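(* Let $V:\mathbb R\to(-\infty,+\infty]$ be lower semicontinuous with $\lim_{|x|\to\infty}\big(\frac{V(x)}2-\log|x|\big)=+\infty$, and assume that its equilibrium measure $\mu_0$ has a density $m_0$ with respect to Lebesgue measure with $m_0\in C^{0,1/2}(\mathbb R)$. For any $n$ and any $x_1,\dots,x_n\in\mathbb R$, $$w_n(x_1,\dots,x_n)=n^2\mathcal F(\mu_0)-n\log n+\frac1\pi W(\nabla H_n',\mathbf 1_{\mathbb R^2})+2n\sum_{i=1}^n\zeta(x_i).$$
   Context: $w_n(x_1,\dots,x_n)=-\sum_{i\neq j}\log|x_i-x_j|+n\sum_{i=1}^nV(x_i)$. Equilibrium measure: $\mu_0$ is the unique minimizer, among probability measures on $\mathbb R$, of $\mathcal F(\mu)=\iint-\log|x-y|\,d\mu(x)d\mu(y)+\int V\,d\mu$; $\Sigma=\mathrm{supp}(\mu_0)$. With $U^{\mu_0}(x)=-\int\log|x-y|\,d\mu_0(y)$ there is a constant $c$ such that $U^{\mu_0}+V/2\ge c$ quasi-everywhere, with equality quasi-everywhere on $\Sigma$; $\zeta:=U^{\mu_0}+V/2-c$. $\delta_{\mathbb R}$ is the measure of length on $\mathbb R\times\{0\}\subset\mathbb R^2$: $\int\varphi\,\delta_{\mathbb R}=\int_{\mathbb R}\varphi(x,0)\,dx$; $\mathbb R$ is identified with $\mathbb R\times\{0\}$. Put $x_i'=nx_i$, $\nu_n'=\sum_{i=1}^n\delta_{x_i'}$, $m_0'(x)=m_0(x/n)$, and $H_n'=-\log|\cdot| *(\nu_n'-m_0'\delta_{\mathbb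 R})$ (convolution in $\mathbb R^2$), i.e. the solution decaying at infinity of $\Delta H_n'=-2\pi(\nu_n'-m_0'\delta_{\mathbb R})$ in $\mathbb R^2$. Finally $$W(\nabla H_n',\mathbf 1_{\mathbb R^2})=\lim_{\eta\to0}\Big(\frac12\int_{\mathbb R^2\setminus\bigcup_{i}B(x_i',\eta)}|\nabla H_n'|^2+\pi n\log\eta\Big).$$ *)

theory Defs
  imports "HOL-Probability.Probability"
begin

definition lower_semicontinuous :: "(real \<Rightarrow> ereal) \<Rightarrow> bool" where
  "lower_semicontinuous V \<longleftrightarrow> (\<forall>x. V x \<le> Liminf (at x) V)"

definition holder_continuous :: "real \<Rightarrow> (real \<Rightarrow> real) \<Rightarrow> bool" where
  "holder_continuous \<alpha> f \<longleftrightarrow> (\<exists>C. \<forall>x y. \<bar>f x - f y\<bar> \<le> C * \<bar>x - y\<bar> powr \<alpha>)"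

definition prob_on_reals :: "real measure \<Rightarrow> bool" where
  "prob_on_reals \<mu> \<longleftrightarrow> prob_space \<mu> \<and> sets \<mu> = sets borel"

definition measure_support :: "real measure \<Rightarrow> real set" where
  "measure_support \<mu> = {x. \<forall>S. open S \<and> x \<in> S \<longrightarrow> emeasure \<mu> S > 0}"

(* Difference of the integrals of the positive and the negative part; e2ennreal sends negative
   numbers to 0. Since \<infinity> + - \<infinity> = \<infinity> for ereal, an integral that is not defined has the value \<infinity>. *)
definition ereal_integral :: "'a measure \<Rightarrow> ('a \<Rightarrow> ereal) \<Rightarrow> ereal" where
  "ereal_integral M f =
     enn2ereal (\<integral>\<^sup>+x. e2ennreal (f x) \<partial>M) - enn2ereal (\<integral>\<^sup>+x. e2ennreal (- f x) \<partial>M)"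

(* - log |t|, with the value + \<infinity> at t = 0 (the library has ln 0 = 0) *)
definition log_kernel :: "real \<Rightarrow> ereal" where
  "log_kernel t = (if t = 0 then \<infinity> else ereal (- ln \<bar>t\<bar>))"

definition log_energy :: "real measure \<Rightarrow> ereal" where
  "log_energy \<mu> = ereal_integral (\<mu> \<Otimes>\<^sub>M \<mu>) (\<lambda>(x, y). log_kernel (x - y))"

definition log_potential :: "real measure \<Rightarrow> real \<Rightarrow> ereal" where
  "log_potential \<mu> x = ereal_integral \<mu> (\<lambda>y. log_kernel (x - y))"

(* The free energy. If V(x) is at least 2 log (1 + |x|) - C, the conventions above only matter for
   measures with infinite V-integral, and these receive the value + \<infinity>. *)
definition free_energy :: "(real \<Rightarrow> ereal) \<Rightarrow> real measure \<Rightarrow> ereal" where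
  "free_energy V \<mu> = log_energy \<mu> + ereal_integral \<mu> V"

definition equilibrium_measure :: "(real \<Rightarrow> ereal) \<Rightarrow> real measure \<Rightarrow> bool" where
  "equilibrium_measure V \<mu> \<longleftrightarrow> (\<forall>\<nu>. is_arg_min (free_energy V) prob_on_reals \<nu> \<longleftrightarrow> \<nu> = \<mu>)"

(* The (inner) logarithmic capacity exp (- inf I), where I is the logarithmic energy and the
   infimum is over the probability measures carried by a compact subset of E. *)
definition log_capacity :: "real set \<Rightarrow> ereal" where
  "log_capacity E =
     (case (INF \<mu> \<in> {\<mu>. prob_on_reals \<mu> \<and> (\<exists>K. compact K \<and> K \<subseteq> E \<and> emeasure \<mu> K = 1)}. log_energy \<mu>) of
        ereal r \<Rightarrow> ereal (exp (- r)) | PInfty \<Rightarrow> 0 | MInfty \<Rightarrow> \<infinity>)"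

definition quasi_everywhere :: "(real \<Rightarrow> bool) \<Rightarrow> bool" where
  "quasi_everywhere P \<longleftrightarrow> log_capacity {x. \<not> P x} = 0"

definition robin_constant :: "(real \<Rightarrow> ereal) \<Rightarrow> real measure \<Rightarrow> real \<Rightarrow> bool" where
  "robin_constant V \<mu> c \<longleftrightarrow>
     quasi_everywhere (\<lambda>x. log_potential \<mu> x + V x / 2 \<ge> ereal c) \<and>
     quasi_everywhere (\<lambda>x. x \<in> measure_support \<mu> \<longrightarrow> log_potential \<mu> x + V x / 2 = ereal c)"

definition zeta :: "(real \<Rightarrow> ereal) \<Rightarrow> real measure \<Rightarrow> real \<Rightarrow> real \<Rightarrow> ereal" where
  "zeta V \<mu> c x = log_potential \<mu> x + V x / 2 - ereal c"

definition hamiltonian :: "(real \<Rightarrow> ereal) \<Rightarrow> nat \<Rightarrow> (nat \<Rightarrow> real) \<Rightarrow> ereal" where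
  "hamiltonian V n x =
     (\<Sum>(i, j) \<in> {(i, j). i \<in> {1..n} \<and> j \<in> {1..n} \<and> i \<noteq> j}. log_kernel (x i - x j))
     + ereal (real n) * (\<Sum>i = 1..n. V (x i))"

(* The plane is the type real \<times> real with its Euclidean norm. *)

definition delta_R :: "(real \<times> real) measure" where
  "delta_R = distr lborel borel (\<lambda>t. (t, 0))"

(* The sum of the Dirac masses at p 1, \<dots>, p n, with multiplicity if points coincide. *)
definition point_measure_sum :: "nat \<Rightarrow> (nat \<Rightarrow> real \<times> real) \<Rightarrow> (real \<times> real) measure" where
  "point_measure_sum n p = distr (count_space {1..n}) borel p"

definition planar_log_conv :: "(real \<times> real) measure \<Rightarrow> real \<times> real \<Rightarrow> real" where
  "planar_log_conv \<nu> p = (\<integral>q. - ln (norm (p - q)) \<partial>\<nu>)"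

definition blown_up_point :: "nat \<Rightarrow> (nat \<Rightarrow> real) \<Rightarrow> nat \<Rightarrow> real \<times> real" where
  "blown_up_point n x i = (real n * x i, 0)"

definition blown_up_field :: "nat \<Rightarrow> (real \<Rightarrow> real) \<Rightarrow> (nat \<Rightarrow> real) \<Rightarrow> real \<times> real \<Rightarrow> real" where
  "blown_up_field n m\<^sub>0 x p =
     planar_log_conv (point_measure_sum n (blown_up_point n x)) p
     - planar_log_conv (density delta_R (\<lambda>q. ennreal (m\<^sub>0 (fst q / real n)))) p"

(* Pointwise gradient, of unspecified value where f is not differentiable. The potential above is
   locally Lipschitz off the points for a bounded, compactly supported density, so this is its
   weak gradient almost everywhere there. *)
definition grad :: "(real \<times> real \<Rightarrow> real) \<Rightarrow> real \<times> real \<Rightarrow> real \<times> real" where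
  "grad f p = (THE D. GDERIV f p :> D)"

definition truncated_energy ::
  "nat \<Rightarrow> (nat \<Rightarrow> real \<times> real) \<Rightarrow> (real \<times> real \<Rightarrow> real \<times> real) \<Rightarrow> real \<Rightarrow> ereal" where
  "truncated_energy n p E \<eta> =
     enn2ereal (\<integral>\<^sup>+q \<in> - (\<Union>i\<in>{1..n}. ball (p i) \<eta>). ennreal ((norm (E q))\<^sup>2) \<partial>lborel) / 2
     + ereal (pi * real n * ln \<eta>)"

(* The renormalized energy W(E, 1), where p 1, \<dots>, p n are the singular points of E. The limit may
   be + \<infinity>; the value is meaningful only if the limit exists. *)
definition renormalized_energy ::
  "nat \<Rightarrow> (nat \<Rightarrow> real \<times> real) \<Rightarrow> (real \<times> real \<Rightarrow> real \<times> real) \<Rightarrow> ereal" where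
  "renormalized_energy n p E = Lim (at_right 0) (truncated_energy n p E)"

end

theory Submission
  imports Defs "HOL-Real_Asymp.Real_Asymp"
begin

text \<open>
The charge \<open>\<nu> = \<Sum>\<^sub>i \<delta>(x\<^sub>i') - m\<^sub>0'\<close> lives on the real axis and is neutral. For \<open>y \<noteq> 0\<close> the squared
field is \<open>\<integral>\<integral> Re 1 / ((z - s) (cnj z - t)) d\<nu>(s) d\<nu>(t)\<close>, and integrating the kernel over a horizontal line gives
\<open>4 \<pi> \<bar>y\<bar> / ((s - t)\<^sup>2 + 4 y\<^sup>2)\<close>. Integrating in \<open>y\<close>, where neutrality removes the contribution of infinity, yields
\<open>\<integral>\<^bsub>\<bar>y\<bar> \<ge> \<epsilon>\<^esub> \<bar>\<nabla>H\<bar>\<^sup>2 = - \<pi> \<integral>\<integral> ln ((s - t)\<^sup>2 + 4 \<epsilon>\<^sup>2) d\<nu> d\<nu>\<close>, so no integration by parts in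
the plane is needed. Removing discs instead of a strip changes the divergent part by the explicit integral of
\<open>1 / \<bar>z\<bar>\<^sup>2\<close> over a disc minus a strip. If two points coincide, the logarithmic divergence is stronger than
\<open>\<pi> n ln \<eta>\<close> compensates and both sides are infinite. Finally, \<open>U + V/2 = c\<close> holds \<open>\<mu>\<^sub>0\<close>-almost everywhere, since sets of
capacity zero are Lebesgue null; this expresses the free energy through \<open>c\<close> and the logarithmic energy.
\<close>

section \<open>Logarithmic potentials and the Cauchy kernel\<close>

text \<open>Strips come first because on a line at height y > 0 all kernels are bounded and the
  charge is finite: Fubini converges absolutely, and the point singularities matter only when the
  strip shrinks. The 4 eps^2 arises because two Cauchy kernels at height y compose to a Poisson
  kernel at height 2y. As eps tends to 0, each ordered pair of coinciding indices contributes ln (2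
  eps) to the mutual logarithm, while its disc minus the strip carries 2 pi ln (eta / (2 eps)) +
  o(1). The same 2 eps occurs in both, so the divergence cancels exactly and leaves ln eta without
  an additive constant. The obstacle is the rest of the squared field near the axis, where cross
  terms between an atom and the density are singular as well. Splitting 1 / |z| into the power 3/4
  of |x| and 1/4 of |y| bounds every such term by products like |x|^(-3/4) |y|^(-1/2), integrable in
  each variable. For distinct points the renormalized energy is thus -pi times the double integral
  of ln |s - t| without self-terms, and the theorem becomes an identity between finite
  quantities.\<close>

lemma half_ln_remainder:
  fixes x y a b :: real
  assumes "y \<noteq> 0" "64 * (a^2 + b^2) \<le> y^2"
  shows "\<bar>ln ((x + a)^2 + (y + b)^2) / 2 - ln (x^2 + y^2) / 2 - (a * x + b * y) / (x^2 + y^2)\<bar>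
    \<le> 10 * (a^2 + b^2) / y^2"
proof -
  \<comment> \<open>With z = (x, y) and h = (a, b), the squared length of z + h is
    \<open>P * (1 + q)\<close>; \<open>w\<close> is the linear term of ln |z + h| and
    \<open>r\<close> is |h|^2 / |z|^2. The factor 64 in the hypothesis means |h| <= |y| / 8, hence
    |\<open>q\<close>| <= 1/2, where the quadratic bound on ln (1 + q) applies.\<close>
  define P w r q where "P = x^2 + y^2" and "w = (a * x + b * y) / P" and "r = (a^2 + b^2) / P"
    and "q = 2 * w + r"
  have P: "P > 0" "y^2 \<le> P" "y^2 > 0"
    using assms by (auto simp: P_def add_nonneg_pos)
  have r0: "0 \<le> r" using P(1) by (simp add: r_def)
  have ry: "r \<le> (a^2 + b^2) / y^2" unfolding r_def by (intro divide_left_mono mult_pos_pos P) auto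
  also have "\<dots> \<le> 1 / 64" using assms P by (simp add: field_simps)
  finally have r1: "r \<le> 1 / 64" .
  \<comment> \<open>Lagrange's identity, which yields Cauchy-Schwarz in the plane and so
    \<open>w^2 \<le> r\<close>.\<close>
  have "(a * x + b * y)^2 + (a * y - b * x)^2 = (a^2 + b^2) * P"
    unfolding P_def by algebra
  then have "(a * x + b * y)^2 \<le> (a^2 + b^2) * P"
    using zero_le_power2[of "a * y - b * x"] by linarith
  then have wr: "w^2 \<le> r"
    using P by (simp add: w_def r_def power_divide divide_simps power2_eq_square)
  then have "w^2 \<le> (1 / 8)^2" using r1 by (simp add: power2_eq_square)
  then have w1: "\<bar>w\<bar> \<le> 1 / 8" using abs_le_square_iff[of w "1/8"] by simp
  have q1: "\<bar>q\<bar> \<le> 1 / 2" using w1 r0 r1 unfolding q_def by linarith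
  have "q^2 \<le> 8 * w^2 + 2 * r^2"
    using zero_le_power2[of "2 * w - r"] by (simp add: q_def power2_eq_square algebra_simps)
  also have "r^2 \<le> (1/64) * r" using mult_right_mono[OF r1 r0] by (simp add: power2_eq_square)
  finally have q2: "q^2 \<le> 9 * r" using wr r0 by simp
  have "(x + a)^2 + (y + b)^2 = P * (1 + q)"
  proof -
    have "P * w = a * x + b * y" "P * r = a^2 + b^2" using P(1) by (auto simp: w_def r_def)
    then have "P * (1 + q) = P + (2 * (a * x + b * y) + (a^2 + b^2))"
      unfolding q_def by (simp add: distrib_left)
    then show ?thesis by (simp add: P_def power2_eq_square algebra_simps)
  qed
  then have "ln ((x + a)^2 + (y + b)^2) = ln P + ln (1 + q)"
    using P(1) q1 by (simp add: ln_mult_pos abs_le_iff)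
  then have "\<bar>ln ((x + a)^2 + (y + b)^2) / 2 - ln P / 2 - w\<bar> = \<bar>(ln (1 + q) - q) / 2 + r / 2\<bar>"
    by (simp add: q_def field_simps)
  also have "\<dots> \<le> q^2 + r / 2"
    using abs_ln_one_plus_x_minus_x_bound[OF q1] r0 by (intro order_trans[OF abs_triangle_ineq]) simp
  also have "\<dots> \<le> 10 * r" using q2 r0 by simp
  also have "\<dots> \<le> 10 * ((a^2 + b^2) / y^2)" using mult_left_mono[OF ry, of 10] by simp
  finally show ?thesis by (simp add: P_def w_def)
qed

abbreviation lnorm :: "real \<Rightarrow> real \<Rightarrow> real" where
  "lnorm a b \<equiv> ln (a^2 + b^2) / 2"

text \<open>The remainder in \<open>half_ln_remainder\<close> is quadratic in the increment and
  uniform in \<open>t\<close>, so integrating it against a finite measure gives differentiability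
  directly. \<open>N\<close> and \<open>u\<close> are general because two uses follow: a charge with
  its positions, and pairs of charges with their differences.\<close>

lemma finite_measure_half_ln_has_derivative:
  fixes g u :: "'a \<Rightarrow> real" and x y B :: real
  assumes "finite_measure N" and [measurable]: "g \<in> borel_measurable N" "u \<in> borel_measurable N"
    and g: "\<And>t. \<bar>g t\<bar> \<le> 1" and u: "\<And>t. \<bar>u t\<bar> \<le> B" and y: "y \<noteq> 0"
  shows "((\<lambda>p. \<integral>t. g t * (lnorm (fst p - u t) (snd p)) \<partial>N) has_derivative
    (\<lambda>h. fst h * (\<integral>t. g t * ((x - u t) / ((x - u t)^2 + y^2)) \<partial>N) +
         snd h * (\<integral>t. g t * (y / ((x - u t)^2 + y^2)) \<partial>N))) (at (x, y))"
proof -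
  interpret finite_measure N by fact
  define F where "F = (\<lambda>p::real\<times>real. \<integral>t. g t * (lnorm (fst p - u t) (snd p)) \<partial>N)"
  define D where "D = (\<lambda>h. fst h * (\<integral>t. g t * ((x - u t) / ((x - u t)^2 + y^2)) \<partial>N) +
         snd h * (\<integral>t. g t * (y / ((x - u t)^2 + y^2)) \<partial>N))"
  have intF: "integrable N (\<lambda>t. g t * (lnorm (a - u t) b))" if "b \<noteq> 0" for a b
  proof (rule integrable_const_bound)
    define C where "C = (\<bar>ln (b^2)\<bar> + \<bar>ln ((\<bar>a\<bar> + B)^2 + b^2)\<bar>) / 2"
    show "AE t in N. norm (g t * (lnorm (a - u t) b)) \<le> C"
    proof (rule AE_I2)
      fix t
      have b: "b^2 > 0" using that by simp
      have "\<bar>a - u t\<bar> \<le> \<bar>a\<bar> + B" using u[of t] by linarith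
      then have "(a - u t)^2 \<le> (\<bar>a\<bar> + B)^2" by (metis abs_ge_zero power2_abs power_mono)
      then have "ln ((a - u t)^2 + b^2) \<le> ln ((\<bar>a\<bar> + B)^2 + b^2)"
        using b by (subst ln_le_cancel_iff) (auto intro!: add_nonneg_pos)
      moreover have "ln (b^2) \<le> ln ((a - u t)^2 + b^2)"
        using b by (subst ln_le_cancel_iff) (auto intro!: add_nonneg_pos)
      moreover have "\<bar>v / 2\<bar> \<le> (\<bar>l\<bar> + \<bar>w\<bar>) / 2" if "l \<le> v" "v \<le> w" for l v w :: real
      proof -
        have "\<bar>v\<bar> \<le> \<bar>l\<bar> + \<bar>w\<bar>" using that by linarith
        then show ?thesis by simp
      qed
      ultimately have "\<bar>ln ((a - u t)^2 + b^2) / 2\<bar> \<le> C" unfolding C_def by blast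
      then show "norm (g t * (lnorm (a - u t) b)) \<le> C"
        using mult_mono[OF g[of t] _ _ abs_ge_zero] by (auto simp: abs_mult)
    qed
  qed simp
  have P: "(x - u t)^2 + y^2 \<ge> y^2" "y^2 > 0" for t using y by auto
  have int1: "integrable N (\<lambda>t. g t * ((x - u t) / ((x - u t)^2 + y^2)))"
  proof (rule integrable_const_bound)
    have "\<bar>(x - u t) / ((x - u t)^2 + y^2)\<bar> \<le> (\<bar>x\<bar> + B) / y^2" for t
      unfolding abs_divide using P(1)[of t] P(2) u[of t] by (intro frac_le) auto
    then show "AE t in N. norm (g t * ((x - u t) / ((x - u t)^2 + y^2))) \<le> (\<bar>x\<bar> + B) / y^2"
      using mult_mono[OF g] by (fastforce simp: abs_mult simp del: abs_divide times_divide_eq_right)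
  qed simp
  have int2: "integrable N (\<lambda>t. g t * (y / ((x - u t)^2 + y^2)))"
  proof (rule integrable_const_bound)
    have "\<bar>y / ((x - u t)^2 + y^2)\<bar> \<le> \<bar>y\<bar> / y^2" for t
      unfolding abs_divide using P(1)[of t] P(2) by (intro frac_le) auto
    then show "AE t in N. norm (g t * (y / ((x - u t)^2 + y^2))) \<le> \<bar>y\<bar> / y^2"
      using mult_mono[OF g] by (fastforce simp: abs_mult simp del: abs_divide times_divide_eq_right)
  qed simp
  define C where "C = 10 / y^2 * measure N (space N)"
  have bound: "norm (F ((x, y) + h) - F (x, y) - D h) / norm h \<le> C * norm h"
    if "norm h \<le> \<bar>y\<bar> / 8" for h
  proof (cases "h = 0")
    case False
    obtain a b where h: "h = (a, b)" by (cases h)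
    have n2: "a^2 + b^2 = (norm h)^2" by (simp add: h norm_Pair)
    have "(norm h)^2 \<le> (\<bar>y\<bar> / 8)^2" using that by (intro power_mono) auto
    then have small: "64 * (a^2 + b^2) \<le> y^2" unfolding n2 by (simp add: power_divide)
    \<comment> \<open>The displaced point must stay off the axis for \<open>intF\<close> to apply;
      the smallness of h forbids |b| = |y|.\<close>
    have yb: "y + b \<noteq> 0"
    proof
      assume "y + b = 0"
      then have "b^2 = y^2" by (simp add: eq_neg_iff_add_eq_0[symmetric] add.commute)
      moreover have False if "B = Y" "64 * (A + B) \<le> Y" "0 < Y" "0 \<le> A" for A B Y :: real
        using that by argo
      ultimately show False using small P(2) zero_le_power2 by blast
    qed
    let ?X = "(\<integral>t. g t * (lnorm (x + a - u t) (y + b)) - g t * (lnorm (x - u t) y)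
        - (a * (g t * ((x - u t) / ((x - u t)^2 + y^2))) + b * (g t * (y / ((x - u t)^2 + y^2)))) \<partial>N)"
    have "F ((x, y) + h) - F (x, y) - D h = ?X"
      using intF[OF yb, of "x + a"] intF[OF y, of x] int1 int2
      by (simp add: F_def D_def h del: times_divide_eq_right times_divide_eq_left)
    moreover have "norm ?X \<le> (\<integral>t. 10 * (a^2 + b^2) / y^2 \<partial>N)"
    proof (rule order_trans[OF integral_norm_bound integral_mono])
      fix t
      have "norm (g t * (lnorm (x + a - u t) (y + b)) - g t * (lnorm (x - u t) y)
        - (a * (g t * ((x - u t) / ((x - u t)^2 + y^2))) + b * (g t * (y / ((x - u t)^2 + y^2)))))
        = \<bar>g t\<bar> * \<bar>lnorm (x - u t + a) (y + b) - lnorm (x - u t) y -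
           (a * (x - u t) + b * y) / ((x - u t)^2 + y^2)\<bar>"
      proof -
        have "x + a - u t = x - u t + a" by simp
        moreover have "(a * (x - u t) + b * y) / Q = a * ((x - u t) / Q) + b * (y / Q)" for Q
          by (simp add: add_divide_distrib)
        ultimately show ?thesis
          unfolding real_norm_def abs_mult[symmetric]
          by (simp only: right_diff_distrib distrib_left mult.left_commute)
      qed
      also have "\<dots> \<le> 1 * (10 * (a^2 + b^2) / y^2)"
        by (rule mult_mono[OF g half_ln_remainder[OF y small]]) simp_all
      finally show "norm (g t * (lnorm (x + a - u t) (y + b)) - g t * (lnorm (x - u t) y)
        - (a * (g t * ((x - u t) / ((x - u t)^2 + y^2))) + b * (g t * (y / ((x - u t)^2 + y^2)))))
        \<le> 10 * (a^2 + b^2) / y^2" by simp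
    qed (use intF[OF yb, of "x + a"] intF[OF y, of x] int1 int2
        in \<open>auto simp del: times_divide_eq_right times_divide_eq_left\<close>)
    moreover have "(\<integral>t. 10 * (a^2 + b^2) / y^2 \<partial>N) = C * norm h * norm h"
      unfolding n2 by (simp add: C_def power2_eq_square)
    ultimately have "norm (F ((x, y) + h) - F (x, y) - D h) \<le> C * norm h * norm h" by (simp only:)
    then show ?thesis using False by (simp add: divide_le_eq)
  qed simp
  have "(F has_derivative D) (at (x, y))"
  proof (rule has_derivativeI_sandwich[where e="\<bar>y\<bar> / 8" and H="\<lambda>p. C * norm (p - (x, y))"])
    show "bounded_linear D" unfolding D_def
      by (intro bounded_linear_add bounded_linear_mult_const bounded_linear_fst bounded_linear_snd)
    show "((\<lambda>p. C * norm (p - (x, y))) \<longlongrightarrow> 0) (at (x, y))"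
      by (auto intro!: tendsto_eq_intros)
    show "norm (F p - F (x, y) - D (p - (x, y))) / norm (p - (x, y)) \<le> C * norm (p - (x, y))"
      if "p \<noteq> (x, y)" "dist p (x, y) < \<bar>y\<bar> / 8" for p
      using bound[of "p - (x, y)"] that by (simp add: dist_norm)
  qed (use y in auto)
  then show ?thesis unfolding F_def D_def .
qed

section \<open>Integrals over horizontal lines\<close>

lemma has_bochner_integral_FTC_UNIV:
  fixes f F :: "real \<Rightarrow> real"
  assumes "\<And>x. (F has_real_derivative f x) (at x)" "continuous_on UNIV f" "integrable lborel f"
    and "(F \<longlongrightarrow> A) at_bot" "(F \<longlongrightarrow> B) at_top"
  shows "has_bochner_integral lborel f (B - A)"
proof -
  have "(LBINT x=-\<infinity>..\<infinity>. f x) = B - A"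
    using assms
    by (intro interval_integral_FTC_integrable[where F=F])
       (auto simp: continuous_on_eq_continuous_at ereal_tendsto_simps set_integrable_def
         simp flip: has_real_derivative_iff_has_vector_derivative)
  then show ?thesis
    using assms by (simp add: has_bochner_integral_iff interval_lebesgue_integral_def set_lebesgue_integral_def)
qed

lemma has_bochner_integral_FTC_UNIV_nonneg:
  fixes f F :: "real \<Rightarrow> real"
  assumes "\<And>x. (F has_real_derivative f x) (at x)" "continuous_on UNIV f" "\<And>x. 0 \<le> f x"
    and "(F \<longlongrightarrow> A) at_bot" "(F \<longlongrightarrow> B) at_top"
  shows "has_bochner_integral lborel f (B - A)"
proof (rule has_bochner_integral_FTC_UNIV)
  have "set_integrable lborel (einterval (-\<infinity>) \<infinity>) f"
    by (rule interval_integral_FTC_nonneg(1)[where F=F and A=A and B=B])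
       (use assms in \<open>auto simp: continuous_on_eq_continuous_at ereal_tendsto_simps\<close>)
  then show "integrable lborel f" by (simp add: set_integrable_def)
qed fact+

text \<open>Residues would give the integral of \<open>K\<close>; an explicit primitive is used
  instead. The value is 2 pi^2 times the Poisson kernel at height 2y, the origin of the doubled
  heights below. The pointwise bound, an instance of 2 |a b| <= a^2 + b^2, is what later justifies
  Fubini.\<close>

lemma cauchy_kernel_x_integral:
  fixes s t y :: real
  assumes y: "y > 0"
  defines "K \<equiv> \<lambda>x. ((x - s) * (x - t) + y^2) / (((x - s)^2 + y^2) * ((x - t)^2 + y^2))"
  shows "has_bochner_integral lborel (\<lambda>x. 1 / ((x - s)^2 + y^2)) (pi / y)"
    and "\<And>x. \<bar>K x\<bar> \<le> (1 / ((x - s)^2 + y^2) + 1 / ((x - t)^2 + y^2)) / 2"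
    and "has_bochner_integral lborel K (4 * pi * y / ((s - t)^2 + 4 * y^2))"
proof -
  have pos: "(x - s)^2 + y^2 > 0" for x s using y by (simp add: add_nonneg_pos)
  have at_bot: "filterlim (\<lambda>x. (x - s) / y) at_bot at_bot" for s
    using y by real_asymp
  have at_top: "filterlim (\<lambda>x. (x - s) / y) at_top at_top" for s
    using y by real_asymp
  have lim_div: "((\<lambda>x. f x / y) \<longlongrightarrow> l / y) F" if "(f \<longlongrightarrow> l) F" for f :: "real \<Rightarrow> real" and l F
    using that y by (intro tendsto_divide) auto
  note lim = filterlim_compose[OF tendsto_arctan_at_bot at_bot] filterlim_compose[OF tendsto_arctan_at_top at_top]
  show one: "has_bochner_integral lborel (\<lambda>x. 1 / ((x - s)^2 + y^2)) (pi / y)" for s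
  proof -
    let ?f = "\<lambda>x. 1 / ((x - s)^2 + y^2)"
    have D: "((\<lambda>x. arctan ((x - s) / y) / y) has_real_derivative ?f x) (at x)" for x
      using y pos[of x s] by (auto intro!: derivative_eq_intros simp: divide_simps) (simp_all add: power2_eq_square algebra_simps)
    have c: "continuous_on UNIV ?f" using pos[of _ s] by (intro continuous_intros) (metis less_irrefl)
    have "has_bochner_integral lborel ?f (pi / 2 / y - (- (pi / 2)) / y)"
      using D pos[of _ s] c lim_div[OF lim(1)[of s]] lim_div[OF lim(2)[of s]]
      by (intro has_bochner_integral_FTC_UNIV_nonneg[where F="\<lambda>x. arctan ((x - s) / y) / y"])
         (auto intro: less_imp_le)
    then show ?thesis by (simp add: field_simps)
  qed
  show bound: "\<bar>K x\<bar> \<le> (1 / ((x - s)^2 + y^2) + 1 / ((x - t)^2 + y^2)) / 2" for x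
  proof -
    define P Q n where "P = (x - s)^2 + y^2" and "Q = (x - t)^2 + y^2" and "n = (x - s) * (x - t) + y^2"
    have "P > 0" "Q > 0" using pos by (auto simp: P_def Q_def)
    have "\<bar>c * d + e\<bar> \<le> ((c^2 + e) + (d^2 + e)) / 2" if "0 \<le> e" for c d e :: real
      using that zero_le_power2[of "c - d"] zero_le_power2[of "c + d"]
      unfolding abs_le_iff by (simp add: power2_eq_square algebra_simps)
    then have "\<bar>n\<bar> \<le> (P + Q) / 2" unfolding P_def Q_def n_def by simp
    then show ?thesis using \<open>P > 0\<close> \<open>Q > 0\<close>
      unfolding K_def P_def[symmetric] Q_def[symmetric] n_def[symmetric]
      by (simp add: abs_mult abs_divide field_simps)
  qed
  have intK: "integrable lborel K"
  proof (rule Bochner_Integration.integrable_bound)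
    show "integrable lborel (\<lambda>x. (1 / ((x - s)^2 + y^2) + 1 / ((x - t)^2 + y^2)) / 2)"
      using one by (auto simp: has_bochner_integral_iff)
    show "AE x in lborel. norm (K x) \<le> norm ((1 / ((x - s)^2 + y^2) + 1 / ((x - t)^2 + y^2)) / 2)"
      using bound by (intro AE_I2) (metis abs_ge_self order_trans real_norm_def)
  qed (simp add: K_def)
  define E where "E = (s - t)^2 + 4 * y^2"
  have E: "E > 0" using y by (simp add: E_def add_nonneg_pos)
  \<comment> \<open>Partial fractions of \<open>K\<close>: the two logarithms cancel at both ends of
    the line, and each arctangent jumps by pi, so the total increment is 4 pi y /
    \<open>E\<close>.\<close>
  define G where "G = (\<lambda>x. ((t - s) * ((ln ((x - t)^2 + y^2) - ln ((x - s)^2 + y^2)) / 2) + 2 * y * (arctan ((x - t) / y) + arctan ((x - s) / y))) / E)"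
  have D: "(G has_real_derivative K x) (at x)" for x
  proof -
    define P Q where "P = (x - s)^2 + y^2" and "Q = (x - t)^2 + y^2"
    have PQ: "P > 0" "Q > 0" using pos by (auto simp: P_def Q_def)
    have at: "((\<lambda>x. arctan ((x - s) / y)) has_real_derivative y / ((x - s)^2 + y^2)) (at x)" for s
      using y pos[of x s] by (auto intro!: derivative_eq_intros simp: divide_simps) (simp_all add: power2_eq_square algebra_simps)
    have l: "((\<lambda>x. ln ((x - s)^2 + y^2)) has_real_derivative 2 * (x - s) / ((x - s)^2 + y^2)) (at x)" for s
      using pos[of x s] by (auto intro!: derivative_eq_intros)
    have "(G has_real_derivative ((t - s) * ((2 * (x - t) / Q - 2 * (x - s) / P) / 2) + 2 * y * (y / Q + y / P)) / E) (at x)"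
      unfolding G_def P_def Q_def
      by (intro DERIV_cdivide DERIV_add DERIV_cmult DERIV_diff at l)
    also have "((t - s) * ((2 * (x - t) / Q - 2 * (x - s) / P) / 2) + 2 * y * (y / Q + y / P)) / E = K x"
    proof -
      have "((t - s) * ((2 * (x - t) / Q - 2 * (x - s) / P) / 2) + 2 * y * (y / Q + y / P))
        = ((t - s) * ((x - t) * P - (x - s) * Q) + 2 * y^2 * (P + Q)) / (P * Q)"
        using PQ by (simp add: field_simps power2_eq_square)
      also have "(t - s) * ((x - t) * P - (x - s) * Q) + 2 * y^2 * (P + Q) = ((x - s) * (x - t) + y^2) * E"
        unfolding P_def Q_def E_def by algebra
      finally show ?thesis using E by (simp add: K_def P_def Q_def)
    qed
    finally show ?thesis .
  qed
  have "continuous_on UNIV K"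
    unfolding K_def using pos by (intro continuous_intros) (metis less_irrefl mult_eq_0_iff)
  have liml: "((\<lambda>x. (ln ((x - t)^2 + y^2) - ln ((x - s)^2 + y^2)) / 2) \<longlongrightarrow> 0) at_top"
    "((\<lambda>x. (ln ((x - t)^2 + y^2) - ln ((x - s)^2 + y^2)) / 2) \<longlongrightarrow> 0) at_bot"
    by real_asymp+
  have "has_bochner_integral lborel K (((t - s) * 0 + 2 * y * (pi / 2 + pi / 2)) / E - ((t - s) * 0 + 2 * y * (- (pi / 2) + - (pi / 2))) / E)"
  proof (rule has_bochner_integral_FTC_UNIV[where F=G])
    show "(G \<longlongrightarrow> ((t - s) * 0 + 2 * y * (pi / 2 + pi / 2)) / E) at_top"
      unfolding G_def by (intro tendsto_intros lim liml) (use E in simp)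
    show "(G \<longlongrightarrow> ((t - s) * 0 + 2 * y * (- (pi / 2) + - (pi / 2))) / E) at_bot"
      unfolding G_def by (intro tendsto_intros lim liml) (use E in simp)
  qed fact+
  then show "has_bochner_integral lborel K (4 * pi * y / ((s - t)^2 + 4 * y^2))"
    unfolding E_def[symmetric] by (simp add: algebra_simps diff_divide_distrib add_divide_distrib)
qed

section \<open>The energy outside a strip\<close>

text \<open>A signed charge on the axis, given by a finite positive measure with a bounded sign and
  a bounded position. Signed double integrals become ordinary integrals over a product measure, and
  bounds valid at every point make them integrable at once.\<close>

locale planar_charge = finite_measure M for M :: "'a measure" +
  fixes sg pos :: "'a \<Rightarrow> real" and B :: real
  assumes sg_measurable [measurable]: "sg \<in> borel_measurable M"
    and pos_measurable [measurable]: "pos \<in> borel_measurable M"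
    and sg_le: "\<And>t. \<bar>sg t\<bar> \<le> 1" and pos_le: "\<And>t. \<bar>pos t\<bar> \<le> B"
begin

sublocale pair: pair_sigma_finite M M ..

sublocale MM: finite_measure "M \<Otimes>\<^sub>M M"
  by (rule finite_measure_pair_measure) unfold_locales

abbreviation M2 where "M2 \<equiv> M \<Otimes>\<^sub>M M"

definition field_x :: "real \<Rightarrow> real \<Rightarrow> real" where
  "field_x x y = (\<integral>t. sg t * ((x - pos t) / ((x - pos t)^2 + y^2)) \<partial>M)"

definition field_y :: "real \<Rightarrow> real \<Rightarrow> real" where
  "field_y x y = (\<integral>t. sg t * (y / ((x - pos t)^2 + y^2)) \<partial>M)"

definition field_sq :: "real \<times> real \<Rightarrow> real" where
  "field_sq p = (field_x (fst p) (snd p))^2 + (field_y (fst p) (snd p))^2"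

text \<open>Interaction of the charge with a copy of itself lifted to height 2y. The shape
  \<open>0 - ...\<close> exhibits it as the planar potential of the pair charge at the point (0,
  2y), so that the derivative formula above applies to it.\<close>

definition mutual_log :: "real \<Rightarrow> real" where
  "mutual_log y = (\<integral>st. sg (fst st) * sg (snd st) * (lnorm (0 - (pos (fst st) - pos (snd st))) (2 * y)) \<partial>(M \<Otimes>\<^sub>M M))"

lemma field_sq_measurable [measurable]: "field_sq \<in> borel_measurable borel"
proof -
  have "field_sq \<in> borel_measurable (borel \<Otimes>\<^sub>M borel)"
    unfolding field_sq_def field_x_def field_y_def by measurable
  then show ?thesis by (simp add: borel_prod)
qed

lemma gderiv_log_potential:
  assumes "y \<noteq> 0"
  shows "GDERIV (\<lambda>p. \<integral>t. sg t * (lnorm (fst p - pos t) (snd p)) \<partial>M) (x, y) :> (field_x x y, field_y x y)"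
  using finite_measure_half_ln_has_derivative[OF finite_measure_axioms sg_measurable pos_measurable sg_le pos_le assms, of x]
  unfolding gderiv_def field_x_def field_y_def by (simp add: inner_prod_def)

lemma field_sq_reflect: "field_sq (x, - y) = field_sq (x, y)"
proof -
  have "field_y x (- y) = - field_y x y"
    unfolding field_y_def by (simp flip: Bochner_Integration.integral_minus)
  then show ?thesis by (simp add: field_sq_def field_x_def)
qed

lemma integral_mult_pair:
  fixes f g :: "'a \<Rightarrow> real"
  assumes [measurable]: "f \<in> borel_measurable M" "g \<in> borel_measurable M"
    and "\<And>t. \<bar>f t\<bar> \<le> A" "\<And>t. \<bar>g t\<bar> \<le> A"
  shows "integrable M2 (\<lambda>st. f (fst st) * g (snd st))"
    and "(\<integral>t. f t \<partial>M) * (\<integral>t. g t \<partial>M) = (\<integral>st. f (fst st) * g (snd st) \<partial>M2)"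
proof -
  have A: "0 \<le> A" using assms(3)[of undefined] by linarith
  show int: "integrable M2 (\<lambda>st. f (fst st) * g (snd st))"
    using assms A by (intro MM.integrable_const_bound[where B="A * A"]) (auto simp: abs_mult intro!: mult_mono)
  show "(\<integral>t. f t \<partial>M) * (\<integral>t. g t \<partial>M) = (\<integral>st. f (fst st) * g (snd st) \<partial>M2)"
    using pair.integral_fst'[of "\<lambda>st. f (fst st) * g (snd st)"] int by simp
qed

text \<open>The squared integrals become double integrals, and Fubini moves the x-integral inside:
  the kernel is dominated by Cauchy densities of mass pi / y, uniformly over the finite measure of
  pairs. \<open>0 \<le> J\<close> is recorded because \<open>ennreal\<close> would hide a negative
  value.\<close>

lemma field_sq_row:
  assumes y: "y > 0"
  defines "J \<equiv> (\<integral>st. sg (fst st) * sg (snd st) * (4 * pi * y / ((pos (fst st) - pos (snd st))^2 + 4 * y^2)) \<partial>M2)"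
  shows "(\<integral>\<^sup>+x. ennreal (field_sq (x, y)) \<partial>lborel) = ennreal J" and "0 \<le> J"
proof -
  define K where "K = (\<lambda>x s t. ((x - s) * (x - t) + y^2) / (((x - s)^2 + y^2) * ((x - t)^2 + y^2)))"
  define f where "f = (\<lambda>x st. sg (fst st) * sg (snd st) * K x (pos (fst st)) (pos (snd st)))"
  interpret L: pair_sigma_finite lborel "M \<Otimes>\<^sub>M M" ..
  have P: "(x - t)^2 + y^2 > 0" for x t using y by (simp add: add_nonneg_pos)
  have [measurable]: "case_prod f \<in> borel_measurable (lborel \<Otimes>\<^sub>M M2)"
    unfolding f_def K_def by measurable
  have int: "integrable (lborel \<Otimes>\<^sub>M M2) (case_prod f)"
  proof (rule integrableI_bounded)
    have "(\<integral>\<^sup>+z. norm (case_prod f z) \<partial>(lborel \<Otimes>\<^sub>M M2)) = (\<integral>\<^sup>+st. (\<integral>\<^sup>+x. norm (f x st) \<partial>lborel) \<partial>M2)"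
      by (subst L.nn_integral_snd[symmetric]) auto
    also have "\<dots> \<le> (\<integral>\<^sup>+st. ennreal (pi / y) \<partial>M2)"
    proof (rule nn_integral_mono)
      fix st :: "'a \<times> 'a"
      let ?s = "pos (fst st)" and ?t = "pos (snd st)"
      have "\<bar>sg (fst st) * sg (snd st)\<bar> \<le> 1 * 1"
        unfolding abs_mult by (intro mult_mono sg_le) auto
      then have "norm (f x st) \<le> \<bar>K x ?s ?t\<bar>" for x
        using mult_right_mono[of "\<bar>sg (fst st) * sg (snd st)\<bar>" 1 "\<bar>K x ?s ?t\<bar>"] by (simp add: f_def abs_mult)
      then have le: "norm (f x st) \<le> (1 / ((x - ?s)^2 + y^2) + 1 / ((x - ?t)^2 + y^2)) / 2" for x
        using cauchy_kernel_x_integral(2)[OF y, of x ?s ?t] unfolding K_def by (rule order_trans)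
      have "has_bochner_integral lborel (\<lambda>x. (1 / ((x - ?s)^2 + y^2) + 1 / ((x - ?t)^2 + y^2)) / 2) ((pi / y + pi / y) / 2)"
        by (intro has_bochner_integral_divide_zero has_bochner_integral_add cauchy_kernel_x_integral(1) y)
      then have "(\<integral>\<^sup>+x. ennreal ((1 / ((x - ?s)^2 + y^2) + 1 / ((x - ?t)^2 + y^2)) / 2) \<partial>lborel) = ennreal (pi / y)"
        using P by (subst nn_integral_eq_integral) (auto simp: has_bochner_integral_iff less_imp_le)
      then show "(\<integral>\<^sup>+x. norm (f x st) \<partial>lborel) \<le> ennreal (pi / y)"
        using le by (metis (no_types, lifting) ennreal_leI nn_integral_mono)
    qed
    also have "\<dots> < \<infinity>"
      by (simp add: ennreal_mult_less_top MM.emeasure_eq_measure)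
    finally show "(\<integral>\<^sup>+z. norm (case_prod f z) \<partial>(lborel \<Otimes>\<^sub>M M2)) < \<infinity>" .
  qed simp
  have row: "field_sq (x, y) = (\<integral>st. f x st \<partial>M2)" for x
  proof -
    have Py: "(x - pos t)^2 + y^2 \<ge> y^2" "y^2 > 0" for t using y by auto
    define A where "A = (\<bar>x\<bar> + B + \<bar>y\<bar>) / y^2"
    have B: "0 \<le> B" using pos_le[of undefined] by linarith
    have "\<bar>(x - pos t) / ((x - pos t)^2 + y^2)\<bar> \<le> A" for t
      unfolding abs_divide A_def using Py(1)[of t] Py(2) pos_le[of t] by (intro frac_le) auto
    then have b1: "\<bar>sg t * ((x - pos t) / ((x - pos t)^2 + y^2))\<bar> \<le> A" for t
      using mult_mono[OF sg_le[of t] _ _ abs_ge_zero] by (fastforce simp: abs_mult)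
    have "\<bar>y / ((x - pos t)^2 + y^2)\<bar> \<le> A" for t
      unfolding abs_divide A_def using Py(1)[of t] Py(2) B by (intro frac_le) auto
    then have b2: "\<bar>sg t * (y / ((x - pos t)^2 + y^2))\<bar> \<le> A" for t
      using mult_mono[OF sg_le[of t] _ _ abs_ge_zero] by (fastforce simp: abs_mult)
    have m [measurable]: "(\<lambda>t. sg t * ((x - pos t) / ((x - pos t)^2 + y^2))) \<in> borel_measurable M"
      "(\<lambda>t. sg t * (y / ((x - pos t)^2 + y^2))) \<in> borel_measurable M" by measurable
    note p1 = integral_mult_pair[OF m(1) m(1) b1 b1] and p2 = integral_mult_pair[OF m(2) m(2) b2 b2]
    have "field_sq (x, y) = (\<integral>st. sg (fst st) * ((x - pos (fst st)) / ((x - pos (fst st))^2 + y^2)) *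
        (sg (snd st) * ((x - pos (snd st)) / ((x - pos (snd st))^2 + y^2))) +
        sg (fst st) * (y / ((x - pos (fst st))^2 + y^2)) *
        (sg (snd st) * (y / ((x - pos (snd st))^2 + y^2))) \<partial>M2)"
      unfolding field_sq_def field_x_def field_y_def fst_conv snd_conv power2_eq_square[of "integral\<^sup>L _ _"]
      by (subst Bochner_Integration.integral_add) (simp_all only: p1 p2)
    also have "\<dots> = (\<integral>st. f x st \<partial>M2)"
      unfolding f_def K_def
      by (intro Bochner_Integration.integral_cong refl)
         (simp add: add_divide_distrib distrib_left power2_eq_square mult_ac)
    finally show ?thesis .
  qed
  have intx: "integrable lborel (\<lambda>x. field_sq (x, y))"
    using L.integrable_fst[OF int] by (simp add: row)
  have "(\<integral>x. field_sq (x, y) \<partial>lborel) = (\<integral>st. (\<integral>x. f x st \<partial>lborel) \<partial>M2)"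
    using L.Fubini_integral[OF int] by (simp add: row)
  also have "\<dots> = J"
    unfolding J_def f_def K_def
    using cauchy_kernel_x_integral(3)[OF y] by (intro Bochner_Integration.integral_cong refl)
      (simp add: has_bochner_integral_iff del: times_divide_eq_right)
  finally have J: "(\<integral>x. field_sq (x, y) \<partial>lborel) = J" .
  show "0 \<le> J" unfolding J[symmetric] by (rule integral_nonneg_AE) (simp add: field_sq_def)
  show "(\<integral>\<^sup>+x. ennreal (field_sq (x, y)) \<partial>lborel) = ennreal J"
    using intx J by (subst nn_integral_eq_integral) (auto simp: field_sq_def)
qed

text \<open>Neutrality of the charge enters only here: it removes the logarithmic divergence at infinity.\<close>

lemma mutual_log_tendsto_0:
  assumes neutral: "(\<integral>t. sg t \<partial>M) = 0"
  shows "(mutual_log \<longlongrightarrow> 0) at_top"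
proof -
  define d where "d = (\<lambda>st. (pos (fst st) - pos (snd st))^2)"
  have d: "0 \<le> d st" "d st \<le> (2 * B)^2" for st
  proof -
    have "\<bar>pos (fst st) - pos (snd st)\<bar> \<le> 2 * B" using pos_le[of "fst st"] pos_le[of "snd st"] by linarith
    then show "d st \<le> (2 * B)^2" unfolding d_def by (metis abs_ge_zero power2_abs power_mono)
  qed (simp add: d_def)
  have zero: "(\<integral>st. sg (fst st) * sg (snd st) \<partial>M2) = 0"
    and sgi: "integrable M2 (\<lambda>st. sg (fst st) * sg (snd st))"
    using integral_mult_pair[OF sg_measurable sg_measurable sg_le sg_le] neutral by simp_all
  have dm [measurable]: "d \<in> borel_measurable M2" unfolding d_def by measurable
  have sg2: "\<bar>sg (fst st) * sg (snd st)\<bar> \<le> 1" for st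
    using mult_mono[OF sg_le sg_le, of "fst st" "snd st"] by (simp add: abs_mult mult.commute)
  have bd: "\<bar>ln (1 + d st / (2 * y)^2) / 2\<bar> \<le> (2 * B)^2 / (2 * y)^2" if "y > 0" for y st
  proof -
    have "0 \<le> d st / (2 * y)^2" using d by simp
    moreover have "ln (1 + d st / (2 * y)^2) \<le> d st / (2 * y)^2"
      using d by (intro ln_add_one_self_le_self) simp
    moreover have "d st / (2 * y)^2 \<le> (2 * B)^2 / (2 * y)^2"
      using d by (intro divide_right_mono) auto
    ultimately show ?thesis by simp
  qed
  have le: "norm (sg (fst st) * sg (snd st) * (ln (1 + d st / (2 * y)^2) / 2)) \<le> (2 * B)^2 / (2 * y)^2"
    if "y > 0" for y st
  proof -
    have "norm (sg (fst st) * sg (snd st) * (ln (1 + d st / (2 * y)^2) / 2)) \<le> 1 * ((2 * B)^2 / (2 * y)^2)"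
      unfolding real_norm_def abs_mult[of _ "_ / _"] by (intro mult_mono sg2 bd that) auto
    then show ?thesis by simp
  qed
  have eq: "mutual_log y = (\<integral>st. sg (fst st) * sg (snd st) * (ln (1 + d st / (2 * y)^2) / 2) \<partial>M2)"
    if y: "y > 0" for y
  proof -
    have i1: "integrable M2 (\<lambda>st. sg (fst st) * sg (snd st) * (ln (1 + d st / (2 * y)^2) / 2))"
      by (intro MM.integrable_const_bound[OF AE_I2, OF le[OF y]]) measurable
    \<comment> \<open>Dividing the argument by (2y)^2 isolates the constant ln (2y), whose
      coefficient is the squared total charge, that is zero. What remains is of order 1 /
      y^2.\<close>
    have "sg (fst st) * sg (snd st) * (lnorm (0 - (pos (fst st) - pos (snd st))) (2 * y)) =
      sg (fst st) * sg (snd st) * (ln (1 + d st / (2 * y)^2) / 2) + ln ((2 * y)^2) / 2 * (sg (fst st) * sg (snd st))" for st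
    proof -
      have "(0 - (pos (fst st) - pos (snd st)))^2 + (2 * y)^2 = (1 + d st / (2 * y)^2) * (2 * y)^2"
        using y by (simp add: d_def field_simps power2_commute)
      moreover have "1 + d st / (2 * y)^2 > 0" using d by (simp add: add_pos_nonneg)
      ultimately have "ln ((0 - (pos (fst st) - pos (snd st)))^2 + (2 * y)^2) = ln (1 + d st / (2 * y)^2) + ln ((2 * y)^2)"
        using y by (simp only: ln_mult_pos) (subst ln_mult_pos; simp)
      then show ?thesis by (simp only: add_divide_distrib distrib_left mult.commute)
    qed
    then show ?thesis unfolding mutual_log_def using i1 sgi zero
      by (simp only: Bochner_Integration.integral_add integrable_mult_right integral_mult_right_zero mult_zero_right add_0_right)
  qed
  have "((\<lambda>y. (2 * B)^2 / (2 * y)^2 * measure M2 (space M2)) \<longlongrightarrow> 0) at_top"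
    by real_asymp
  then show ?thesis
  proof (rule Lim_null_comparison[rotated])
    show "\<forall>\<^sub>F y in at_top. norm (mutual_log y) \<le> (2 * B)^2 / (2 * y)^2 * measure M2 (space M2)"
      using eventually_gt_at_top[of 0]
    proof eventually_elim
      case (elim y)
      have "norm (mutual_log y) \<le> (\<integral>st. (2 * B)^2 / (2 * y)^2 \<partial>M2)"
        unfolding eq[OF elim]
      proof (rule order_trans[OF integral_norm_bound integral_mono])
        show "norm (sg (fst st) * sg (snd st) * (ln (1 + d st / (2 * y)^2) / 2)) \<le> (2 * B)^2 / (2 * y)^2" for st
          by (rule le[OF elim])
        show "integrable M2 (\<lambda>st. norm (sg (fst st) * sg (snd st) * (ln (1 + d st / (2 * y)^2) / 2)))"
          by (intro integrable_norm MM.integrable_const_bound[OF AE_I2, OF le[OF elim]]) measurable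
      qed simp
      then show ?case by (simp add: mult.commute)
    qed
  qed
qed


text \<open>Chain rule along the map from y to (0, 2y). The result is the energy of one horizontal
  line divided by pi, which makes \<open>mutual_log\<close> a primitive of the line
  energies.\<close>

lemma mutual_log_deriv:
  assumes "y > 0"
  shows "(mutual_log has_real_derivative
    (\<integral>st. sg (fst st) * sg (snd st) * (4 * y / ((pos (fst st) - pos (snd st))^2 + 4 * y^2)) \<partial>M2)) (at y)"
proof -
  define u where "u = (\<lambda>st. pos (fst st) - pos (snd st))"
  have sg2: "\<bar>sg (fst st) * sg (snd st)\<bar> \<le> 1" for st
    using mult_mono[OF sg_le sg_le, of "fst st" "snd st"] by (simp add: abs_mult mult.commute)
  have u2: "\<bar>u st\<bar> \<le> 2 * B" for st
    using pos_le[of "fst st"] pos_le[of "snd st"] unfolding u_def by linarith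
  have um [measurable]: "u \<in> borel_measurable M2" unfolding u_def by measurable
  have sgm: "(\<lambda>st. sg (fst st) * sg (snd st)) \<in> borel_measurable M2" by measurable
  have "2 * y \<noteq> 0" using assms by simp
  note D = finite_measure_half_ln_has_derivative[OF MM.finite_measure_axioms sgm um sg2 u2 this, of 0]
  have "((\<lambda>y. (0::real, 2 * y)) has_derivative (\<lambda>h. (0, 2 * h))) (at y)"
    by (auto intro!: derivative_eq_intros)
  from diff_chain_at[OF this D]
  have "(mutual_log has_derivative (\<lambda>h. 2 * h * (\<integral>st. sg (fst st) * sg (snd st) *
     (2 * y / ((0 - u st)^2 + (2 * y)^2)) \<partial>M2))) (at y)"
    by (simp add: o_def mutual_log_def[abs_def] u_def)
  moreover have "2 * (\<integral>st. sg (fst st) * sg (snd st) * (2 * y / ((0 - u st)^2 + (2 * y)^2)) \<partial>M2) =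
    (\<integral>st. sg (fst st) * sg (snd st) * (4 * y / ((pos (fst st) - pos (snd st))^2 + 4 * y^2)) \<partial>M2)"
    unfolding integral_mult_right_zero[symmetric]
    by (intro Bochner_Integration.integral_cong refl) (simp add: u_def power_mult_distrib power2_commute)
  moreover have "(\<lambda>h. 2 * h * A) = (*) (2 * A)" for A :: real by (simp add: fun_eq_iff)
  ultimately show ?thesis unfolding has_field_derivative_def by (simp only:)
qed

text \<open>The line energies are pi times the derivative of \<open>mutual_log\<close>, and
  \<open>mutual_log\<close> vanishes at infinity; so the upper half contributes -pi times the value
  at \<epsilon>, and the lower half the same by reflection.\<close>

lemma strip_energy:
  assumes \<epsilon>: "\<epsilon> > 0" and neutral: "(\<integral>t. sg t \<partial>M) = 0"
  shows "(\<integral>\<^sup>+p \<in> {p. \<epsilon> \<le> \<bar>snd p\<bar>}. ennreal (field_sq p) \<partial>lborel) = ennreal (- 2 * pi * mutual_log \<epsilon>)"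
    and "0 \<le> - 2 * pi * mutual_log \<epsilon>"
proof -
  define I where "I = (\<lambda>y. \<integral>st. sg (fst st) * sg (snd st) * (4 * y / ((pos (fst st) - pos (snd st))^2 + 4 * y^2)) \<partial>M2)"
  define r where "r = (\<lambda>y. \<integral>\<^sup>+x. ennreal (field_sq (x, y)) \<partial>lborel)"
  have Ieq: "(\<integral>st. sg (fst st) * sg (snd st) * (4 * pi * y / ((pos (fst st) - pos (snd st))^2 + 4 * y^2)) \<partial>M2) = pi * I y" for y
    unfolding I_def integral_mult_right_zero[symmetric]
    by (intro Bochner_Integration.integral_cong refl) (simp add: field_simps)
  have r: "r y = ennreal (pi * I y)" and I0: "0 \<le> I y" if "y > 0" for y
    using field_sq_row[OF that] mult_left_le_imp_le[of pi 0 "I y"] unfolding Ieq r_def by auto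
  have r_even: "r (- y) = r y" for y unfolding r_def by (simp add: field_sq_reflect)
  have [measurable]: "I \<in> borel_measurable borel" unfolding I_def by measurable
  have fm [measurable]: "(\<lambda>p. field_sq p) \<in> borel_measurable (borel \<Otimes>\<^sub>M borel)" by (simp add: borel_prod)
  have [measurable]: "r \<in> borel_measurable borel" unfolding r_def by measurable
  have half: "(\<integral>\<^sup>+y. r y * indicator {\<epsilon>..} y \<partial>lborel) = ennreal (- pi * mutual_log \<epsilon>)"
  proof -
    have "(\<integral>\<^sup>+y. r y * indicator {\<epsilon>..} y \<partial>lborel) = (\<integral>\<^sup>+y. ennreal (pi * I y) * indicator {\<epsilon>..} y \<partial>lborel)"
      using \<epsilon> by (intro nn_integral_cong) (auto simp: r split: split_indicator)
    also have "\<dots> = ennreal (pi * 0 - pi * mutual_log \<epsilon>)"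
    proof (rule nn_integral_FTC_atLeast[where F="\<lambda>y. pi * mutual_log y"])
      show "((\<lambda>y. pi * mutual_log y) has_real_derivative pi * I y) (at y)" if "\<epsilon> \<le> y" for y
        using mutual_log_deriv[of y] that \<epsilon> unfolding I_def by (intro DERIV_cmult) auto
      show "((\<lambda>y. pi * mutual_log y) \<longlongrightarrow> pi * 0) at_top"
        by (intro tendsto_intros mutual_log_tendsto_0 neutral)
    qed (use I0 \<epsilon> in auto)
    finally show ?thesis by simp
  qed
  have half': "(\<integral>\<^sup>+y. r y * indicator {..-\<epsilon>} y \<partial>lborel) = (\<integral>\<^sup>+y. r y * indicator {\<epsilon>..} y \<partial>lborel)"
  proof -
    have "(\<integral>\<^sup>+y. r y * indicator {..-\<epsilon>} y \<partial>lborel) = ennreal \<bar>-1\<bar> * (\<integral>\<^sup>+y. r (0 + (-1) * y) * indicator {..-\<epsilon>} (0 + (-1) * y) \<partial>lborel)"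
      by (rule nn_integral_real_affine) auto
    also have "\<dots> = (\<integral>\<^sup>+y. r y * indicator {\<epsilon>..} y \<partial>lborel)"
      by (auto simp: r_even intro!: nn_integral_cong split: split_indicator)
    finally show ?thesis .
  qed
  have nonneg: "0 \<le> - pi * mutual_log \<epsilon>"
  proof -
    \<comment> \<open>The derivative is a line energy over pi, hence nonnegative, so
      \<open>mutual_log\<close> increases to its limit 0.\<close>
    have "mutual_log \<epsilon> \<le> 0"
    proof (rule tendsto_lowerbound[OF mutual_log_tendsto_0[OF neutral]])
      show "\<forall>\<^sub>F y in at_top. mutual_log \<epsilon> \<le> mutual_log y"
        using eventually_ge_at_top[of \<epsilon>]
      proof eventually_elim
        case (elim y)
        show ?case
        proof (rule DERIV_nonneg_imp_nondecreasing[OF elim])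
          fix z assume "\<epsilon> \<le> z"
          then have "z > 0" using \<epsilon> by simp
          then show "\<exists>D. (mutual_log has_real_derivative D) (at z) \<and> 0 \<le> D"
            using mutual_log_deriv[of z] I0[of z] unfolding I_def by blast
        qed
      qed
    qed simp
    then show ?thesis by (simp add: mult_nonneg_nonpos)
  qed
  then show "0 \<le> - 2 * pi * mutual_log \<epsilon>" by simp
  have "(\<integral>\<^sup>+p \<in> {p. \<epsilon> \<le> \<bar>snd p\<bar>}. ennreal (field_sq p) \<partial>lborel) =
    (\<integral>\<^sup>+p. ennreal (field_sq p) * indicator {y. \<epsilon> \<le> \<bar>y\<bar>} (snd p) \<partial>(lborel \<Otimes>\<^sub>M lborel))"
    unfolding lborel_prod by (intro nn_integral_cong) (auto split: split_indicator)
  also have "\<dots> = (\<integral>\<^sup>+y. (\<integral>\<^sup>+x. ennreal (field_sq (x, y)) * indicator {y. \<epsilon> \<le> \<bar>y\<bar>} y \<partial>lborel) \<partial>lborel)"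
    by (subst lborel_pair.nn_integral_snd[symmetric]) simp_all
  also have "\<dots> = (\<integral>\<^sup>+y. r y * indicator {\<epsilon>..} y + r y * indicator {..-\<epsilon>} y \<partial>lborel)"
    unfolding r_def using \<epsilon>
    by (intro nn_integral_cong) (subst nn_integral_multc, auto split: split_indicator)
  also have "\<dots> = ennreal (- pi * mutual_log \<epsilon>) + ennreal (- pi * mutual_log \<epsilon>)"
    by (subst nn_integral_add) (auto simp: half half')
  finally show "(\<integral>\<^sup>+p \<in> {p. \<epsilon> \<le> \<bar>snd p\<bar>}. ennreal (field_sq p) \<partial>lborel) = ennreal (- 2 * pi * mutual_log \<epsilon>)"
    using nonneg by (simp flip: ennreal_plus)
qed

end

section \<open>A disc with a strip removed\<close>

text \<open>Parametrize by v: ln (1 + v^2 t^2) / (1 + t^2) has v-derivative \<open>f v t\<close>,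
  whose t-integral is 2 pi / (1 + v); integrating v over [0, 1] gives 2 pi ln 2. All integrands are
  nonnegative, so Tonelli suffices.\<close>

lemma nn_integral_ln_over_one_plus_square:
  "(\<integral>\<^sup>+t. ennreal (ln (1 + t^2) / (1 + t^2)) \<partial>lborel) = ennreal (2 * pi * ln 2)"
proof -
  define f where "f = (\<lambda>v t::real. 2 * v * t^2 / ((1 + v^2 * t^2) * (1 + t^2)))"
  have pos: "1 + v^2 * t^2 > 0" "1 + t^2 > 0" for v t :: real by (simp_all add: add_pos_nonneg)
  have [measurable]: "case_prod f \<in> borel_measurable (borel \<Otimes>\<^sub>M borel)" unfolding f_def by measurable
  have v_int: "(\<integral>\<^sup>+v. ennreal (f v t) * indicator {0..1} v \<partial>lborel) = ennreal (ln (1 + t^2) / (1 + t^2))" for t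
  proof -
    have "(\<integral>\<^sup>+v. ennreal (f v t) * indicator {0..1} v \<partial>lborel) =
      ennreal (ln (1 + 1^2 * t^2) / (1 + t^2) - ln (1 + 0^2 * t^2) / (1 + t^2))"
    proof (rule nn_integral_FTC_Icc)
      fix v :: real assume "v \<in> {0..1}"
      then have "0 \<le> v" by simp
      have "((\<lambda>v. ln (1 + v^2 * t^2)) has_real_derivative 2 * v * t^2 / (1 + v^2 * t^2)) (at v)"
        using pos(1)[of v t] pos(2)[of t] by (auto intro!: derivative_eq_intros)
      then have "((\<lambda>v. ln (1 + v^2 * t^2) / (1 + t^2)) has_real_derivative 2 * v * t^2 / (1 + v^2 * t^2) / (1 + t^2)) (at v)"
        by (rule DERIV_cdivide)
      then show "((\<lambda>v. ln (1 + v^2 * t^2) / (1 + t^2)) has_real_derivative f v t) (at v)"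
        by (simp add: f_def)
      show "0 \<le> f v t" using \<open>0 \<le> v\<close> pos(1)[of v t] pos(2)[of t] by (simp add: f_def)
    qed simp_all
    then show ?thesis by simp
  qed
  have t_int: "(\<integral>\<^sup>+t. ennreal (f v t) \<partial>lborel) = ennreal (2 * pi / (1 + v))" if v: "0 < v" "v < 1" for v
  proof -
    have v2: "v^2 < 1" "v^2 \<noteq> 0" using v by (simp_all add: power_less_one_iff)
    have "has_bochner_integral lborel (f v) ((2 * v / (1 - v^2)) * (pi / 2 / v - pi / 2) - (2 * v / (1 - v^2)) * (- (pi / 2) / v - - (pi / 2)))"
    proof (rule has_bochner_integral_FTC_UNIV_nonneg)
      fix t
      have "((\<lambda>t. arctan (v * t)) has_real_derivative v / (1 + v^2 * t^2)) (at t)"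
        by (auto intro!: derivative_eq_intros simp: power_mult_distrib divide_simps)
      then have "((\<lambda>t. (2 * v / (1 - v^2)) * (arctan (v * t) / v - arctan t)) has_real_derivative
          (2 * v / (1 - v^2)) * (v / (1 + v^2 * t^2) / v - inverse (1 + t^2))) (at t)"
        by (intro DERIV_cmult DERIV_diff DERIV_cdivide DERIV_arctan)
      also have "(2 * v / (1 - v^2)) * (v / (1 + v^2 * t^2) / v - inverse (1 + t^2)) = f v t"
      proof -
        define a b c where "a = 1 + v^2 * t^2" and "b = 1 + t^2" and "c = 1 - v^2"
        have nz: "a \<noteq> 0" "b \<noteq> 0" "c \<noteq> 0"
          using v2 pos(1)[of v t] pos(2)[of t] by (auto simp: a_def b_def c_def)
        have "v / a / v - inverse b = (b - a) / (a * b)" using nz v by (simp add: field_simps)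
        also have "b - a = c * t^2" by (simp add: a_def b_def c_def algebra_simps)
        finally show ?thesis using nz unfolding f_def a_def[symmetric] b_def[symmetric] c_def[symmetric] by simp
      qed
      finally show "((\<lambda>t. (2 * v / (1 - v^2)) * (arctan (v * t) / v - arctan t)) has_real_derivative f v t) (at t)" .
      show "0 \<le> f v t" using v pos(1)[of v t] pos(2)[of t] by (simp add: f_def)
    next
      show "continuous_on UNIV (f v)" unfolding f_def using pos
        by (intro continuous_intros) (metis less_irrefl mult_eq_0_iff)
      have "filterlim (\<lambda>t. v * t) at_bot at_bot" "filterlim (\<lambda>t. v * t) at_top at_top" using v by real_asymp+
      note lim = filterlim_compose[OF tendsto_arctan_at_bot this(1)] filterlim_compose[OF tendsto_arctan_at_top this(2)]
      show "((\<lambda>t. (2 * v / (1 - v^2)) * (arctan (v * t) / v - arctan t)) \<longlongrightarrow> (2 * v / (1 - v^2)) * (- (pi / 2) / v - - (pi / 2))) at_bot"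
        by (intro tendsto_intros lim tendsto_arctan_at_bot) (use v in simp)
      show "((\<lambda>t. (2 * v / (1 - v^2)) * (arctan (v * t) / v - arctan t)) \<longlongrightarrow> (2 * v / (1 - v^2)) * (pi / 2 / v - pi / 2)) at_top"
        by (intro tendsto_intros lim tendsto_arctan_at_top) (use v in simp)
    qed
    moreover have "(2 * v / (1 - v^2)) * (pi / 2 / v - pi / 2) - (2 * v / (1 - v^2)) * (- (pi / 2) / v - - (pi / 2)) = 2 * pi / (1 + v)"
    proof -
      have "(pi / 2 / v - pi / 2) - (- (pi / 2) / v - - (pi / 2)) = pi * (1 - v) / v"
        using v by (simp add: field_simps)
      moreover have "1 - v^2 = (1 - v) * (1 + v)" by (simp add: power2_eq_square algebra_simps)
      ultimately show ?thesis using v by (simp only: right_diff_distrib[symmetric]) simp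
    qed
    moreover have "0 \<le> f v t" for t using v pos(1)[of v t] pos(2)[of t] by (simp add: f_def)
    ultimately show ?thesis by (subst nn_integral_eq_integral) (auto simp: has_bochner_integral_iff)
  qed
  have "(\<integral>\<^sup>+t. ennreal (ln (1 + t^2) / (1 + t^2)) \<partial>lborel) = (\<integral>\<^sup>+t. (\<integral>\<^sup>+v. ennreal (f v t) * indicator {0..1} v \<partial>lborel) \<partial>lborel)"
    by (simp add: v_int)
  also have "\<dots> = (\<integral>\<^sup>+v. (\<integral>\<^sup>+t. ennreal (f v t) * indicator {0..1} v \<partial>lborel) \<partial>lborel)"
    by (rule lborel_pair.Fubini') measurable
  also have "\<dots> = (\<integral>\<^sup>+v. ennreal (2 * pi / (1 + v)) * indicator {0..1} v \<partial>lborel)"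
  proof (rule nn_integral_cong_AE)
    \<comment> \<open>The partial fractions behind \<open>t_int\<close> degenerate at v = 0 and at v
      = 1.\<close>
    have "AE v in lborel. v \<noteq> (0::real)" "AE v in lborel. v \<noteq> (1::real)" by (rule AE_lborel_singleton)+
    then show "AE v in lborel. (\<integral>\<^sup>+t. ennreal (f v t) * indicator {0..1} v \<partial>lborel) = ennreal (2 * pi / (1 + v)) * indicator {0..1} v"
    proof eventually_elim
      case (elim v)
      then show ?case
        by (subst nn_integral_multc) (auto simp: t_int split: split_indicator)
    qed
  qed
  also have "\<dots> = ennreal (2 * pi * ln (1 + 1) - 2 * pi * ln (1 + 0))"
    by (rule nn_integral_FTC_Icc) (auto intro!: derivative_eq_intros)
  finally show ?thesis by simp
qed

text \<open>Integral of 1 / |z|^2 over a disc of radius \<eta> without the strip of half-width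
  \<epsilon>, in the slope t = x / y: heights run from \<epsilon> to
  \<open>\<eta> / sqrt (1 + t^2)\<close>, the factor 2 counts both signs of y, and the maximum with
  0 discards slopes whose line leaves the disc inside the strip.\<close>

definition disc_strip_energy :: "real \<Rightarrow> real \<Rightarrow> real" where
  "disc_strip_energy \<eta> \<epsilon> = (\<integral>t. 2 * max 0 (ln (\<eta> / \<epsilon>) - ln (1 + t^2) / 2) / (1 + t^2) \<partial>lborel)"

text \<open>Substituting \<open>x = y t\<close> turns the integral over a disc into one over the slope \<open>t\<close>.\<close>

lemma nn_integral_disc_strip:
  assumes \<epsilon>: "0 < \<epsilon>" and \<eta>: "\<epsilon> \<le> \<eta>"
  shows "(\<integral>\<^sup>+p \<in> {p. \<epsilon> \<le> \<bar>snd p\<bar>} \<inter> ball (a, 0) \<eta>. ennreal (1 / ((fst p - a)^2 + (snd p)^2)) \<partial>lborel)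
    = ennreal (disc_strip_energy \<eta> \<epsilon>)"
proof -
  have pos: "1 + t^2 > 0" for t :: real by (simp add: add_pos_nonneg)
  define f where "f = (\<lambda>x y::real. ennreal (1 / ((x - a)^2 + y^2)) * indicator {p. \<epsilon> \<le> \<bar>snd p\<bar> \<and> (fst p - a)^2 + (snd p)^2 < \<eta>^2} (x, y))"
  have [measurable]: "case_prod f \<in> borel_measurable (borel \<Otimes>\<^sub>M borel)" unfolding f_def by measurable
  define g where "g = (\<lambda>t y::real. ennreal (1 / (1 + t^2)) * (ennreal (1 / \<bar>y\<bar>) * indicator {y. \<epsilon> \<le> \<bar>y\<bar> \<and> \<bar>y\<bar> < \<eta> / sqrt (1 + t^2)} y))"
  have [measurable]: "case_prod g \<in> borel_measurable (borel \<Otimes>\<^sub>M borel)" unfolding g_def by measurable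
  have ball: "(x, y) \<in> ball (a, 0) \<eta> \<longleftrightarrow> (x - a)^2 + y^2 < \<eta>^2" for x y
  proof -
    have "(x, y) \<in> ball (a, 0) \<eta> \<longleftrightarrow> sqrt ((x - a)^2 + y^2) < sqrt (\<eta>^2)"
      using assms by (simp add: dist_Pair_Pair dist_real_def power2_commute[of a x] mem_ball)
    then show ?thesis by (simp only: real_sqrt_less_iff)
  qed
  have row: "(\<integral>\<^sup>+x. f x y \<partial>lborel) = (\<integral>\<^sup>+t. g t y \<partial>lborel)" if y: "y \<noteq> 0" for y
  proof -
    have "(\<integral>\<^sup>+x. f x y \<partial>lborel) = ennreal \<bar>y\<bar> * (\<integral>\<^sup>+t. f (a + y * t) y \<partial>lborel)"
      using y by (intro nn_integral_real_affine) measurable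
    also have "\<dots> = (\<integral>\<^sup>+t. ennreal \<bar>y\<bar> * f (a + y * t) y \<partial>lborel)"
      by (rule nn_integral_cmult[symmetric]) measurable
    also have "\<dots> = (\<integral>\<^sup>+t. g t y \<partial>lborel)"
    proof (rule nn_integral_cong)
      fix t
      have e: "(y * t)^2 + y^2 = \<bar>y\<bar> * \<bar>y\<bar> * (1 + t^2)" by (simp add: power2_eq_square algebra_simps)
      have "(y * t)^2 + y^2 < \<eta>^2 \<longleftrightarrow> \<bar>y\<bar> < \<eta> / sqrt (1 + t^2)"
      proof -
        have "(y * t)^2 + y^2 = (\<bar>y\<bar> * sqrt (1 + t^2))^2"
          by (simp add: power_mult_distrib algebra_simps)
        then have "(y * t)^2 + y^2 < \<eta>^2 \<longleftrightarrow> \<bar>y\<bar> * sqrt (1 + t^2) < \<eta>"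
          using abs_le_square_iff[of \<eta> "\<bar>y\<bar> * sqrt (1 + t^2)"] assms pos[of t]
          by (simp add: abs_mult not_le flip: not_less)
        then show ?thesis using pos[of t] by (simp add: pos_less_divide_eq)
      qed
      \<comment> \<open>The Jacobian |y| against 1 / (y^2 (1 + t^2)) separates the
        variables.\<close>
      moreover have "ennreal \<bar>y\<bar> * ennreal (1 / ((y * t)^2 + y^2)) = ennreal (1 / (1 + t^2)) * ennreal (1 / \<bar>y\<bar>)"
      proof -
        have "\<bar>y\<bar> * (1 / (\<bar>y\<bar> * \<bar>y\<bar> * (1 + t^2))) = 1 / (1 + t^2) * (1 / \<bar>y\<bar>)"
          using y by (simp del: abs_mult_self_eq)
        then show ?thesis unfolding e using pos[of t] by (subst (1 2) ennreal_mult[symmetric]) (auto simp: less_imp_le)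
      qed
      ultimately show "ennreal \<bar>y\<bar> * f (a + y * t) y = g t y"
        unfolding f_def g_def by (auto simp: mult.assoc[symmetric] split: split_indicator)
    qed
    finally show ?thesis .
  qed
  have inner: "(\<integral>\<^sup>+y. g t y \<partial>lborel) = ennreal (2 * max 0 (ln (\<eta> / \<epsilon>) - ln (1 + t^2) / 2) / (1 + t^2))" for t
  proof -
    define q where "q = \<eta> / sqrt (1 + t^2)"
    have q: "q > 0" using assms pos[of t] by (simp add: q_def)
    define h where "h = (\<lambda>y::real. ennreal (1 / \<bar>y\<bar>) * indicator {\<epsilon>..<q} y)"
    have [measurable]: "h \<in> borel_measurable borel" unfolding h_def by measurable
    have ln_q: "ln q - ln \<epsilon> = ln (\<eta> / \<epsilon>) - ln (1 + t^2) / 2"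
      using assms pos[of t] by (simp add: q_def ln_div ln_sqrt)
    have h: "(\<integral>\<^sup>+y. h y \<partial>lborel) = ennreal (max 0 (ln q - ln \<epsilon>))"
    proof (cases "\<epsilon> \<le> q")
      case True
      have "(\<integral>\<^sup>+y. h y \<partial>lborel) = (\<integral>\<^sup>+y. ennreal (1 / y) * indicator {\<epsilon>..q} y \<partial>lborel)"
        using AE_lborel_singleton[of q] \<epsilon>
        by (intro nn_integral_cong_AE) (auto simp: h_def split: split_indicator)
      also have "\<dots> = ennreal (ln q - ln \<epsilon>)"
        using True \<epsilon>
        by (intro nn_integral_FTC_Icc DERIV_ln_divide) auto
      finally show ?thesis using True \<epsilon> by simp
    next
      case False
      then have "ln q \<le> ln \<epsilon>" using q by simp
      then show ?thesis using False by (simp add: h_def)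
    qed
    have "(\<integral>\<^sup>+y. h y \<partial>lborel) = ennreal \<bar>-1\<bar> * (\<integral>\<^sup>+y. h (0 + (-1) * y) \<partial>lborel)"
      by (rule nn_integral_real_affine) auto
    then have h': "(\<integral>\<^sup>+y. h (- y) \<partial>lborel) = (\<integral>\<^sup>+y. h y \<partial>lborel)" by simp
    have "(\<integral>\<^sup>+y. g t y \<partial>lborel) = (\<integral>\<^sup>+y. ennreal (1 / (1 + t^2)) * (h y + h (- y)) \<partial>lborel)"
      unfolding g_def h_def q_def[symmetric] using \<epsilon>
      by (intro nn_integral_cong) (auto split: split_indicator)
    also have "\<dots> = ennreal (1 / (1 + t^2)) * (ennreal (max 0 (ln q - ln \<epsilon>)) + ennreal (max 0 (ln q - ln \<epsilon>)))"
      by (subst nn_integral_cmult, simp, subst nn_integral_add) (auto simp: h h')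
    also have "\<dots> = ennreal (2 * max 0 (ln q - ln \<epsilon>) / (1 + t^2))"
    proof -
      have "ennreal (1 / (1 + t^2)) * (ennreal c + ennreal c) = ennreal (2 * c / (1 + t^2))" if "0 \<le> c" for c
        using that pos[of t] by (simp flip: ennreal_plus ennreal_mult)
      from this[OF max.cobounded1] show ?thesis .
    qed
    finally show ?thesis unfolding ln_q .
  qed
  have int: "integrable lborel (\<lambda>t. 2 * max 0 (ln (\<eta> / \<epsilon>) - ln (1 + t^2) / 2) / (1 + t^2))"
  proof (rule Bochner_Integration.integrable_bound)
    have "integrable lborel (\<lambda>t::real. 1 / ((t - 0)^2 + 1^2))"
      using cauchy_kernel_x_integral(1)[of 1 0] by (simp add: has_bochner_integral_iff)
    then have "integrable lborel (\<lambda>t::real. 1 / (1 + t^2))" by (simp add: add.commute)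
    then show "integrable lborel (\<lambda>t::real. 2 * ln (\<eta> / \<epsilon>) * (1 / (1 + t^2)))" by (rule integrable_mult_right)
    have "0 \<le> ln (\<eta> / \<epsilon>)" using assms by simp
    moreover have "0 \<le> ln (1 + t^2)" for t :: real by simp
    ultimately have "max 0 (ln (\<eta> / \<epsilon>) - ln (1 + t^2) / 2) \<le> ln (\<eta> / \<epsilon>)" for t :: real
      by (smt (verit) divide_nonneg_nonneg)
    then show "AE t in lborel. norm (2 * max 0 (ln (\<eta> / \<epsilon>) - ln (1 + t^2) / 2) / (1 + t^2))
       \<le> norm (2 * ln (\<eta> / \<epsilon>) * (1 / (1 + t^2)))"
      using pos by (intro AE_I2) (auto simp: abs_mult abs_divide intro!: divide_right_mono)
  qed simp
  have "(\<integral>\<^sup>+p \<in> {p. \<epsilon> \<le> \<bar>snd p\<bar>} \<inter> ball (a, 0) \<eta>. ennreal (1 / ((fst p - a)^2 + (snd p)^2)) \<partial>lborel)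
    = (\<integral>\<^sup>+p. case_prod f p \<partial>(lborel \<Otimes>\<^sub>M lborel))"
    unfolding lborel_prod
  proof (rule nn_integral_cong)
    fix p :: "real \<times> real"
    show "ennreal (1 / ((fst p - a)^2 + (snd p)^2)) * indicator ({p. \<epsilon> \<le> \<bar>snd p\<bar>} \<inter> ball (a, 0) \<eta>) p = case_prod f p"
      using ball[of "fst p" "snd p"] by (auto simp: f_def split_beta split: split_indicator simp del: mem_ball)
  qed
  also have "\<dots> = (\<integral>\<^sup>+y. (\<integral>\<^sup>+x. f x y \<partial>lborel) \<partial>lborel)"
    by (subst lborel_pair.nn_integral_snd[symmetric]) simp_all
  also have "\<dots> = (\<integral>\<^sup>+y. (\<integral>\<^sup>+t. g t y \<partial>lborel) \<partial>lborel)"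
    using AE_lborel_singleton[of 0] row by (intro nn_integral_cong_AE) auto
  also have "\<dots> = (\<integral>\<^sup>+t. (\<integral>\<^sup>+y. g t y \<partial>lborel) \<partial>lborel)"
    by (rule lborel_pair.Fubini') measurable
  also have "\<dots> = ennreal (disc_strip_energy \<eta> \<epsilon>)"
    unfolding inner disc_strip_energy_def
    by (rule nn_integral_eq_integral[OF int]) (auto intro!: AE_I2 divide_nonneg_pos pos)
  finally show ?thesis .
qed

text \<open>With L = ln (\<eta> / e), the numerator 2 max 0 (L - l/2) is 2L - min l (2L). The first
  part integrates to 2 pi L, the second tends to 2 pi ln 2; this turns \<eta> / e into \<eta> / (2
  e), matching the 2 e in \<open>mutual_log\<close>.\<close>

lemma disc_strip_energy_asymp:
  assumes \<eta>: "0 < \<eta>" and e: "e \<longlonglongrightarrow> 0" "\<And>k::nat. 0 < e k"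
  shows "(\<lambda>k. disc_strip_energy \<eta> (e k) - 2 * pi * ln (\<eta> / (2 * e k))) \<longlonglongrightarrow> 0"
proof -
  define l where "l = (\<lambda>t::real. ln (1 + t^2))"
  have pos: "1 + t^2 > 0" and l0: "0 \<le> l t" for t :: real by (simp_all add: l_def add_pos_nonneg)
  have [measurable]: "l \<in> borel_measurable borel" unfolding l_def by measurable
  have li: "has_bochner_integral lborel (\<lambda>t. l t / (1 + t^2)) (2 * pi * ln 2)"
    using l0 pos nn_integral_ln_over_one_plus_square unfolding l_def
    by (intro has_bochner_integral_nn_integral) (auto simp: less_imp_le)
  have ci: "has_bochner_integral lborel (\<lambda>t::real. 1 / (1 + t^2)) pi"
    using cauchy_kernel_x_integral(1)[of 1 0] by (simp add: add.commute)
  define m where "m = (\<lambda>L t. min (l t) (2 * L) / (1 + t^2))"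
  have [measurable]: "m L \<in> borel_measurable borel" for L unfolding m_def by measurable
  have mb: "\<bar>m L t\<bar> \<le> l t / (1 + t^2)" if "0 \<le> L" for L t
    using that l0[of t] pos[of t] unfolding m_def abs_divide by (intro frac_le) auto
  have mi: "integrable lborel (m L)" if "0 \<le> L" for L
  proof (rule Bochner_Integration.integrable_bound)
    show "integrable lborel (\<lambda>t. l t / (1 + t^2))" using li by (simp add: has_bochner_integral_iff)
    show "AE t in lborel. norm (m L t) \<le> norm (l t / (1 + t^2))"
      unfolding real_norm_def by (intro AE_I2 order_trans[OF mb[OF that] abs_ge_self])
  qed simp
  have eq: "disc_strip_energy \<eta> x - 2 * pi * ln (\<eta> / (2 * x)) = 2 * pi * ln 2 - (\<integral>t. m (ln (\<eta> / x)) t \<partial>lborel)"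
    if x: "0 < x" "x \<le> \<eta>" for x
  proof -
    define L where "L = ln (\<eta> / x)"
    have L: "0 \<le> L" using that by (simp add: L_def)
    have "ln (\<eta> / (2 * x)) = L - ln 2" using that \<eta> by (simp add: L_def ln_div ln_mult_pos)
    moreover have "disc_strip_energy \<eta> x = (\<integral>t. 2 * L * (1 / (1 + t^2)) - m L t \<partial>lborel)"
      unfolding disc_strip_energy_def L_def[symmetric]
      by (intro Bochner_Integration.integral_cong refl)
         (auto simp: m_def l_def max_def min_def diff_divide_distrib)
    moreover have "\<dots> = 2 * L * pi - (\<integral>t. m L t \<partial>lborel)"
      using mi[OF L] ci
      by (subst Bochner_Integration.integral_diff) (auto simp: has_bochner_integral_iff simp del: times_divide_eq_right)
    ultimately show ?thesis unfolding L_def[symmetric] by (simp only:) (simp add: algebra_simps)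
  qed
  have ev: "\<forall>\<^sub>F k in sequentially. e k \<le> \<eta>"
    using order_tendstoD(2)[OF e(1) \<eta>] by eventually_elim simp
  have "filterlim e (at_right 0) sequentially"
    using e by (auto simp: filterlim_at less_imp_neq[symmetric] intro!: always_eventually)
  then have top: "filterlim (\<lambda>k. ln (\<eta> / e k)) at_top sequentially"
    by (rule filterlim_compose[rotated]) (use \<eta> in real_asymp)
  have "(\<lambda>k. \<integral>t. m (max 0 (ln (\<eta> / e k))) t \<partial>lborel) \<longlonglongrightarrow> (\<integral>t. l t / (1 + t^2) \<partial>lborel)"
  proof (rule integral_dominated_convergence[where w="\<lambda>t. l t / (1 + t^2)"])
    show "AE t in lborel. (\<lambda>k. m (max 0 (ln (\<eta> / e k))) t) \<longlonglongrightarrow> l t / (1 + t^2)"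
    proof (rule AE_I2)
      fix t
      have "\<forall>\<^sub>F k in sequentially. m (max 0 (ln (\<eta> / e k))) t = l t / (1 + t^2)"
        using filterlim_at_top_dense[THEN iffD1, OF top, rule_format, of "l t"]
        by eventually_elim (use l0[of t] in \<open>auto simp: m_def min_def\<close>)
      then show "(\<lambda>k. m (max 0 (ln (\<eta> / e k))) t) \<longlonglongrightarrow> l t / (1 + t^2)"
        by (rule tendsto_eventually)
    qed
    show "AE t in lborel. norm (m (max 0 (ln (\<eta> / e k))) t) \<le> l t / (1 + t^2)" for k
      using mb by (intro AE_I2) simp
  qed (use li in \<open>auto simp: has_bochner_integral_iff\<close>)
  then have "(\<lambda>k. 2 * pi * ln 2 - (\<integral>t. m (max 0 (ln (\<eta> / e k))) t \<partial>lborel)) \<longlonglongrightarrow> 2 * pi * ln 2 - 2 * pi * ln 2"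
    using li by (intro tendsto_intros) (auto simp: has_bochner_integral_iff)
  moreover have "\<forall>\<^sub>F k in sequentially. 2 * pi * ln 2 - (\<integral>t. m (max 0 (ln (\<eta> / e k))) t \<partial>lborel)
      = disc_strip_energy \<eta> (e k) - 2 * pi * ln (\<eta> / (2 * e k))"
    using ev by eventually_elim (use e(2) in \<open>simp add: eq max_def not_le\<close>)
  ultimately show ?thesis by (simp add: tendsto_cong)
qed

section \<open>Point charges screened by a bounded density\<close>

lemma integrable_abs_powr:
  fixes a c :: real
  assumes a: "-1 < a"
  shows "integrable lborel (\<lambda>x. \<bar>x\<bar> powr a * indicator {-c..c} x)"
proof (cases "c \<ge> 0")
  case c: True
  define f where "f = (\<lambda>x. \<bar>x\<bar> powr a * indicator {0..c} x)"
  have "((\<lambda>x. x powr a) has_integral (c powr (a+1) / (a+1))) {0..c}"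
    by (rule has_integral_powr_from_0[OF a c])
  then have "((\<lambda>x. if x \<in> {0..c} then x powr a else 0) has_integral (c powr (a+1) / (a+1))) UNIV"
    by (simp only: has_integral_restrict_UNIV)
  also have "(\<lambda>x. if x \<in> {0..c} then x powr a else 0) = f"
    by (auto simp: f_def fun_eq_iff)
  finally have "integral\<^sup>N lborel f = ennreal (c powr (a+1) / (a+1))"
    by (intro nn_integral_has_integral_lborel) (auto simp: f_def)
  then have f: "integrable lborel f" by (intro integrableI_nonneg) (auto simp: f_def)
  then have f': "integrable lborel (\<lambda>x. f (0 + (-1) * x))"
    by (subst lborel_integrable_real_affine_iff) auto
  show ?thesis
  proof (rule Bochner_Integration.integrable_bound)
    show "integrable lborel (\<lambda>x. f x + f (0 + (-1) * x))" using f f' by (rule Bochner_Integration.integrable_add)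
    show "AE x in lborel. norm (\<bar>x\<bar> powr a * indicator {-c..c} x) \<le> norm (f x + f (0 + (-1) * x))"
      by (auto simp: f_def split: split_indicator)
  qed simp
qed (auto simp: not_le)

lemma integrable_lborel_prod:
  fixes f g :: "real \<Rightarrow> real"
  assumes f: "integrable lborel f" and g: "integrable lborel g"
  shows "integrable lborel (\<lambda>p. f (fst p) * g (snd p))"
proof -
  have [measurable]: "f \<in> borel_measurable borel" "g \<in> borel_measurable borel" using assms by auto
  have "(\<integral>\<^sup>+p. norm (f (fst p) * g (snd p)) \<partial>(lborel \<Otimes>\<^sub>M lborel)) = (\<integral>\<^sup>+x. (\<integral>\<^sup>+y. ennreal (norm (f x)) * ennreal (norm (g y)) \<partial>lborel) \<partial>lborel)"
    by (subst lborel.nn_integral_fst[symmetric]) (auto simp: abs_mult ennreal_mult)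
  also have "\<dots> = (\<integral>\<^sup>+x. norm (f x) \<partial>lborel) * (\<integral>\<^sup>+y. norm (g y) \<partial>lborel)"
    by (simp add: nn_integral_cmult nn_integral_multc)
  also have "\<dots> < \<infinity>"
    using assms by (simp add: integrable_iff_bounded ennreal_mult_less_top)
  finally have "integrable (lborel \<Otimes>\<^sub>M lborel) (\<lambda>p. f (fst p) * g (snd p))"
    by (intro integrableI_bounded) auto
  then show ?thesis by (simp add: lborel_prod)
qed

text \<open>Both sides are 0 at d = 0 because \<open>ln 0 = 0\<close>, so regularization at height 0
  is the plain logarithm everywhere.\<close>

lemma half_ln_square: "ln (d^2) / 2 = ln \<bar>d :: real\<bar>"
  using ln_realpow[of "\<bar>d\<bar>" 2] by (cases "d = 0") simp_all

text \<open>A majorant uniform in the regularization, for dominated convergence as \<open>e\<close>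
  tends to 0. The exponent -3/4 also bounds the field of an atom later, so one singular integral
  serves both. The factor 2 covers the 4/3 that ln s <= s - 1 produces at s = |d|^(-3/4).\<close>

lemma abs_ln_le_powr:
  fixes d e :: real
  assumes d: "d \<noteq> 0" and e: "0 \<le> e" "e \<le> 1"
  shows "\<bar>ln (d^2 + (2 * e)^2) / 2\<bar> \<le> 2 * \<bar>d\<bar> powr (-3/4) + \<bar>d\<bar> + 2"
proof -
  define v where "v = lnorm d (2 * e)"
  have d2: "0 < d^2" using d by simp
  have pw: "0 < \<bar>d\<bar> powr (-3/4)" using d by simp
  have "(2 * e)^2 \<le> 2^2" using e by (intro power_mono) auto
  then have "d^2 + (2 * e)^2 \<le> (\<bar>d\<bar> + 2)^2" by (simp add: power2_sum)
  then have "v \<le> ln ((\<bar>d\<bar> + 2)^2) / 2"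
    unfolding v_def using d2 by (intro divide_right_mono ln_mono) (auto intro!: add_pos_nonneg)
  also have "\<dots> = ln (\<bar>d\<bar> + 2)" by (simp add: ln_realpow)
  also have "\<dots> \<le> \<bar>d\<bar> + 2" by (rule order_trans[OF ln_le_minus_one]) auto
  finally have up: "v \<le> \<bar>d\<bar> + 2" .
  have "ln (\<bar>d\<bar> powr (-3/4)) \<le> \<bar>d\<bar> powr (-3/4) - 1" using pw by (rule ln_le_minus_one)
  moreover have "ln (\<bar>d\<bar> powr (-3/4)) = -3/4 * ln \<bar>d\<bar>" using d by (simp add: ln_powr)
  ultimately have "- ln \<bar>d\<bar> \<le> 2 * \<bar>d\<bar> powr (-3/4)" using pw by linarith
  moreover have "ln \<bar>d\<bar> = ln (d^2) / 2" by (simp only: half_ln_square)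
  moreover have "ln (d^2) / 2 \<le> v" unfolding v_def using d2 by (intro divide_right_mono ln_mono) auto
  ultimately have "- v \<le> 2 * \<bar>d\<bar> powr (-3/4)" by linarith
  then show ?thesis using up pw unfolding v_def[symmetric] abs_le_iff by linarith
qed

text \<open>Coinciding points are allowed. Besides the blown-up system, the locale is instantiated
  with n = 1 and a dummy atom at 0, to obtain potential and energy formulas for a single density of
  mass one.\<close>

locale screened_points =
  fixes n :: nat and p :: "nat \<Rightarrow> real" and m :: "real \<Rightarrow> real" and R C :: real
  assumes m_measurable [measurable]: "m \<in> borel_measurable borel"
    and m_nonneg: "\<And>t. 0 \<le> m t" and m_le: "\<And>t. m t \<le> C"
    and m_support: "\<And>t. R < \<bar>t\<bar> \<Longrightarrow> m t = 0" and R: "0 < R"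
    and m_mass: "has_bochner_integral lborel m (real n)"
begin

lemma C_nonneg: "0 \<le> C" using m_nonneg[of 0] m_le[of 0] by linarith

lemma integrable_m: "integrable lborel m" and integral_m: "integral\<^sup>L lborel m = real n"
  using m_mass by (auto simp: has_bochner_integral_iff)

text \<open>The neutral charge, atoms included, is encoded as a density on the line: the interval
  \<open>[R + i, R + i + 1)\<close> carries the atom at \<open>p i\<close>.\<close>

definition atom_index :: "real \<Rightarrow> nat" where "atom_index t = nat \<lfloor>t - R\<rfloor>"

text \<open>Atoms are numbered from 1, so the first occupied cell begins at R + 1, and
  \<open>m\<close> already vanishes beyond R. Cells have length one and weight one, hence unit
  mass.\<close>

definition weight :: "real \<Rightarrow> real" where
  "weight t = (if t < R + 1 then m t else if atom_index t \<le> n then 1 else 0)"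

definition polarity :: "real \<Rightarrow> real" where "polarity t = (if t < R + 1 then - 1 else 1)"

text \<open>The fallback 0 occurs only where \<open>weight\<close> vanishes; it keeps the position
  bounded at every point, as \<open>planar_charge\<close> demands.\<close>

definition position :: "real \<Rightarrow> real" where
  "position t = (if t < R + 1 then if \<bar>t\<bar> \<le> R then t else 0
    else if atom_index t \<le> n then p (atom_index t) else 0)"

definition charges :: "real measure" where "charges = density lborel (\<lambda>t. ennreal (weight t))"

lemma atom_index_measurable [measurable]: "atom_index \<in> borel \<rightarrow>\<^sub>M count_space UNIV"
  unfolding atom_index_def[abs_def] by measurable

lemma measurable_charges [measurable]:
  "weight \<in> borel_measurable borel" "polarity \<in> borel_measurable borel" "position \<in> borel_measurable borel"
  unfolding weight_def[abs_def] polarity_def[abs_def] position_def[abs_def] by measurable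

lemma sets_charges [measurable_cong]: "sets charges = sets borel"
  by (simp add: charges_def)

lemma weight_nonneg: "0 \<le> weight t" by (simp add: weight_def m_nonneg)

lemma atom_index_iff:
  assumes "R + 1 \<le> t"
  shows "t \<in> {R + real i..<R + real i + 1} \<longleftrightarrow> i = atom_index t"
proof -
  have "1 \<le> \<lfloor>t - R\<rfloor>" using assms by (simp add: le_floor_iff)
  then have "i = atom_index t \<longleftrightarrow> \<lfloor>t - R\<rfloor> = int i" by (auto simp: atom_index_def)
  also have "\<dots> \<longleftrightarrow> t \<in> {R + real i..<R + real i + 1}" by (auto simp: floor_eq_iff)
  finally show ?thesis by simp
qed

lemma weight_decomp:
  "weight t * (polarity t * f (position t)) =
    (\<Sum>i\<in>{1..n}. indicator {R + real i..<R + real i + 1} t * f (p i)) - m t * f t"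
proof (cases "t < R + 1")
  case True
  then have "(\<Sum>i\<in>{1..n}. indicator {R + real i..<R + real i + 1} t * f (p i)) = 0"
    by (intro sum.neutral) (auto split: split_indicator)
  moreover have "m t * f (position t) = m t * f t"
    using True m_support[of t] by (auto simp: position_def)
  ultimately show ?thesis using True by (simp add: weight_def polarity_def)
next
  case False
  then have t: "R + 1 \<le> t" by simp
  then have "m t = 0" using R by (intro m_support) auto
  have "1 \<le> atom_index t" using t unfolding atom_index_def by (simp add: le_nat_iff le_floor_iff)
  have "(\<Sum>i\<in>{1..n}. indicator {R + real i..<R + real i + 1} t * f (p i)) =
    (\<Sum>i\<in>{1..n}. if i = atom_index t then f (p i) else 0)"
    using atom_index_iff[OF t] by (intro sum.cong) (auto split: split_indicator)
  also have "\<dots> = (if atom_index t \<le> n then f (p (atom_index t)) else 0)"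
    using \<open>1 \<le> atom_index t\<close> by (simp add: sum.delta)
  finally show ?thesis using False \<open>m t = 0\<close> by (simp add: weight_def polarity_def position_def)
qed

text \<open>The dictionary between the encoded density and the true charge; the formulas for its
  total mass, field and energy all pass through it.\<close>

lemma charges_integral:
  assumes [measurable]: "f \<in> borel_measurable borel" and int: "integrable lborel (\<lambda>t. m t * f t)"
  shows "has_bochner_integral charges (\<lambda>t. polarity t * f (position t)) ((\<Sum>i\<in>{1..n}. f (p i)) - (\<integral>t. m t * f t \<partial>lborel))"
  unfolding charges_def
proof (rule has_bochner_integral_density)
  have "has_bochner_integral lborel (indicator {R + real i..<R + real i + 1}) (1::real)" for i :: nat
    using has_bochner_integral_real_indicator[of "{R + real i..<R + real i + 1}" lborel] by simp
  then have "has_bochner_integral lborel (\<lambda>t. \<Sum>i\<in>{1..n}. indicator {R + real i..<R + real i + 1} t * f (p i)) (\<Sum>i\<in>{1..n}. 1 * f (p i))"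
    by (intro has_bochner_integral_sum has_bochner_integral_mult_left)
  from has_bochner_integral_diff[OF this has_bochner_integral_integrable[OF int]]
  show "has_bochner_integral lborel (\<lambda>t. weight t *\<^sub>R (polarity t * f (position t))) ((\<Sum>i\<in>{1..n}. f (p i)) - (\<integral>t. m t * f t \<partial>lborel))"
    by (simp add: weight_decomp)
qed (auto simp: weight_nonneg)

definition bound :: real where "bound = R + (\<Sum>i\<in>{1..n}. \<bar>p i\<bar>)"

lemma finite_charges: "finite_measure charges"
proof (rule finite_measureI)
  have "weight t \<le> indicator {R + 1..<R + 1 + real n} t + m t" for t
  proof (cases "t < R + 1")
    case False
    then have "atom_index t \<le> n \<longrightarrow> t < R + 1 + n"
      using atom_index_iff[of t "atom_index t"] by auto
    then show ?thesis using False m_nonneg[of t] by (auto simp: weight_def)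
  qed (auto simp: weight_def)
  moreover have "integrable lborel (\<lambda>t. indicator {R + 1..<R + 1 + real n} t + m t)"
    using integrable_m by (intro Bochner_Integration.integrable_add integrable_real_indicator) auto
  ultimately have "integrable lborel weight"
    by (rule_tac Bochner_Integration.integrable_bound) (auto simp: weight_nonneg m_nonneg intro!: AE_I2)
  then show "emeasure charges (space charges) \<noteq> \<infinity>"
    by (auto simp: charges_def emeasure_density weight_nonneg nn_integral_eq_integral)
qed

sublocale planar_charge charges polarity position bound
proof (rule planar_charge.intro[OF finite_charges], unfold_locales)
  show "\<bar>polarity t\<bar> \<le> 1" for t by (simp add: polarity_def)
  have S0: "0 \<le> (\<Sum>i\<in>{1..n}. \<bar>p i\<bar>)" by (intro sum_nonneg) auto
  have "\<bar>p i\<bar> \<le> (\<Sum>i\<in>{1..n}. \<bar>p i\<bar>)" if "i \<in> {1..n}" for i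
    using that by (intro member_le_sum) auto
  then have S: "\<bar>p i\<bar> \<le> bound" if "1 \<le> i" "i \<le> n" for i
    unfolding bound_def using R that by (intro add_increasing) auto
  have "R \<le> bound" unfolding bound_def using S0 by simp
  moreover have "1 \<le> atom_index t" if "\<not> t < R + 1" for t
    using that unfolding atom_index_def by (simp add: le_nat_iff le_floor_iff)
  ultimately show "\<bar>position t\<bar> \<le> bound" for t
    using R S[of "atom_index t"] unfolding position_def by auto
qed measurable

lemma neutral: "(\<integral>t. polarity t \<partial>charges) = 0"
  using charges_integral[of "\<lambda>_. 1"] integrable_m by (simp add: has_bochner_integral_iff integral_m)

lemma integrable_m_mult:
  assumes [measurable]: "f \<in> borel_measurable borel" and "\<And>t. \<bar>t\<bar> \<le> R \<Longrightarrow> \<bar>f t\<bar> \<le> K"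
  shows "integrable lborel (\<lambda>t. m t * f t)"
proof (rule Bochner_Integration.integrable_bound)
  show "integrable lborel (\<lambda>t. m t * K)" using integrable_m by simp
  show "AE t in lborel. norm (m t * f t) \<le> norm (m t * K)"
  proof (rule AE_I2)
    fix t show "norm (m t * f t) \<le> norm (m t * K)"
    proof (cases "\<bar>t\<bar> \<le> R")
      case True
      then have "\<bar>f t\<bar> \<le> \<bar>K\<bar>" using assms(2)[of t] by linarith
      then show ?thesis by (auto simp: abs_mult intro!: mult_left_mono)
    qed (simp add: m_support)
  qed
qed measurable

section \<open>Potentials of the density, plain and regularized\<close>

definition sing_bound :: real where
  "sing_bound = C * (\<integral>s. \<bar>s\<bar> powr (-3/4) * indicator {-1..1} s \<partial>lborel) + real n"

text \<open>Split at |x - t| = 1: near x the density is at most \<open>C\<close>, farther away the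
  kernel is at most 1 and the mass is \<open>n\<close>. The bound is uniform in x.\<close>

lemma singular_integral:
  shows "integrable lborel (\<lambda>t. m t * \<bar>x - t\<bar> powr (-3/4))"
    and "(\<integral>t. m t * \<bar>x - t\<bar> powr (-3/4) \<partial>lborel) \<le> sing_bound"
    and "0 \<le> sing_bound"
proof -
  define q where "q = (\<lambda>s::real. \<bar>s\<bar> powr (-3/4) * indicator {-1..1} s)"
  have q: "integrable lborel q" unfolding q_def by (rule integrable_abs_powr) simp
  have q': "integrable lborel (\<lambda>t. q (x + (-1) * t))"
    using q by (subst lborel_integrable_real_affine_iff) auto
  have qi: "(\<integral>t. q (x + (-1) * t) \<partial>lborel) = (\<integral>t. q t \<partial>lborel)"
    using lborel_integral_real_affine[of "-1" q x] by simp
  have le: "m t * \<bar>x - t\<bar> powr (-3/4) \<le> C * q (x + (-1) * t) + m t" for t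
  proof (cases "\<bar>x - t\<bar> \<le> 1")
    case True
    then have "q (x + (-1) * t) = \<bar>x - t\<bar> powr (-3/4)" by (auto simp: q_def split: split_indicator)
    then show ?thesis using mult_right_mono[OF m_le[of t], of "\<bar>x - t\<bar> powr (-3/4)"] m_nonneg[of t] by simp
  next
    case False
    then have "\<bar>x - t\<bar> powr (-3/4) \<le> 1" using powr_mono2'[of "-3/4" 1 "\<bar>x - t\<bar>"] by simp
    then show ?thesis using mult_left_mono[of "\<bar>x - t\<bar> powr (-3/4)" 1 "m t"] m_nonneg[of t] C_nonneg
      by (simp add: q_def add_increasing)
  qed
  have int: "integrable lborel (\<lambda>t. C * q (x + (-1) * t) + m t)" using q' integrable_m by simp
  show i: "integrable lborel (\<lambda>t. m t * \<bar>x - t\<bar> powr (-3/4))"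
    by (rule Bochner_Integration.integrable_bound[OF int])
       (use le in \<open>auto simp: m_nonneg intro!: AE_I2 order_trans[OF _ abs_ge_self]\<close>)
  have "(\<integral>t. m t * \<bar>x - t\<bar> powr (-3/4) \<partial>lborel) \<le> (\<integral>t. C * q (x + (-1) * t) + m t \<partial>lborel)"
    by (rule integral_mono[OF i int le])
  also have "\<dots> = C * (\<integral>t. q t \<partial>lborel) + real n"
    using q' integrable_m qi by (simp add: integral_m)
  also have "\<dots> = sing_bound" by (simp add: sing_bound_def q_def)
  finally show "(\<integral>t. m t * \<bar>x - t\<bar> powr (-3/4) \<partial>lborel) \<le> sing_bound" .
  show "0 \<le> sing_bound"
    unfolding sing_bound_def using C_nonneg by (intro add_nonneg_nonneg mult_nonneg_nonneg integral_nonneg) auto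
qed

text \<open>Distances are measured to a copy of the axis shifted by 2e. At e = 0 this is the
  potential on the axis itself, with the sign opposite to \<open>log_potential\<close>.\<close>

definition log_pot :: "real \<Rightarrow> real \<Rightarrow> real" where
  "log_pot e x = (\<integral>t. m t * (lnorm (x - t) (2 * e)) \<partial>lborel)"

lemma log_pot_measurable [measurable]: "log_pot e \<in> borel_measurable borel"
  unfolding log_pot_def by measurable

lemma log_pot_integrable:
  assumes "0 \<le> e" "e \<le> 1"
  shows "integrable lborel (\<lambda>t. m t * (lnorm (x - t) (2 * e)))"
    and "\<bar>log_pot e x\<bar> \<le> 2 * sing_bound + (\<bar>x\<bar> + R + 2) * n"
    and "AE t in lborel. norm (m t * (lnorm (x - t) (2 * e)))
      \<le> 2 * (m t * \<bar>x - t\<bar> powr (-3/4)) + (\<bar>x\<bar> + R + 2) * m t"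
    and "integrable lborel (\<lambda>t. 2 * (m t * \<bar>x - t\<bar> powr (-3/4)) + (\<bar>x\<bar> + R + 2) * m t)"
proof -
  show le: "AE t in lborel. norm (m t * (lnorm (x - t) (2 * e)))
      \<le> 2 * (m t * \<bar>x - t\<bar> powr (-3/4)) + (\<bar>x\<bar> + R + 2) * m t"
    using AE_lborel_singleton[of x]
  proof eventually_elim
    case (elim t)
    show ?case
    proof (cases "\<bar>t\<bar> \<le> R")
      case True
      have "\<bar>ln ((x - t)^2 + (2 * e)^2) / 2\<bar> \<le> 2 * \<bar>x - t\<bar> powr (-3/4) + \<bar>x - t\<bar> + 2"
        using elim assms by (intro abs_ln_le_powr) auto
      also have "\<dots> \<le> 2 * \<bar>x - t\<bar> powr (-3/4) + (\<bar>x\<bar> + R + 2)" using True by linarith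
      finally have "m t * \<bar>ln ((x - t)^2 + (2 * e)^2) / 2\<bar> \<le> m t * (2 * \<bar>x - t\<bar> powr (-3/4) + (\<bar>x\<bar> + R + 2))"
        by (rule mult_left_mono) (rule m_nonneg)
      then show ?thesis unfolding real_norm_def abs_mult[of "m t"] abs_of_nonneg[OF m_nonneg]
        by (simp add: distrib_left mult_ac)
    qed (simp add: m_support)
  qed
  show int: "integrable lborel (\<lambda>t. 2 * (m t * \<bar>x - t\<bar> powr (-3/4)) + (\<bar>x\<bar> + R + 2) * m t)"
    using singular_integral(1)[of x] integrable_m by simp
  show i: "integrable lborel (\<lambda>t. m t * (lnorm (x - t) (2 * e)))"
  proof (rule Bochner_Integration.integrable_bound[OF int])
    show "AE t in lborel. norm (m t * (lnorm (x - t) (2 * e)))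
      \<le> norm (2 * (m t * \<bar>x - t\<bar> powr (-3/4)) + (\<bar>x\<bar> + R + 2) * m t)"
      using le by eventually_elim (unfold real_norm_def, erule order_trans, rule abs_ge_self)
  qed measurable
  have "\<bar>log_pot e x\<bar> \<le> (\<integral>t. norm (m t * (lnorm (x - t) (2 * e))) \<partial>lborel)"
    unfolding log_pot_def using integral_norm_bound[of lborel "\<lambda>t. m t * (lnorm (x - t) (2 * e))"] by simp
  also have "\<dots> \<le> (\<integral>t. 2 * (m t * \<bar>x - t\<bar> powr (-3/4)) + (\<bar>x\<bar> + R + 2) * m t \<partial>lborel)"
    by (rule integral_mono_AE[OF integrable_norm[OF i] int le])
  also have "\<dots> = 2 * (\<integral>t. m t * \<bar>x - t\<bar> powr (-3/4) \<partial>lborel) + (\<bar>x\<bar> + R + 2) * n"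
    using singular_integral(1)[of x] integrable_m by (simp add: integral_m)
  also have "\<dots> \<le> 2 * sing_bound + (\<bar>x\<bar> + R + 2) * n" using singular_integral(2)[of x] by simp
  finally show "\<bar>log_pot e x\<bar> \<le> 2 * sing_bound + (\<bar>x\<bar> + R + 2) * n" .
qed

lemma log_integrable: "integrable lborel (\<lambda>t. m t * ln \<bar>x - t\<bar>)"
  using log_pot_integrable(1)[of 0 x]
  by (simp only: half_ln_square mult_zero_right power_zero_numeral add_0_right order_refl zero_le_one)

lemma log_pot_m_integrable:
  assumes "0 \<le> e" "e \<le> 1"
  shows "integrable lborel (\<lambda>t. m t * log_pot e t)"
proof (rule integrable_m_mult)
  show "\<bar>log_pot e t\<bar> \<le> 2 * sing_bound + (R + R + 2) * n" if "\<bar>t\<bar> \<le> R" for t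
  proof -
    have "(\<bar>t\<bar> + R + 2) * n \<le> (R + R + 2) * n" using that by (intro mult_right_mono) auto
    then show ?thesis using log_pot_integrable(2)[OF assms, of t] by linarith
  qed
qed measurable

text \<open>The dictionary is applied once per variable: the inner integral is the regularized
  potential \<open>G\<close> of the whole charge, the outer one integrates \<open>G\<close>. The two
  cross terms agree because the kernel is even.\<close>

lemma mutual_log_eq:
  assumes e: "0 < e" "e \<le> 1"
  shows "mutual_log e = (\<Sum>i\<in>{1..n}. \<Sum>j\<in>{1..n}. lnorm (p i - p j) (2 * e))
    - 2 * (\<Sum>i\<in>{1..n}. log_pot e (p i)) + (\<integral>t. m t * log_pot e t \<partial>lborel)"
proof -
  have e': "0 \<le> e" using e by simp
  define g where "g = (\<lambda>d::real. lnorm d (2 * e))"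
  have [measurable]: "g \<in> borel_measurable borel" unfolding g_def by measurable
  have lp: "log_pot e x = (\<integral>t. m t * g (x - t) \<partial>lborel)" for x by (simp add: log_pot_def g_def)
  define G where "G = (\<lambda>x. (\<Sum>i\<in>{1..n}. g (x - p i)) - log_pot e x)"
  have inner: "has_bochner_integral charges (\<lambda>t. polarity t * g (x - position t)) (G x)" for x
    unfolding G_def lp using log_pot_integrable(1)[OF e' e(2), of x] by (intro charges_integral) (auto simp: g_def)
  have mg: "integrable lborel (\<lambda>t. m t * g (t - x))" for x
    using log_pot_integrable(1)[OF e' e(2), of x] by (simp add: g_def power2_commute)
  have mG: "m t * G t = (\<Sum>i\<in>{1..n}. m t * g (t - p i)) - m t * log_pot e t" for t
    by (simp add: G_def right_diff_distrib sum_distrib_left)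
  have iG: "integrable lborel (\<lambda>t. m t * G t)"
    unfolding mG using mg log_pot_m_integrable[OF e' e(2)] by (intro Bochner_Integration.integrable_diff) auto
  have lp': "(\<integral>t. m t * g (t - x) \<partial>lborel) = log_pot e x" for x
    unfolding lp by (simp add: g_def power2_commute)
  have outer: "has_bochner_integral charges (\<lambda>t. polarity t * G (position t)) ((\<Sum>i\<in>{1..n}. G (p i)) - (\<integral>t. m t * G t \<partial>lborel))"
    by (rule charges_integral[OF _ iG]) (simp add: G_def)
  have int: "integrable M2 (\<lambda>st. polarity (fst st) * polarity (snd st) * g (position (fst st) - position (snd st)))"
  proof (rule MM.integrable_const_bound[OF AE_I2])
    fix st :: "real \<times> real"
    define d where "d = position (fst st) - position (snd st)"
    have "\<bar>d\<bar> \<le> 2 * bound" unfolding d_def using pos_le[of "fst st"] pos_le[of "snd st"] by linarith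
    then have "d^2 \<le> (2 * bound)^2" by (metis abs_ge_zero power2_abs power_mono)
    then have "ln (d^2 + (2 * e)^2) \<le> ln ((2 * bound)^2 + (2 * e)^2)"
      using e by (intro ln_mono) (auto intro!: add_nonneg_pos)
    moreover have "ln ((2 * e)^2) \<le> ln (d^2 + (2 * e)^2)" using e by (intro ln_mono) auto
    moreover have "\<bar>v\<bar> \<le> \<bar>a\<bar> + \<bar>b\<bar>" if "a \<le> v" "v \<le> b" for a b v :: real using that by linarith
    ultimately have "\<bar>ln (d^2 + (2 * e)^2)\<bar> \<le> \<bar>ln ((2 * e)^2)\<bar> + \<bar>ln ((2 * bound)^2 + (2 * e)^2)\<bar>" by blast
    then have "\<bar>g d\<bar> \<le> \<bar>ln ((2 * e)^2)\<bar> + \<bar>ln ((2 * bound)^2 + (2 * e)^2)\<bar>" by (simp add: g_def)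
    then show "norm (polarity (fst st) * polarity (snd st) * g (position (fst st) - position (snd st)))
      \<le> \<bar>ln ((2 * e)^2)\<bar> + \<bar>ln ((2 * bound)^2 + (2 * e)^2)\<bar>"
      unfolding d_def by (simp add: abs_mult polarity_def)
  qed measurable
  have "mutual_log e = (\<integral>st. polarity (fst st) * polarity (snd st) * g (position (fst st) - position (snd st)) \<partial>M2)"
    unfolding mutual_log_def g_def by (intro Bochner_Integration.integral_cong refl) (simp add: power2_commute)
  also have "\<dots> = (\<integral>s. (\<integral>t. polarity s * polarity t * g (position s - position t) \<partial>charges) \<partial>charges)"
    by (subst pair.integral_fst'[OF int, symmetric]) simp
  also have "\<dots> = (\<integral>s. polarity s * G (position s) \<partial>charges)"
    using inner by (intro Bochner_Integration.integral_cong refl) (simp add: has_bochner_integral_iff mult.assoc)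
  also have "\<dots> = (\<Sum>i\<in>{1..n}. G (p i)) - (\<integral>t. m t * G t \<partial>lborel)"
    using outer by (simp add: has_bochner_integral_iff)
  also have "(\<integral>t. m t * G t \<partial>lborel) = (\<Sum>i\<in>{1..n}. log_pot e (p i)) - (\<integral>t. m t * log_pot e t \<partial>lborel)"
    unfolding mG using mg log_pot_m_integrable[OF e' e(2)]
    by (subst Bochner_Integration.integral_diff) (auto simp: lp')
  finally show ?thesis by (simp add: G_def sum_subtractf g_def)
qed

text \<open>Ordered pairs including the diagonal, so the cardinality is the sum of the squared
  multiplicities.\<close>

definition coincidences :: "(nat \<times> nat) set" where
  "coincidences = {(i, j) \<in> {1..n} \<times> {1..n}. p i = p j}"

text \<open>Finite part of the double integral of ln |s - t| against the charge, with coinciding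
  pairs left out.\<close>

definition interaction :: real where
  "interaction = (\<Sum>(i, j) \<in> {(i, j) \<in> {1..n} \<times> {1..n}. p i \<noteq> p j}. ln \<bar>p i - p j\<bar>)
    - 2 * (\<Sum>i\<in>{1..n}. \<integral>t. m t * ln \<bar>p i - t\<bar> \<partial>lborel) + (\<integral>s. m s * (\<integral>t. m t * ln \<bar>s - t\<bar> \<partial>lborel) \<partial>lborel)"

lemma log_pot_0: "log_pot 0 x = (\<integral>t. m t * ln \<bar>x - t\<bar> \<partial>lborel)"
proof -
  have "lnorm (x - t) (2 * 0) = ln \<bar>x - t\<bar>" for t
    using half_ln_square[of "x - t"] by simp
  then show ?thesis unfolding log_pot_def by simp
qed

lemma log_pot_tendsto:
  assumes e: "e \<longlonglongrightarrow> 0" "\<And>k::nat. 0 < e k" "\<And>k. e k \<le> 1"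
  shows "(\<lambda>k. log_pot (e k) x) \<longlonglongrightarrow> log_pot 0 x"
  unfolding log_pot_def
proof (rule integral_dominated_convergence)
  show "AE t in lborel. norm (m t * (lnorm (x - t) (2 * e k)))
      \<le> 2 * (m t * \<bar>x - t\<bar> powr (-3/4)) + (\<bar>x\<bar> + R + 2) * m t" for k
    using log_pot_integrable(3)[of "e k" x] e(2,3)[of k] by simp
  show "AE t in lborel. (\<lambda>k. m t * (lnorm (x - t) (2 * e k))) \<longlonglongrightarrow> m t * (lnorm (x - t) (2 * 0))"
    using AE_lborel_singleton[of x]
    by eventually_elim (intro tendsto_intros e(1); simp)
qed (use log_pot_integrable(4)[of 0 x] in \<open>simp_all\<close>)

text \<open>A coinciding pair contributes exactly ln (2 e), whence the subtracted term; distinct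
  pairs and the integrals against the density converge to their values at e = 0.\<close>

lemma mutual_log_asymp:
  assumes e: "e \<longlonglongrightarrow> 0" "\<And>k::nat. 0 < e k" "\<And>k. e k \<le> 1"
  shows "(\<lambda>k. mutual_log (e k) - card coincidences * ln (2 * e k)) \<longlonglongrightarrow> interaction"
proof -
  let ?D = "{(i, j) \<in> {1..n} \<times> {1..n}. p i \<noteq> p j}"
  have fin: "finite ?D" "finite coincidences" unfolding coincidences_def by (auto intro: finite_subset[of _ "{1..n} \<times> {1..n}"])
  have split: "(\<Sum>i\<in>{1..n}. \<Sum>j\<in>{1..n}. lnorm (p i - p j) (2 * a)) =
     card coincidences * ln (2 * a) + (\<Sum>(i,j)\<in>?D. lnorm (p i - p j) (2 * a))" if "a > 0" for a
  proof -
    have "(\<Sum>i\<in>{1..n}. \<Sum>j\<in>{1..n}. lnorm (p i - p j) (2 * a)) =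
      (\<Sum>(i,j)\<in>coincidences \<union> ?D. lnorm (p i - p j) (2 * a))"
      unfolding sum.cartesian_product by (intro sum.cong) (auto simp: coincidences_def)
    also have "\<dots> = (\<Sum>(i,j)\<in>coincidences. lnorm (p i - p j) (2 * a)) + (\<Sum>(i,j)\<in>?D. lnorm (p i - p j) (2 * a))"
      using fin by (intro sum.union_disjoint) (auto simp: coincidences_def)
    also have "(\<Sum>(i,j)\<in>coincidences. lnorm (p i - p j) (2 * a)) = (\<Sum>ij\<in>coincidences. ln (2 * a))"
      using that half_ln_square[of "2 * a"] by (intro sum.cong) (auto simp: coincidences_def)
    finally show ?thesis by simp
  qed
  have lim0: "(\<lambda>k. lnorm (p i - p j) (2 * e k)) \<longlonglongrightarrow> ln \<bar>p i - p j\<bar>" if "p i \<noteq> p j" for i j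
  proof -
    have "(\<lambda>k. lnorm (p i - p j) (2 * e k)) \<longlonglongrightarrow> lnorm (p i - p j) (2 * 0)"
      using that by (intro tendsto_intros e(1)) auto
    also have "lnorm (p i - p j) (2 * 0) = ln \<bar>p i - p j\<bar>"
      using half_ln_square[of "p i - p j"] by simp
    finally show ?thesis .
  qed
  have lim1: "(\<lambda>k. \<Sum>(i,j)\<in>?D. lnorm (p i - p j) (2 * e k)) \<longlonglongrightarrow> (\<Sum>(i, j) \<in> ?D. ln \<bar>p i - p j\<bar>)"
    unfolding split_beta by (intro tendsto_sum lim0) auto
  have lim2: "(\<lambda>k. \<integral>t. m t * log_pot (e k) t \<partial>lborel) \<longlonglongrightarrow> (\<integral>t. m t * log_pot 0 t \<partial>lborel)"
  proof (rule integral_dominated_convergence)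
    define K where "K = 2 * sing_bound + (R + R + 2) * n"
    show "integrable lborel (\<lambda>t. m t * K)" using integrable_m by simp
    show "AE t in lborel. norm (m t * log_pot (e k) t) \<le> m t * K" for k
    proof (rule AE_I2)
      fix t show "norm (m t * log_pot (e k) t) \<le> m t * K"
      proof (cases "\<bar>t\<bar> \<le> R")
        case True
        have "(\<bar>t\<bar> + R + 2) * n \<le> (R + R + 2) * n" using True by (intro mult_right_mono) auto
        then have "\<bar>log_pot (e k) t\<bar> \<le> K"
          using log_pot_integrable(2)[of "e k" t] e(2,3)[of k] unfolding K_def by linarith
        then show ?thesis using m_nonneg[of t] by (auto simp: abs_mult intro!: mult_left_mono)
      qed (simp add: m_support)
    qed
    show "AE t in lborel. (\<lambda>k. m t * log_pot (e k) t) \<longlonglongrightarrow> m t * log_pot 0 t"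
      by (intro AE_I2 tendsto_mult tendsto_const log_pot_tendsto[OF e])
  qed measurable
  have lim3: "(\<lambda>k. \<Sum>i\<in>{1..n}. log_pot (e k) (p i)) \<longlonglongrightarrow> (\<Sum>i\<in>{1..n}. log_pot 0 (p i))"
    by (intro tendsto_sum log_pot_tendsto[OF e])
  have "(\<lambda>k. (\<Sum>(i,j)\<in>?D. lnorm (p i - p j) (2 * e k)) - 2 * (\<Sum>i\<in>{1..n}. log_pot (e k) (p i))
     + (\<integral>t. m t * log_pot (e k) t \<partial>lborel)) \<longlonglongrightarrow> interaction"
    unfolding interaction_def log_pot_0[symmetric]
    by (rule tendsto_add[OF tendsto_diff[OF lim1 tendsto_mult[OF tendsto_const lim3]] lim2])
  moreover have "mutual_log (e k) - card coincidences * ln (2 * e k) =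
      (\<Sum>(i,j)\<in>?D. lnorm (p i - p j) (2 * e k)) - 2 * (\<Sum>i\<in>{1..n}. log_pot (e k) (p i))
     + (\<integral>t. m t * log_pot (e k) t \<partial>lborel)" for k
    unfolding mutual_log_eq[OF e(2,3)] split[OF e(2)] by linarith
  ultimately show ?thesis by (simp only:)
qed

end

section \<open>From strips to discs\<close>

text \<open>1 / r = r^(-3/4) r^(-1/4), where the norm r is at least |d| and |y|. With these
  exponents a further factor |y|^(-1/4) still leaves both powers above -1, hence locally
  integrable.\<close>

lemma inverse_norm_le_powr:
  fixes d y :: real
  assumes d: "d \<noteq> 0" and y: "y \<noteq> 0"
  shows "1 / sqrt (d^2 + y^2) \<le> \<bar>d\<bar> powr (-3/4) * \<bar>y\<bar> powr (-1/4)"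
proof -
  define r where "r = sqrt (d^2 + y^2)"
  have r: "\<bar>d\<bar> \<le> r" "\<bar>y\<bar> \<le> r" unfolding r_def by (simp_all add: real_le_rsqrt)
  have r0: "0 < r" using r d by linarith
  have "1 / r = r powr (-1)" using r0 by (simp add: powr_minus_divide)
  also have "\<dots> = r powr (-3/4) * r powr (-1/4)" by (simp flip: powr_add)
  also have "\<dots> \<le> \<bar>d\<bar> powr (-3/4) * \<bar>y\<bar> powr (-1/4)"
    using r d y by (intro mult_mono powr_mono2') auto
  finally show ?thesis by (simp add: r_def)
qed

lemma abs_component_le:
  fixes d y :: real
  assumes "y \<noteq> 0"
  shows "\<bar>d / (d^2 + y^2)\<bar> \<le> 1 / sqrt (d^2 + y^2)" and "\<bar>y / (d^2 + y^2)\<bar> \<le> 1 / sqrt (d^2 + y^2)"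
proof -
  define r where "r = sqrt (d^2 + y^2)"
  have r: "\<bar>d\<bar> \<le> r" "\<bar>y\<bar> \<le> r" unfolding r_def by (simp_all add: real_le_rsqrt)
  have r0: "0 < r" using r assms by linarith
  have r2: "d^2 + y^2 = r * r" by (simp add: r_def)
  show "\<bar>d / (d^2 + y^2)\<bar> \<le> 1 / sqrt (d^2 + y^2)" "\<bar>y / (d^2 + y^2)\<bar> \<le> 1 / sqrt (d^2 + y^2)"
    using r r0 unfolding r_def[symmetric] r2 by (simp_all add: abs_divide divide_simps)
qed

lemma AE_snd_neq: "AE q in lborel. snd (q :: real \<times> real) \<noteq> c"
  using AE_lborel_inner_neq[of "(0, 1) :: real \<times> real" c] by (simp add: Basis_prod_def inner_prod_def)

lemma AE_fst_neq: "AE q in lborel. fst (q :: real \<times> real) \<noteq> c"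
  using AE_lborel_inner_neq[of "(1, 0) :: real \<times> real" c] by (simp add: Basis_prod_def inner_prod_def)

context screened_points
begin

definition cloud_x :: "real \<Rightarrow> real \<Rightarrow> real" where
  "cloud_x x y = (\<integral>t. m t * ((x - t) / ((x - t)^2 + y^2)) \<partial>lborel)"

definition cloud_y :: "real \<Rightarrow> real \<Rightarrow> real" where
  "cloud_y x y = (\<integral>t. m t * (y / ((x - t)^2 + y^2)) \<partial>lborel)"

lemma field_decomp:
  assumes y: "y \<noteq> 0"
  shows "field_x x y = (\<Sum>i\<in>{1..n}. (x - p i) / ((x - p i)^2 + y^2)) - cloud_x x y"
    and "field_y x y = (\<Sum>i\<in>{1..n}. y / ((x - p i)^2 + y^2)) - cloud_y x y"
proof -
  have P: "(x - t)^2 + y^2 \<ge> y^2" "y^2 > 0" for t using y by auto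
  have "\<bar>(x - t) / ((x - t)^2 + y^2)\<bar> \<le> (\<bar>x\<bar> + R) / y^2" if "\<bar>t\<bar> \<le> R" for t
    unfolding abs_divide using P(1)[of t] P(2) that by (intro frac_le) auto
  then have "integrable lborel (\<lambda>t. m t * ((x - t) / ((x - t)^2 + y^2)))" by (intro integrable_m_mult) auto
  from charges_integral[OF _ this]
  show "field_x x y = (\<Sum>i\<in>{1..n}. (x - p i) / ((x - p i)^2 + y^2)) - cloud_x x y"
    unfolding field_x_def cloud_x_def by (simp add: has_bochner_integral_iff)
  have "\<bar>y / ((x - t)^2 + y^2)\<bar> \<le> \<bar>y\<bar> / y^2" for t
    unfolding abs_divide using P(1)[of t] P(2) by (intro frac_le) auto
  then have "integrable lborel (\<lambda>t. m t * (y / ((x - t)^2 + y^2)))" by (intro integrable_m_mult) auto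
  from charges_integral[OF _ this]
  show "field_y x y = (\<Sum>i\<in>{1..n}. y / ((x - p i)^2 + y^2)) - cloud_y x y"
    unfolding field_y_def cloud_y_def by (simp add: has_bochner_integral_iff)
qed

text \<open>The product bound is integrated against \<open>m\<close>: \<open>sing_bound\<close>
  absorbs the factor in x - t uniformly and leaves the factor in y.\<close>

lemma cloud_le:
  assumes y: "y \<noteq> 0"
  shows "\<bar>cloud_x x y\<bar> \<le> sing_bound * \<bar>y\<bar> powr (-1/4)" and "\<bar>cloud_y x y\<bar> \<le> sing_bound * \<bar>y\<bar> powr (-1/4)"
proof -
  have main: "\<bar>\<integral>t. m t * f t \<partial>lborel\<bar> \<le> sing_bound * \<bar>y\<bar> powr (-1/4)"
    if [measurable]: "f \<in> borel_measurable borel" and f: "\<And>t. \<bar>f t\<bar> \<le> 1 / sqrt ((x - t)^2 + y^2)" for f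
  proof -
    have le: "AE t in lborel. norm (m t * f t) \<le> m t * \<bar>x - t\<bar> powr (-3/4) * \<bar>y\<bar> powr (-1/4)"
      using AE_lborel_singleton[of x]
    proof eventually_elim
      case (elim t)
      then have "\<bar>f t\<bar> \<le> \<bar>x - t\<bar> powr (-3/4) * \<bar>y\<bar> powr (-1/4)"
        using f[of t] inverse_norm_le_powr[OF _ y, of "x - t"] by simp
      from mult_left_mono[OF this m_nonneg[of t]] show ?case
        unfolding real_norm_def abs_mult abs_of_nonneg[OF m_nonneg] by (simp only: mult.assoc)
    qed
    have int: "integrable lborel (\<lambda>t. m t * \<bar>x - t\<bar> powr (-3/4) * \<bar>y\<bar> powr (-1/4))"
      by (rule integrable_mult_left) (rule singular_integral(1))
    have i: "integrable lborel (\<lambda>t. m t * f t)"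
    proof (rule Bochner_Integration.integrable_bound[OF int])
      show "AE t in lborel. norm (m t * f t) \<le> norm (m t * \<bar>x - t\<bar> powr (-3/4) * \<bar>y\<bar> powr (-1/4))"
        using le by eventually_elim (unfold real_norm_def, erule order_trans, rule abs_ge_self)
    qed measurable
    have "\<bar>\<integral>t. m t * f t \<partial>lborel\<bar> \<le> (\<integral>t. norm (m t * f t) \<partial>lborel)"
      using integral_norm_bound[of lborel "\<lambda>t. m t * f t"] by simp
    also have "\<dots> \<le> (\<integral>t. m t * \<bar>x - t\<bar> powr (-3/4) * \<bar>y\<bar> powr (-1/4) \<partial>lborel)"
      by (rule integral_mono_AE[OF integrable_norm[OF i] int le])
    also have "\<dots> = (\<integral>t. m t * \<bar>x - t\<bar> powr (-3/4) \<partial>lborel) * \<bar>y\<bar> powr (-1/4)"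
      by (rule integral_mult_left_zero)
    also have "\<dots> \<le> sing_bound * \<bar>y\<bar> powr (-1/4)"
      by (rule mult_right_mono[OF singular_integral(2)]) simp
    finally show ?thesis .
  qed
  show "\<bar>cloud_x x y\<bar> \<le> sing_bound * \<bar>y\<bar> powr (-1/4)" "\<bar>cloud_y x y\<bar> \<le> sing_bound * \<bar>y\<bar> powr (-1/4)"
    unfolding cloud_x_def cloud_y_def by (rule main; use abs_component_le[OF y] in simp)+
qed

section \<open>The squared field without its poles\<close>

definition discs :: "real \<Rightarrow> (real \<times> real) set" where
  "discs \<eta> = (\<Union>i\<in>{1..n}. ball (p i, 0) \<eta>)"

lemma sets_discs [measurable]: "discs \<eta> \<in> sets borel" unfolding discs_def by measurable

lemma finite_coincidences [simp]: "finite coincidences"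
  unfolding coincidences_def by (auto intro: finite_subset[of _ "{1..n} \<times> {1..n}"])

text \<open>Summing over the pairs of coinciding indices subtracts the square of the multiplicity. The remainder is
  integrable near the atoms because the field of an atom is at most \<open>\<bar>x\<bar>\<^sup>-\<^sup>3\<^sup>/\<^sup>4 \<bar>y\<bar>\<^sup>-\<^sup>1\<^sup>/\<^sup>4\<close> and that of the density
  at most a multiple of \<open>\<bar>y\<bar>\<^sup>-\<^sup>1\<^sup>/\<^sup>4\<close>.\<close>

definition regular_part :: "real \<Rightarrow> real \<times> real \<Rightarrow> real" where
  "regular_part \<delta> q = field_sq q - (\<Sum>(i, j)\<in>coincidences. indicator (ball (p i, 0) \<delta>) q * (1 / ((fst q - p i)^2 + (snd q)^2)))"

abbreviation reg_int :: "real \<Rightarrow> (real \<times> real) set \<Rightarrow> real" where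
  "reg_int \<delta> A \<equiv> \<integral>q. regular_part \<delta> q * indicator A q \<partial>lborel"

lemma regular_part_measurable [measurable]: "regular_part \<delta> \<in> borel_measurable borel"
proof -
  have "(\<lambda>q::real\<times>real. indicator (ball (a, 0) \<delta>) q * (1 / ((fst q - a)^2 + (snd q)^2)) :: real) \<in> borel_measurable borel" for a
    by (intro borel_measurable_times borel_measurable_indicator borel_measurable_divide borel_measurable_add
        borel_measurable_power borel_measurable_diff borel_measurable_const borel_measurable_continuous_onI continuous_intros) auto
  then show ?thesis unfolding regular_part_def[abs_def] split_beta by (intro borel_measurable_diff borel_measurable_sum field_sq_measurable)
qed

text \<open>Guarantees that open discs of radius \<delta> about different points do not
  overlap.\<close>

definition separated :: "real \<Rightarrow> bool" where
  "separated \<delta> \<longleftrightarrow> (\<forall>i\<in>{1..n}. \<forall>j\<in>{1..n}. p i \<noteq> p j \<longrightarrow> 2 * \<delta> \<le> \<bar>p i - p j\<bar>)"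

lemma separatedD:
  "separated \<delta> \<Longrightarrow> i \<in> {1..n} \<Longrightarrow> j \<in> {1..n} \<Longrightarrow> p i \<noteq> p j \<Longrightarrow> 2 * \<delta> \<le> \<bar>p i - p j\<bar>"
  by (simp add: separated_def)

text \<open>Four kinds of terms occur: coinciding pairs, distinct pairs, atom with density, density
  with itself. Each is bounded by a multiple of \<open>Q * (z * z)\<close>, with \<open>Q\<close>
  and \<open>z\<close> as defined below. Near an atom a coinciding pair cancels against the
  subtracted pole. The excluded lines y = 0 and x = p i are null.\<close>

lemma regular_part_le:
  assumes \<delta>: "0 < \<delta>" and sep: "separated \<delta>"
  obtains K where "\<And>x y. 0 < \<bar>y\<bar> \<Longrightarrow> \<bar>y\<bar> \<le> 1 \<Longrightarrow> (\<And>i. i \<in> {1..n} \<Longrightarrow> x \<noteq> p i) \<Longrightarrow>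
    \<bar>regular_part \<delta> (x, y)\<bar> \<le> K * ((1 + (\<Sum>i\<in>{1..n}. \<bar>x - p i\<bar> powr (-3/4))) * \<bar>y\<bar> powr (-1/2))"
proof -
  let ?D = "{(i, j) \<in> {1..n} \<times> {1..n}. p i \<noteq> p j}"
  have fin: "finite ?D" by (auto intro: finite_subset[of _ "{1..n} \<times> {1..n}"])
  define S where "S = sing_bound"
  have S0: "0 \<le> S" unfolding S_def by (rule singular_integral(3))
  \<comment> \<open>One summand for each of the bounds \<open>c\<close>, \<open>d\<close>,
    \<open>e\<close>, \<open>f\<close> below.\<close>
  define K where "K = card coincidences * (1 / \<delta>^2) + card ?D * (1 / \<delta>) + 2 * (n * (2 * S)) + 2 * S^2"
  show thesis
  proof (rule that[of K])
    fix x y :: real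
    assume y: "0 < \<bar>y\<bar>" "\<bar>y\<bar> \<le> 1" and x: "\<And>i. i \<in> {1..n} \<Longrightarrow> x \<noteq> p i"
    define r where "r = (\<lambda>i. sqrt ((x - p i)^2 + y^2))"
    define a where "a = (\<lambda>i. (x - p i) / ((x - p i)^2 + y^2))"
    define b where "b = (\<lambda>i. y / ((x - p i)^2 + y^2))"
    define z where "z = \<bar>y\<bar> powr (-1/4)"
    define Q where "Q = 1 + (\<Sum>i\<in>{1..n}. \<bar>x - p i\<bar> powr (-3/4))"
    have yn: "y \<noteq> 0" using y by auto
    have r0: "0 < r i" for i using yn unfolding r_def by (simp add: add_nonneg_pos)
    have r2: "(r i)^2 = (x - p i)^2 + y^2" for i unfolding r_def by simp
    have a_le: "\<bar>a i\<bar> \<le> 1 / r i" and b_le: "\<bar>b i\<bar> \<le> 1 / r i" for i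
      unfolding a_def b_def r_def using abs_component_le[OF yn] by auto
    have z1: "1 \<le> z" unfolding z_def using y powr_mono2'[of "-1/4" "\<bar>y\<bar>" 1] by simp
    have zz: "z * z = \<bar>y\<bar> powr (-1/2)" unfolding z_def by (simp flip: powr_add)
    have Q1: "1 \<le> Q" unfolding Q_def by (simp add: sum_nonneg)
    have rq: "1 / r i \<le> Q * z" if "i \<in> {1..n}" for i
    proof -
      have "1 / r i \<le> \<bar>x - p i\<bar> powr (-3/4) * z"
        unfolding r_def z_def using x[OF that] yn by (intro inverse_norm_le_powr) auto
      also have "\<bar>x - p i\<bar> powr (-3/4) \<le> (\<Sum>i\<in>{1..n}. \<bar>x - p i\<bar> powr (-3/4))"
        using that by (intro member_le_sum) auto
      also have "\<dots> \<le> Q" by (simp add: Q_def)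
      finally show ?thesis using z1 by (simp add: mult_right_mono)
    qed
    define X where "X = cloud_x x y"
    define Y where "Y = cloud_y x y"
    have XY: "\<bar>X\<bar> \<le> S * z" "\<bar>Y\<bar> \<le> S * z" using cloud_le[OF yn, of x] unfolding X_def Y_def S_def z_def by auto
    have zQ: "z \<le> Q * z" using mult_right_mono[OF Q1, of z] z1 by simp
    \<comment> \<open>As \<open>Q\<close> and \<open>z\<close> are at least 1, the latter because
      |y| <= 1, lower powers may be raised to the common bound.\<close>
    have W: "1 \<le> Q * (z * z)" "z * z \<le> Q * (z * z)" "Q * z \<le> Q * (z * z)"
    proof -
      have zz1: "1 \<le> z * z" using mult_mono[OF z1 z1] z1 by simp
      show "z * z \<le> Q * (z * z)" using mult_right_mono[OF Q1, of "z * z"] zz1 by simp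
      then show "1 \<le> Q * (z * z)" using zz1 by linarith
      show "Q * z \<le> Q * (z * z)" using mult_left_mono[of z "z * z" Q] mult_left_mono[OF z1, of z] z1 Q1 by simp
    qed
    have sq: "field_sq (x, y) = (\<Sum>(i, j)\<in>coincidences. a i * a j + b i * b j) + (\<Sum>(i, j)\<in>?D. a i * a j + b i * b j)
      - 2 * (\<Sum>i\<in>{1..n}. a i * X + b i * Y) + (X^2 + Y^2)"
    proof -
      have "(\<Sum>i\<in>{1..n}. a i)^2 + (\<Sum>i\<in>{1..n}. b i)^2 = (\<Sum>(i, j)\<in>{1..n}\<times>{1..n}. a i * a j + b i * b j)"
        unfolding power2_eq_square sum_product sum.cartesian_product by (simp add: split_beta sum.distrib)
      also have "{1..n}\<times>{1..n} = coincidences \<union> ?D" by (auto simp: coincidences_def)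
      also have "(\<Sum>(i, j)\<in>coincidences \<union> ?D. a i * a j + b i * b j) =
        (\<Sum>(i, j)\<in>coincidences. a i * a j + b i * b j) + (\<Sum>(i, j)\<in>?D. a i * a j + b i * b j)"
        by (rule sum.union_disjoint[OF finite_coincidences fin]) (auto simp: coincidences_def)
      finally have eq: "(\<Sum>i\<in>{1..n}. a i)^2 + (\<Sum>i\<in>{1..n}. b i)^2 = \<dots>" .
      have "field_sq (x, y) = ((\<Sum>i\<in>{1..n}. a i) - X)^2 + ((\<Sum>i\<in>{1..n}. b i) - Y)^2"
        unfolding field_sq_def fst_conv snd_conv field_decomp[OF yn] a_def b_def X_def Y_def by simp
      also have "\<dots> = ((\<Sum>i\<in>{1..n}. a i)^2 + (\<Sum>i\<in>{1..n}. b i)^2) - 2 * ((\<Sum>i\<in>{1..n}. a i) * X + (\<Sum>i\<in>{1..n}. b i) * Y) + (X^2 + Y^2)"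
        by (simp add: power2_eq_square algebra_simps)
      finally show ?thesis unfolding eq by (simp only: sum_distrib_right sum.distrib)
    qed
    define c where "c = (\<Sum>(i, j)\<in>coincidences. a i * a j + b i * b j - indicator (ball (p i, 0) \<delta>) (x, y) * (1 / ((x - p i)^2 + y^2)))"
    have reg: "regular_part \<delta> (x, y) = c + (\<Sum>(i, j)\<in>?D. a i * a j + b i * b j)
      - 2 * (\<Sum>i\<in>{1..n}. a i * X + b i * Y) + (X^2 + Y^2)"
      unfolding regular_part_def sq c_def by (simp add: split_beta sum_subtractf)
    have c: "\<bar>c\<bar> \<le> card coincidences * (1 / \<delta>^2) * (Q * (z * z))"
    proof -
      have "\<bar>c\<bar> \<le> (\<Sum>ij\<in>coincidences. 1 / \<delta>^2)"
        unfolding c_def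
      proof (rule order_trans[OF sum_abs sum_mono], clarify)
        fix i j assume "(i, j) \<in> coincidences"
        then have "p j = p i" by (simp add: coincidences_def)
        then have "a i * a j + b i * b j = ((x - p i)^2 + y^2) / ((x - p i)^2 + y^2)^2"
          by (simp add: a_def b_def power2_eq_square add_divide_distrib)
        also have "\<dots> = 1 / (r i)^2" using r0[of i] unfolding r2[symmetric] by (simp add: power2_eq_square)
        finally have e: "a i * a j + b i * b j = 1 / (r i)^2" .
        \<comment> \<open>Inside the disc the pair equals the subtracted pole and the difference is
          0; outside it 1 / r^2 is at most 1 / \<delta>^2.\<close>
        have "(x, y) \<in> ball (p i, 0) \<delta> \<longleftrightarrow> r i < \<delta>"
          by (simp add: r_def dist_Pair_Pair dist_real_def power2_commute)
        then show "\<bar>a i * a j + b i * b j - indicator (ball (p i, 0) \<delta>) (x, y) * (1 / ((x - p i)^2 + y^2))\<bar> \<le> 1 / \<delta>^2"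
          unfolding e r2[symmetric] using \<delta> r0[of i]
          by (auto simp: not_less divide_simps power_mono split: split_indicator)
      qed
      also have "\<dots> = card coincidences * (1 / \<delta>^2) * 1" by simp
      also have "\<dots> \<le> card coincidences * (1 / \<delta>^2) * (Q * (z * z))" using W by (intro mult_left_mono) auto
      finally show ?thesis .
    qed
    have d: "\<bar>\<Sum>(i, j)\<in>?D. a i * a j + b i * b j\<bar> \<le> card ?D * (1 / \<delta>) * (Q * (z * z))"
    proof -
      have "\<bar>\<Sum>(i, j)\<in>?D. a i * a j + b i * b j\<bar> \<le> (\<Sum>ij\<in>?D. 1 / \<delta> * (Q * z))"
      proof (rule order_trans[OF sum_abs sum_mono], clarify)
        fix i j assume ij: "i \<in> {1..n}" "j \<in> {1..n}" "p i \<noteq> p j"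
        have cs: "(a i * a j + b i * b j)^2 \<le> ((a i)^2 + (b i)^2) * ((a j)^2 + (b j)^2)"
          using zero_le_power2[of "a i * b j - b i * a j"] by (simp add: power2_eq_square algebra_simps)
        have n2: "(a i)^2 + (b i)^2 = (1 / r i)^2" for i
        proof -
          have "(a i)^2 + (b i)^2 = ((x - p i)^2 + y^2) / ((x - p i)^2 + y^2)^2"
            by (simp add: a_def b_def power_divide add_divide_distrib)
          also have "\<dots> = (1 / r i)^2" using r0[of i] unfolding r2[symmetric] by (simp add: power2_eq_square)
          finally show ?thesis .
        qed
        have "\<bar>a i * a j + b i * b j\<bar> \<le> \<bar>1 / r i * (1 / r j)\<bar>"
          using cs unfolding n2 power_mult_distrib[symmetric] abs_le_square_iff .
        also have "\<dots> = 1 / (r i * r j)" using r0[of i] r0[of j] by simp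
        \<comment> \<open>1 / (r_i r_j) = (1 / r_i + 1 / r_j) / (r_i + r_j), and r_i + r_j >= 2
          \<delta> because no point is close to two separated atoms. A product of singularities
          becomes a sum of single ones.\<close>
        also have "\<dots> \<le> (1 / r i + 1 / r j) / (2 * \<delta>)"
        proof -
          have "\<bar>x - p i\<bar> \<le> r i" "\<bar>x - p j\<bar> \<le> r j" unfolding r_def by (simp_all add: real_le_rsqrt)
          then have "2 * \<delta> \<le> r i + r j" using separatedD[OF sep ij] by linarith
          then show ?thesis using r0[of i] r0[of j] \<delta> by (simp add: divide_simps)
        qed
        also have "\<dots> \<le> (Q * z + Q * z) / (2 * \<delta>)"
          using \<delta> rq ij by (intro divide_right_mono add_mono) auto
        finally show "\<bar>a i * a j + b i * b j\<bar> \<le> 1 / \<delta> * (Q * z)" by simp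
      qed
      also have "\<dots> = card ?D * (1 / \<delta>) * (Q * z)" by simp
      also have "\<dots> \<le> card ?D * (1 / \<delta>) * (Q * (z * z))" using \<delta> by (intro mult_left_mono[OF W(3)]) auto
      finally show ?thesis .
    qed
    have e: "\<bar>\<Sum>i\<in>{1..n}. a i * X + b i * Y\<bar> \<le> n * (2 * S) * (Q * (z * z))"
    proof -
      have "\<bar>\<Sum>i\<in>{1..n}. a i * X + b i * Y\<bar> \<le> (\<Sum>i\<in>{1..n}. 2 * S * (Q * (z * z)))"
      proof (rule order_trans[OF sum_abs sum_mono])
        fix i assume i: "i \<in> {1..n}"
        have "\<bar>a i * X + b i * Y\<bar> \<le> \<bar>a i\<bar> * \<bar>X\<bar> + \<bar>b i\<bar> * \<bar>Y\<bar>"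
          unfolding abs_mult[symmetric] by (rule abs_triangle_ineq)
        also have "\<dots> \<le> (Q * z) * (S * z) + (Q * z) * (S * z)"
          using order_trans[OF a_le rq[OF i]] order_trans[OF b_le rq[OF i]] XY Q1 z1
          by (intro add_mono mult_mono) auto
        finally show "\<bar>a i * X + b i * Y\<bar> \<le> 2 * S * (Q * (z * z))" by (simp add: mult_ac)
      qed
      then show ?thesis by simp
    qed
    have f: "\<bar>X^2 + Y^2\<bar> \<le> 2 * S^2 * (Q * (z * z))"
    proof -
      have "X^2 \<le> (S * z)^2" "Y^2 \<le> (S * z)^2" using XY by (metis abs_ge_zero power2_abs power_mono)+
      then have "\<bar>X^2 + Y^2\<bar> \<le> 2 * S^2 * (z * z)" by (simp add: power2_eq_square algebra_simps)
      also have "\<dots> \<le> 2 * S^2 * (Q * (z * z))" using W by (intro mult_left_mono) auto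
      finally show ?thesis .
    qed
    have "\<bar>regular_part \<delta> (x, y)\<bar> \<le> \<bar>c\<bar> + \<bar>\<Sum>(i, j)\<in>?D. a i * a j + b i * b j\<bar> + 2 * \<bar>\<Sum>i\<in>{1..n}. a i * X + b i * Y\<bar> + \<bar>X^2 + Y^2\<bar>"
      unfolding reg by linarith
    also have "\<dots> \<le> card coincidences * (1 / \<delta>^2) * (Q * (z * z)) + card ?D * (1 / \<delta>) * (Q * (z * z)) + 2 * (n * (2 * S) * (Q * (z * z))) + 2 * S^2 * (Q * (z * z))"
      by (intro add_mono c d f mult_left_mono[OF e]) simp
    also have "\<dots> = K * (Q * (z * z))" unfolding K_def by (simp add: distrib_right)
    finally show "\<bar>regular_part \<delta> (x, y)\<bar> \<le> K * ((1 + (\<Sum>i\<in>{1..n}. \<bar>x - p i\<bar> powr (-3/4))) * \<bar>y\<bar> powr (-1/2))"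
      unfolding zz Q_def .
  qed
qed

definition window :: "(real \<times> real) set" where "window = {- (bound + 1)..bound + 1} \<times> {-1..1}"

text \<open>The majorant is a function of x with powers -3/4 times a function of y with power -1/2,
  both integrable on bounded intervals.\<close>

lemma regular_part_integrable:
  assumes \<delta>: "0 < \<delta>" and sep: "separated \<delta>"
  shows "integrable lborel (\<lambda>q. regular_part \<delta> q * indicator window q)"
proof -
  obtain K where K: "\<And>x y. 0 < \<bar>y\<bar> \<Longrightarrow> \<bar>y\<bar> \<le> 1 \<Longrightarrow> (\<And>i. i \<in> {1..n} \<Longrightarrow> x \<noteq> p i) \<Longrightarrow>
    \<bar>regular_part \<delta> (x, y)\<bar> \<le> K * ((1 + (\<Sum>i\<in>{1..n}. \<bar>x - p i\<bar> powr (-3/4))) * \<bar>y\<bar> powr (-1/2))"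
    using regular_part_le[OF assms] by blast
  define f where "f = (\<lambda>x. indicator {- (bound + 1)..bound + 1} x + (\<Sum>i\<in>{1..n}. \<bar>x - p i\<bar> powr (-3/4) * indicator {- (bound + 1)..bound + 1} x))"
  define g where "g = (\<lambda>y::real. \<bar>y\<bar> powr (-1/2) * indicator {-1..1} y)"
  have g: "integrable lborel g" unfolding g_def by (rule integrable_abs_powr) simp
  have fi: "integrable lborel (\<lambda>x. \<bar>x - a\<bar> powr (-3/4) * indicator {- (bound + 1)..bound + 1} x)" for a
  proof -
    define h where "h = (\<lambda>s::real. \<bar>s\<bar> powr (-3/4) * indicator {- (bound + 1 + \<bar>a\<bar>)..bound + 1 + \<bar>a\<bar>} s)"
    have "integrable lborel h" unfolding h_def by (rule integrable_abs_powr) simp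
    then have "integrable lborel (\<lambda>x. h (- a + 1 * x))" by (subst lborel_integrable_real_affine_iff) auto
    then show ?thesis
    proof (rule Bochner_Integration.integrable_bound)
      show "AE x in lborel. norm (\<bar>x - a\<bar> powr (-3/4) * indicator {- (bound + 1)..bound + 1} x) \<le> norm (h (- a + 1 * x))"
        by (intro AE_I2) (auto simp: h_def split: split_indicator)
    qed simp
  qed
  have f: "integrable lborel f" unfolding f_def
    by (intro Bochner_Integration.integrable_add Bochner_Integration.integrable_sum fi integrable_real_indicator) (auto simp: emeasure_lborel_Icc_eq)
  have bd: "integrable lborel (\<lambda>q. K * (f (fst q) * g (snd q)))"
    by (intro integrable_mult_right integrable_lborel_prod f g)
  have window [measurable]: "window \<in> sets borel" unfolding window_def by (intro borel_closed closed_Times) auto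
  have nz: "AE q in lborel. \<forall>i\<in>{1..n}. fst (q :: real \<times> real) \<noteq> p i"
    by (intro AE_finite_allI AE_fst_neq) auto
  show ?thesis
  proof (rule Bochner_Integration.integrable_bound[OF bd])
    show "AE q in lborel. norm (regular_part \<delta> q * indicator window q) \<le> norm (K * (f (fst q) * g (snd q)))"
      using nz AE_snd_neq[of 0]
    proof eventually_elim
      case (elim q)
      show ?case
      proof (cases "q \<in> window")
        case True
        obtain x y where q: "q = (x, y)" by (cases q)
        have "\<bar>regular_part \<delta> (x, y)\<bar> \<le> K * ((1 + (\<Sum>i\<in>{1..n}. \<bar>x - p i\<bar> powr (-3/4))) * \<bar>y\<bar> powr (-1/2))"
          using True elim unfolding q window_def by (intro K) auto
        also have "\<dots> = K * (f (fst q) * g (snd q))"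
          using True unfolding q window_def f_def g_def by simp
        finally show ?thesis using True unfolding q by (simp add: order_trans[OF _ abs_ge_self])
      qed simp
    qed
  qed measurable
qed

lemma discs_subset_window: "\<eta> \<le> 1 \<Longrightarrow> discs \<eta> \<subseteq> window"
proof -
  assume \<eta>: "\<eta> \<le> 1"
  have "\<bar>p i\<bar> \<le> bound" if "i \<in> {1..n}" for i
  proof -
    have "\<bar>p i\<bar> \<le> (\<Sum>i\<in>{1..n}. \<bar>p i\<bar>)" using that by (intro member_le_sum) auto
    then show ?thesis using R by (simp add: bound_def)
  qed
  moreover have "\<bar>x - a\<bar> < 1 \<and> \<bar>y\<bar> < 1" if "(x, y) \<in> ball (a, 0) \<eta>" for x y a :: real
  proof -
    have "dist a x \<le> dist (a, 0) (x, y)" "dist 0 y \<le> dist (a, 0) (x, y)"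
      using dist_fst_le[of "(a, 0)" "(x, y)"] dist_snd_le[of "(a, 0)" "(x, y)"] by auto
    moreover have "dist a x = \<bar>x - a\<bar>" "dist 0 y = \<bar>y\<bar>" by (simp_all add: dist_real_def abs_minus_commute)
    moreover have "dist (a, 0) (x, y) < \<eta>" using that by simp
    ultimately show ?thesis using \<eta> by linarith
  qed
  ultimately show ?thesis unfolding discs_def window_def by (fastforce simp: abs_less_iff abs_le_iff)
qed

lemma regular_part_discs_integrable:
  assumes \<delta>: "0 < \<delta>" and sep: "separated \<delta>"
    and "\<eta> \<le> 1" and [measurable]: "A \<in> sets borel"
  shows "integrable lborel (\<lambda>q. regular_part \<delta> q * indicator (A \<inter> discs \<eta>) q)"
proof (rule Bochner_Integration.integrable_bound[OF regular_part_integrable[OF \<delta> sep]])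
  show "AE q in lborel. norm (regular_part \<delta> q * indicator (A \<inter> discs \<eta>) q) \<le> norm (regular_part \<delta> q * indicator window q)"
    using discs_subset_window[OF \<open>\<eta> \<le> 1\<close>] by (intro AE_I2) (auto split: split_indicator)
qed measurable

text \<open>By separation, a pole cut off at radius \<delta> and restricted to all discs of radius
  \<eta> lives on the disc about its own atom. Off the strip it integrates to
  \<open>disc_strip_energy\<close>, once per coinciding pair.\<close>

lemma strip_discs_energy:
  assumes \<delta>: "0 < \<delta>" and sep: "separated \<delta>"
    and \<eta>: "\<eta> \<le> \<delta>" "\<eta> \<le> 1" and e: "0 < e" "e \<le> \<eta>"
  defines "S \<equiv> {q. e \<le> \<bar>snd q\<bar>}"
  shows "(\<integral>\<^sup>+q\<in>S \<inter> discs \<eta>. ennreal (field_sq q) \<partial>lborel) = ennreal (card coincidences * disc_strip_energy \<eta> e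
     + reg_int \<delta> (S \<inter> discs \<eta>))" (is "_ = ennreal ?R")
    and "0 \<le> card coincidences * disc_strip_energy \<eta> e
     + reg_int \<delta> (S \<inter> discs \<eta>)"
proof -
  have S [measurable]: "S \<in> sets borel"
    unfolding S_def by (intro borel_closed closed_Collect_le continuous_intros)
  define h where "h = (\<lambda>a q. 1 / ((fst q - a)^2 + (snd q)^2) * indicator (S \<inter> ball (a, 0) \<eta>) q :: real)"
  have h: "has_bochner_integral lborel (h a) (disc_strip_energy \<eta> e)" for a
  proof (rule has_bochner_integral_nn_integral)
    have m: "(\<lambda>q::real\<times>real. 1 / ((fst q - a)^2 + (snd q)^2)) \<in> borel_measurable borel"
      by (intro borel_measurable_divide borel_measurable_const borel_measurable_continuous_onI continuous_intros)
    have "h a \<in> borel_measurable borel"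
      unfolding h_def by (rule borel_measurable_times[OF m borel_measurable_indicator]) measurable
    then show "h a \<in> borel_measurable lborel" by simp
    show "AE q in lborel. 0 \<le> h a q" by (auto simp: h_def)
    show "0 \<le> disc_strip_energy \<eta> e"
      unfolding disc_strip_energy_def by (intro Bochner_Integration.integral_nonneg) (auto intro!: divide_nonneg_nonneg)
    have "(\<integral>\<^sup>+q. ennreal (h a q) \<partial>lborel) = (\<integral>\<^sup>+q \<in> {q. e \<le> \<bar>snd q\<bar>} \<inter> ball (a, 0) \<eta>. ennreal (1 / ((fst q - a)^2 + (snd q)^2)) \<partial>lborel)"
      by (intro nn_integral_cong) (auto simp: h_def S_def split: split_indicator)
    then show "(\<integral>\<^sup>+q. ennreal (h a q) \<partial>lborel) = ennreal (disc_strip_energy \<eta> e)"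
      using nn_integral_disc_strip[OF e] by simp
  qed
  have eq: "field_sq q * indicator (S \<inter> discs \<eta>) q = (\<Sum>(i, j)\<in>coincidences. h (p i) q) + regular_part \<delta> q * indicator (S \<inter> discs \<eta>) q" for q
  proof -
    have "indicator (ball (p i, 0) \<delta>) q * (1 / ((fst q - p i)^2 + (snd q)^2)) * indicator (S \<inter> discs \<eta>) q = h (p i) q"
      if ij: "(i, j) \<in> coincidences" for i j
    proof -
      have i: "i \<in> {1..n}" using ij by (auto simp: coincidences_def)
      have "q \<in> ball (p i, 0) \<delta> \<and> q \<in> discs \<eta> \<longleftrightarrow> q \<in> ball (p i, 0) \<eta>"
      proof
        assume L: "q \<in> ball (p i, 0) \<delta> \<and> q \<in> discs \<eta>"
        then obtain k where k: "k \<in> {1..n}" "q \<in> ball (p k, 0) \<eta>" by (auto simp: discs_def)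
        have "p k = p i"
        proof (rule ccontr)
          assume "p k \<noteq> p i"
          then have "2 * \<delta> \<le> \<bar>p k - p i\<bar>" using k i by (intro separatedD[OF sep]) auto
          also have "\<dots> = dist (p k, 0::real) (p i, 0::real)" by (simp add: dist_Pair_Pair dist_real_def)
          also have "\<dots> \<le> dist (p k, 0) q + dist (p i, 0) q" by (rule dist_triangle2)
          also have "\<dots> < \<delta> + \<delta>" using L k(2) \<eta> by (simp add: mem_ball)
          finally show False by simp
        qed
        then show "q \<in> ball (p i, 0) \<eta>" using k by simp
      next
        assume "q \<in> ball (p i, 0) \<eta>"
        then show "q \<in> ball (p i, 0) \<delta> \<and> q \<in> discs \<eta>" using \<eta> i by (auto simp: discs_def)
      qed
      then show ?thesis by (auto simp: h_def simp del: mem_ball split: split_indicator)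
    qed
    then have "(\<Sum>(i, j)\<in>coincidences. indicator (ball (p i, 0) \<delta>) q * (1 / ((fst q - p i)^2 + (snd q)^2))) * indicator (S \<inter> discs \<eta>) q
      = (\<Sum>(i, j)\<in>coincidences. h (p i) q)"
      unfolding sum_distrib_right by (intro sum.cong) auto
    then show ?thesis unfolding regular_part_def by (simp add: left_diff_distrib)
  qed
  have "has_bochner_integral lborel (\<lambda>q. (\<Sum>(i, j)\<in>coincidences. h (p i) q) + regular_part \<delta> q * indicator (S \<inter> discs \<eta>) q)
    ((\<Sum>(i, j)\<in>coincidences. disc_strip_energy \<eta> e) + reg_int \<delta> (S \<inter> discs \<eta>))"
    unfolding split_beta
    by (intro has_bochner_integral_add has_bochner_integral_sum h has_bochner_integral_integrable
        regular_part_discs_integrable[OF \<delta> sep \<eta>(2) S])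
  then have hb: "has_bochner_integral lborel (\<lambda>q. field_sq q * indicator (S \<inter> discs \<eta>) q) ?R"
    unfolding eq[symmetric] by simp
  have nn: "0 \<le> field_sq q * indicator (S \<inter> discs \<eta>) q" for q by (simp add: field_sq_def)
  show "0 \<le> ?R"
    unfolding has_bochner_integral_integral_eq[OF hb, symmetric] by (rule integral_nonneg_AE) (simp add: nn)
  have "(\<integral>\<^sup>+q\<in>S \<inter> discs \<eta>. ennreal (field_sq q) \<partial>lborel) = (\<integral>\<^sup>+q. ennreal (field_sq q * indicator (S \<inter> discs \<eta>) q) \<partial>lborel)"
    by (intro nn_integral_cong) (auto split: split_indicator)
  also have "\<dots> = ennreal ?R"
    using hb nn by (subst nn_integral_eq_integral) (auto simp: has_bochner_integral_iff)
  finally show "(\<integral>\<^sup>+q\<in>S \<inter> discs \<eta>. ennreal (field_sq q) \<partial>lborel) = ennreal ?R" .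
qed

text \<open>A limit of strip energies minus their parts inside the discs. Both diverge by the same
  multiple of ln (2 e_k), which cancels. The sets outside the strips increase to the plane without
  the axis, a null set, so continuity from below applies.\<close>

lemma exterior_energy:
  assumes \<delta>: "0 < \<delta>" and sep: "separated \<delta>"
    and \<eta>: "0 < \<eta>" "\<eta> \<le> \<delta>" "\<eta> \<le> 1"
  defines "L \<equiv> - 2 * pi * interaction - 2 * pi * card coincidences * ln \<eta> - reg_int \<delta> (discs \<eta>)"
  shows "(\<integral>\<^sup>+q\<in>- discs \<eta>. ennreal (field_sq q) \<partial>lborel) = ennreal L" and "0 \<le> L"
proof -
  define e where "e = (\<lambda>k. \<eta> / real (Suc k))"
  have e0: "0 < e k" and e\<eta>: "e k \<le> \<eta>" for k using \<eta> by (auto simp: e_def divide_simps)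
  have e1: "e k \<le> 1" for k using e\<eta>[of k] \<eta> by linarith
  have elim: "e \<longlonglongrightarrow> 0" unfolding e_def by real_asymp
  have edec: "e j \<le> e i" if "i \<le> j" for i j unfolding e_def using \<eta> that by (intro divide_left_mono) auto
  define S where "S = (\<lambda>k. {q::real\<times>real. e k \<le> \<bar>snd q\<bar>})"
  have S [measurable]: "S k \<in> sets borel" for k
    unfolding S_def by (intro borel_closed closed_Collect_le continuous_intros)
  have Sk: "{q. e k \<le> \<bar>snd q\<bar>} = S k" for k by (simp add: S_def)
  define E where "E = density lborel (\<lambda>q. ennreal (field_sq q))"
  have sets_E [measurable_cong]: "sets E = sets borel" by (simp add: E_def)
  have E: "emeasure E A = (\<integral>\<^sup>+q\<in>A. ennreal (field_sq q) \<partial>lborel)" if "A \<in> sets borel" for A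
    unfolding E_def using that by (subst emeasure_density) auto
  define D where "D = (\<lambda>k. card coincidences * disc_strip_energy \<eta> (e k) + reg_int \<delta> (S k \<inter> discs \<eta>))"
  have ES: "emeasure E (S k) = ennreal (- 2 * pi * mutual_log (e k))" for k
    using strip_energy[OF e0[of k] neutral] unfolding Sk by (simp add: E)
  have ED: "emeasure E (S k \<inter> discs \<eta>) = ennreal (D k)" and D0: "0 \<le> D k" for k
    using strip_discs_energy[OF \<delta> sep \<eta>(2,3) e0[of k] e\<eta>[of k]] unfolding D_def Sk by (auto simp: E)
  have mutual_log_nonpos: "0 \<le> - 2 * pi * mutual_log (e k)" for k by (rule strip_energy(2)[OF e0 neutral])
  have D_le: "D k \<le> - 2 * pi * mutual_log (e k)" for k
  proof (rule ccontr)
    assume "\<not> ?thesis"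
    moreover have "ennreal (D k) \<le> ennreal (- 2 * pi * mutual_log (e k))"
      unfolding ES[symmetric] ED[symmetric] by (intro emeasure_mono) auto
    ultimately show False using D0[of k] mutual_log_nonpos[of k] by (simp add: ennreal_le_iff)
  qed
  have ext: "emeasure E (S k - discs \<eta>) = ennreal (- 2 * pi * mutual_log (e k) - D k)" for k
  proof -
    have "S k - discs \<eta> = S k - S k \<inter> discs \<eta>" by auto
    also have "emeasure E \<dots> = emeasure E (S k) - emeasure E (S k \<inter> discs \<eta>)"
      by (intro emeasure_Diff) (auto simp: ED)
    finally show ?thesis using D0[of k] by (simp add: ES ED ennreal_minus)
  qed
  have "(\<lambda>k. \<integral>q. regular_part \<delta> q * indicator (S k \<inter> discs \<eta>) q \<partial>lborel) \<longlonglongrightarrow> reg_int \<delta> (discs \<eta>)"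
  proof (rule integral_dominated_convergence)
    show "integrable lborel (\<lambda>q. norm (regular_part \<delta> q * indicator (UNIV \<inter> discs \<eta>) q))"
      by (intro integrable_norm regular_part_discs_integrable[OF \<delta> sep \<eta>(3)]) auto
    show "AE q in lborel. norm (regular_part \<delta> q * indicator (S k \<inter> discs \<eta>) q) \<le> norm (regular_part \<delta> q * indicator (UNIV \<inter> discs \<eta>) q)" for k
      by (auto split: split_indicator)
    show "AE q in lborel. (\<lambda>k. regular_part \<delta> q * indicator (S k \<inter> discs \<eta>) q) \<longlonglongrightarrow> regular_part \<delta> q * indicator (discs \<eta>) q"
      using AE_snd_neq[of 0]
    proof eventually_elim
      case (elim q)
      then have "\<forall>\<^sub>F k in sequentially. e k < \<bar>snd q\<bar>" using order_tendstoD(2)[OF \<open>e \<longlonglongrightarrow> 0\<close>, of "\<bar>snd q\<bar>"] by simp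
      then have "\<forall>\<^sub>F k in sequentially. regular_part \<delta> q * indicator (S k \<inter> discs \<eta>) q = regular_part \<delta> q * indicator (discs \<eta>) q"
        by eventually_elim (auto simp: S_def split: split_indicator)
      then show ?case by (rule tendsto_eventually)
    qed
  qed measurable
  note reg = this
  have lim: "(\<lambda>k. - 2 * pi * mutual_log (e k) - D k) \<longlonglongrightarrow> L"
  proof -
    let ?N = "real (card coincidences)"
    \<comment> \<open>The divergent ln (2 * e k) is added and subtracted so that each bracket
      converges by itself.\<close>
    have "(\<lambda>k. - 2 * pi * (mutual_log (e k) - ?N * ln (2 * e k)) - ?N * (disc_strip_energy \<eta> (e k) - 2 * pi * ln (\<eta> / (2 * e k)))
      - 2 * pi * ?N * ln \<eta> - reg_int \<delta> (S k \<inter> discs \<eta>)) \<longlonglongrightarrow>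
      - 2 * pi * interaction - ?N * 0 - 2 * pi * ?N * ln \<eta> - reg_int \<delta> (discs \<eta>)"
      by (intro tendsto_diff tendsto_mult tendsto_const mutual_log_asymp[OF elim e0 e1] disc_strip_energy_asymp[OF \<eta>(1) elim e0] reg)
    moreover have "- 2 * pi * (mutual_log (e k) - ?N * ln (2 * e k)) - ?N * (disc_strip_energy \<eta> (e k) - 2 * pi * ln (\<eta> / (2 * e k)))
      - 2 * pi * ?N * ln \<eta> - reg_int \<delta> (S k \<inter> discs \<eta>) = - 2 * pi * mutual_log (e k) - D k" for k
    proof -
      have l: "ln (\<eta> / (2 * e k)) = ln \<eta> - ln (2 * e k)" using e0[of k] \<eta> by (intro ln_divide_pos) auto
      show ?thesis unfolding l D_def by (simp add: algebra_simps)
    qed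
    moreover have "L = - 2 * pi * interaction - ?N * 0 - 2 * pi * ?N * ln \<eta> - reg_int \<delta> (discs \<eta>)"
      by (simp add: L_def)
    ultimately show ?thesis by (simp only:)
  qed
  show L0: "0 \<le> L" using D_le by (intro LIMSEQ_le_const[OF lim]) auto
  have "(\<lambda>k. emeasure E (S k - discs \<eta>)) \<longlonglongrightarrow> emeasure E (\<Union>k. S k - discs \<eta>)"
  proof (rule Lim_emeasure_incseq)
    show "range (\<lambda>k. S k - discs \<eta>) \<subseteq> sets E" by (auto simp: sets_E)
    show "incseq (\<lambda>k. S k - discs \<eta>)"
      unfolding incseq_def S_def using edec by (auto intro: order_trans)
  qed
  moreover have "(\<lambda>k. emeasure E (S k - discs \<eta>)) \<longlonglongrightarrow> ennreal L"
    unfolding ext by (rule tendsto_ennrealI[OF lim])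
  ultimately have "emeasure E (\<Union>k. S k - discs \<eta>) = ennreal L" by (rule LIMSEQ_unique)
  moreover have "emeasure E (\<Union>k. S k - discs \<eta>) = (\<integral>\<^sup>+q\<in>- discs \<eta>. ennreal (field_sq q) \<partial>lborel)"
  proof -
    have "(\<integral>\<^sup>+q\<in>(\<Union>k. S k - discs \<eta>). ennreal (field_sq q) \<partial>lborel) = (\<integral>\<^sup>+q\<in>- discs \<eta>. ennreal (field_sq q) \<partial>lborel)"
    proof (rule nn_integral_cong_AE)
      show "AE q in lborel. ennreal (field_sq q) * indicator (\<Union>k. S k - discs \<eta>) q = ennreal (field_sq q) * indicator (- discs \<eta>) q"
        using AE_snd_neq[of 0]
      proof eventually_elim
        case (elim q)
        then have "\<forall>\<^sub>F k in sequentially. e k < \<bar>snd q\<bar>" using order_tendstoD(2)[OF \<open>e \<longlonglongrightarrow> 0\<close>, of "\<bar>snd q\<bar>"] by simp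
        then obtain k where "e k < \<bar>snd q\<bar>" by (auto simp: eventually_sequentially)
        then have "q \<in> S k" by (simp add: S_def)
        then show ?case by (auto split: split_indicator)
      qed
    qed
    then show ?thesis by (subst E) auto
  qed
  ultimately show "(\<integral>\<^sup>+q\<in>- discs \<eta>. ennreal (field_sq q) \<partial>lborel) = ennreal L" by simp
qed

text \<open>\<open>coincidences\<close> always contains the diagonal, and contains nothing else
  precisely when the points are distinct.\<close>

lemma card_coincidences: "n \<le> card coincidences" "card coincidences = n \<longleftrightarrow> inj_on p {1..n}"
proof -
  define D where "D = (\<lambda>i. (i, i)) ` {1..n}"
  have card_D: "card D = n" unfolding D_def by (subst card_image) (auto simp: inj_on_def)
  have sub: "D \<subseteq> coincidences" by (auto simp: D_def coincidences_def)
  then show "n \<le> card coincidences" using card_mono[OF finite_coincidences sub] card_D by simp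
  have "card coincidences = n \<longleftrightarrow> D = coincidences"
    using card_subset_eq[OF finite_coincidences sub] card_D by auto
  also have "\<dots> \<longleftrightarrow> inj_on p {1..n}"
  proof
    assume D: "D = coincidences"
    show "inj_on p {1..n}"
    proof (rule inj_onI)
      fix i j assume "i \<in> {1..n}" "j \<in> {1..n}" "p i = p j"
      then have "(i, j) \<in> D" unfolding D by (simp add: coincidences_def)
      then show "i = j" by (auto simp: D_def)
    qed
  next
    assume inj: "inj_on p {1..n}"
    have "coincidences \<subseteq> D"
    proof
      fix ij assume "ij \<in> coincidences"
      then obtain i j where ij: "ij = (i, j)" "i \<in> {1..n}" "j \<in> {1..n}" "p i = p j"
        by (auto simp: coincidences_def)
      then have "i = j" using inj by (auto dest: inj_onD)
      then show "ij \<in> D" using ij by (simp add: D_def)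
    qed
    with sub show "D = coincidences" by blast
  qed
  finally show "card coincidences = n \<longleftrightarrow> inj_on p {1..n}" .
qed

lemma separation:
  obtains \<delta> where "0 < \<delta>" "\<delta> \<le> 1" "separated \<delta>"
proof -
  \<comment> \<open>The inserted 1 keeps the minimum defined when there is no pair of different
    points, and bounds it by 1.\<close>
  define A where "A = insert 1 ((\<lambda>(i, j). \<bar>p i - p j\<bar> / 2) ` {(i, j) \<in> {1..n} \<times> {1..n}. p i \<noteq> p j})"
  have fin: "finite A" unfolding A_def by (intro finite.insertI finite_imageI) (auto intro: finite_subset[of _ "{1..n} \<times> {1..n}"])
  show thesis
  proof (rule that[of "Min A"])
    show "0 < Min A" using fin by (subst Min_gr_iff) (auto simp: A_def)
    show "Min A \<le> 1" using fin by (intro Min_le) (auto simp: A_def)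
    show "separated (Min A)" unfolding separated_def
    proof (intro ballI impI)
      fix i j assume that: "i \<in> {1..n}" "j \<in> {1..n}" "p i \<noteq> p j"
      have "Min A \<le> \<bar>p i - p j\<bar> / 2" using that fin by (intro Min_le) (auto simp: A_def intro!: image_eqI[of _ _ "(i, j)"])
      then show "2 * Min A \<le> \<bar>p i - p j\<bar>" by simp
    qed
  qed
qed

text \<open>For small \<eta> the quantity is -pi \<open>interaction\<close>, minus half the regular
  part over the discs, plus (N - n)(-pi ln \<eta>), where N counts coinciding pairs. The regular
  part tends to 0 as the discs shrink; the last term is 0 for distinct points and tends to infinity
  otherwise.\<close>

lemma renormalized_limit:
  defines "T \<equiv> \<lambda>\<eta>. enn2ereal (\<integral>\<^sup>+q\<in>- discs \<eta>. ennreal (field_sq q) \<partial>lborel) / 2 + ereal (pi * real n * ln \<eta>)"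
  shows "inj_on p {1..n} \<Longrightarrow> (T \<longlongrightarrow> ereal (- pi * interaction)) (at_right 0)"
    and "\<not> inj_on p {1..n} \<Longrightarrow> (T \<longlongrightarrow> \<infinity>) (at_right 0)"
proof -
  obtain \<delta> where \<delta>: "0 < \<delta>" "\<delta> \<le> 1" and sep: "separated \<delta>"
    using separation by blast
  let ?N = "real (card coincidences)"
  define r where "r = (\<lambda>\<eta>. \<integral>q. regular_part \<delta> q * indicator (discs \<eta>) q \<partial>lborel)"
  define t where "t = (\<lambda>\<eta>. - pi * interaction - r \<eta> / 2 + (?N - real n) * (- pi * ln \<eta>))"
  have T: "T \<eta> = ereal (t \<eta>)" if "0 < \<eta>" "\<eta> < \<delta>" for \<eta>
  proof -
    have "(\<integral>\<^sup>+q\<in>- discs \<eta>. ennreal (field_sq q) \<partial>lborel) = ennreal (- 2 * pi * interaction - 2 * pi * ?N * ln \<eta> - r \<eta>)"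
      "0 \<le> - 2 * pi * interaction - 2 * pi * ?N * ln \<eta> - r \<eta>"
      unfolding r_def using that \<delta> by (intro exterior_energy[OF \<delta>(1) sep]; simp)+
    then have "T \<eta> = ereal ((- 2 * pi * interaction - 2 * pi * ?N * ln \<eta> - r \<eta>) / 2 + pi * real n * ln \<eta>)"
      unfolding T_def by simp
    also have "(- 2 * pi * interaction - 2 * pi * ?N * ln \<eta> - r \<eta>) / 2 + pi * real n * ln \<eta> = t \<eta>"
      unfolding t_def by (simp add: field_simps)
    finally show ?thesis .
  qed
  have ev: "\<forall>\<^sub>F \<eta> in at_right 0. ereal (t \<eta>) = T \<eta>"
    using eventually_at_right_less[of 0] order_tendstoD(2)[OF tendsto_ident_at \<delta>(1)]
    by eventually_elim (simp add: T)
  have r: "(r \<longlongrightarrow> 0) (at_right 0)"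
  proof (rule tendsto_at_right_sequentially[OF \<delta>(1)])
    fix s assume s: "\<And>k. 0 < s k" "\<And>k. s k < \<delta>" "s \<longlonglongrightarrow> 0"
    have "(\<lambda>k. r (s k)) \<longlonglongrightarrow> (\<integral>q. 0 \<partial>(lborel :: (real \<times> real) measure))"
      unfolding r_def
    proof (rule integral_dominated_convergence)
      show "integrable lborel (\<lambda>q. norm (regular_part \<delta> q * indicator window q))"
        by (intro integrable_norm regular_part_integrable[OF \<delta>(1) sep])
      show "AE q in lborel. norm (regular_part \<delta> q * indicator (discs (s k)) q) \<le> norm (regular_part \<delta> q * indicator window q)" for k
        using discs_subset_window[of "s k"] s(2)[of k] \<delta>(2) by (intro AE_I2) (auto split: split_indicator)
      show "AE q in lborel. (\<lambda>k. regular_part \<delta> q * indicator (discs (s k)) q) \<longlonglongrightarrow> 0"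
        using AE_snd_neq[of 0]
      proof eventually_elim
        case (elim q)
        then have "\<forall>\<^sub>F k in sequentially. s k < \<bar>snd q\<bar>" using order_tendstoD(2)[OF s(3), of "\<bar>snd q\<bar>"] by simp
        then have "\<forall>\<^sub>F k in sequentially. regular_part \<delta> q * indicator (discs (s k)) q = 0"
        proof eventually_elim
          case (elim k)
          have "q \<notin> discs (s k)"
          proof
            assume "q \<in> discs (s k)"
            then obtain i where "dist (p i, 0) q < s k" by (auto simp: discs_def)
            moreover have "\<bar>snd q\<bar> \<le> dist (p i, 0) q" using dist_snd_le[of "(p i, 0)" q] by (simp add: dist_real_def)
            ultimately show False using elim by linarith
          qed
          then show ?case by simp
        qed
        then show ?case by (rule tendsto_eventually)
      qed
    qed measurable
    then show "(\<lambda>k. r (s k)) \<longlonglongrightarrow> 0" by simp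
  qed
  have base: "((\<lambda>\<eta>. - pi * interaction - r \<eta> / 2) \<longlongrightarrow> - pi * interaction - 0 / 2) (at_right 0)"
    by (intro tendsto_intros r) simp
  show "(T \<longlongrightarrow> ereal (- pi * interaction)) (at_right 0)" if "inj_on p {1..n}"
  proof -
    have "t = (\<lambda>\<eta>. - pi * interaction - r \<eta> / 2)"
      using that card_coincidences(2) by (simp add: t_def)
    then have "((\<lambda>\<eta>. ereal (t \<eta>)) \<longlongrightarrow> ereal (- pi * interaction)) (at_right 0)"
      using base by (simp add: tendsto_ereal)
    then show ?thesis using ev by (rule Lim_transform_eventually)
  qed
  show "(T \<longlongrightarrow> \<infinity>) (at_right 0)" if "\<not> inj_on p {1..n}"
  proof -
    have N: "0 < ?N - real n" using that card_coincidences by (simp add: order_less_le)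
    have "filterlim (\<lambda>\<eta>. c * (- ln \<eta>)) at_top (at_right 0)" if "0 < c" for c :: real
      using that by real_asymp
    from this[of "(?N - real n) * pi"] have "filterlim (\<lambda>\<eta>. (?N - real n) * (- pi * ln \<eta>)) at_top (at_right 0)"
      using N by (simp add: mult.assoc)
    then have "filterlim t at_top (at_right 0)"
      unfolding t_def by (rule filterlim_tendsto_add_at_top[OF base])
    then have "((\<lambda>\<eta>. ereal (t \<eta>)) \<longlongrightarrow> \<infinity>) (at_right 0)" by (simp add: tendsto_PInfty_eq_at_top)
    then show ?thesis using ev by (rule Lim_transform_eventually)
  qed
qed

end

section \<open>Equilibrium measures\<close>

text \<open>Asking for equality only almost everywhere makes the infinite value of
  \<open>log_kernel\<close> at 0 harmless for measures with a density.\<close>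

lemma ereal_integral_eq:
  assumes "AE x in M. f x = ereal (g x)" and g: "integrable M g"
  shows "ereal_integral M f = ereal (\<integral>x. g x \<partial>M)"
proof -
  have p: "(\<integral>\<^sup>+x. e2ennreal (f x) \<partial>M) = (\<integral>\<^sup>+x. ennreal (g x) \<partial>M)"
    using assms(1) by (intro nn_integral_cong_AE) (auto simp: ennreal.abs_eq)
  have m: "(\<integral>\<^sup>+x. e2ennreal (- f x) \<partial>M) = (\<integral>\<^sup>+x. ennreal (- g x) \<partial>M)"
    using assms(1) by (intro nn_integral_cong_AE) (auto simp: ennreal.abs_eq)
  have fin: "(\<integral>\<^sup>+x. ennreal (g x) \<partial>M) < \<infinity>" "(\<integral>\<^sup>+x. ennreal (- g x) \<partial>M) < \<infinity>"
    using real_integrable_def[THEN iffD1, OF g] by (auto simp: top.not_eq_extremum)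
  obtain a where a: "(\<integral>\<^sup>+x. ennreal (g x) \<partial>M) = ennreal a" "0 \<le> a" using fin(1) by (cases "\<integral>\<^sup>+x. ennreal (g x) \<partial>M") auto
  obtain b where b: "(\<integral>\<^sup>+x. ennreal (- g x) \<partial>M) = ennreal b" "0 \<le> b" using fin(2) by (cases "\<integral>\<^sup>+x. ennreal (- g x) \<partial>M") auto
  show ?thesis
    unfolding ereal_integral_def p m real_lebesgue_integral_def[OF g] a b using a b by simp
qed

lemma log_kernel_measurable [measurable]: "log_kernel \<in> borel_measurable borel"
  unfolding log_kernel_def by measurable

context screened_points
begin

lemma AE_density_neq: "AE t in density lborel (\<lambda>t. ennreal (m t)). t \<noteq> x"
  by (subst AE_density) (auto intro: eventually_mono[OF AE_lborel_singleton[of x]])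

lemma log_potential_eq: "log_potential (density lborel (\<lambda>t. ennreal (m t))) x = ereal (- log_pot 0 x)"
proof -
  have i: "integrable lborel (\<lambda>t. m t * ln \<bar>x - t\<bar>)"
    by (rule log_integrable)
  have "log_potential (density lborel (\<lambda>t. ennreal (m t))) x = ereal (\<integral>t. - ln \<bar>x - t\<bar> \<partial>(density lborel (\<lambda>t. ennreal (m t))))"
    unfolding log_potential_def
  proof (rule ereal_integral_eq)
    show "AE t in density lborel (\<lambda>t. ennreal (m t)). log_kernel (x - t) = ereal (- ln \<bar>x - t\<bar>)"
      using AE_density_neq[of x] by eventually_elim (simp add: log_kernel_def)
    show "integrable (density lborel (\<lambda>t. ennreal (m t))) (\<lambda>t. - ln \<bar>x - t\<bar>)"
      using i m_nonneg by (subst integrable_density) auto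
  qed
  also have "(\<integral>t. - ln \<bar>x - t\<bar> \<partial>(density lborel (\<lambda>t. ennreal (m t)))) = - log_pot 0 x"
    using m_nonneg unfolding log_pot_0 by (subst integral_density) auto
  finally show ?thesis .
qed

text \<open>Absolute integrability on the product comes from the bound on single potentials, uniform
  over [-R, R]; the diagonal, where the kernel is infinite, is null for the product.\<close>

lemma log_energy_eq: "log_energy (density lborel (\<lambda>t. ennreal (m t))) = ereal (- (\<integral>t. m t * log_pot 0 t \<partial>lborel))"
proof -
  define \<mu> where "\<mu> = density lborel (\<lambda>t. ennreal (m t))"
  have sets_mu [measurable_cong]: "sets \<mu> = sets borel" by (simp add: \<mu>_def)
  have "emeasure \<mu> UNIV = ennreal (real n)"
    using integrable_m m_nonneg by (simp add: \<mu>_def emeasure_density nn_integral_eq_integral integral_m)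
  then interpret mu: finite_measure \<mu> by (intro finite_measureI) (simp add: space_density \<mu>_def)
  interpret P: pair_sigma_finite \<mu> \<mu> ..
  define g where "g = (\<lambda>z :: real \<times> real. - ln \<bar>fst z - snd z\<bar>)"
  have g [measurable]: "g \<in> borel_measurable (\<mu> \<Otimes>\<^sub>M \<mu>)" unfolding g_def by measurable
  have i: "integrable lborel (\<lambda>t. m t * ln \<bar>x - t\<bar>)" for x
    by (rule log_integrable)
  have "(\<integral>\<^sup>+z. norm (g z) \<partial>(\<mu> \<Otimes>\<^sub>M \<mu>)) = (\<integral>\<^sup>+x. (\<integral>\<^sup>+t. ennreal \<bar>ln \<bar>x - t\<bar>\<bar> \<partial>\<mu>) \<partial>\<mu>)"
    by (subst mu.nn_integral_fst[symmetric]) (auto simp: g_def)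
  also have "\<dots> \<le> (\<integral>\<^sup>+x. ennreal (2 * sing_bound + (R + R + 2) * n) \<partial>\<mu>)"
  proof (rule nn_integral_mono_AE)
    have "AE x in \<mu>. \<bar>x\<bar> \<le> R" unfolding \<mu>_def using m_support by (subst AE_density) (auto simp: not_less[symmetric])
    then show "AE x in \<mu>. (\<integral>\<^sup>+t. ennreal \<bar>ln \<bar>x - t\<bar>\<bar> \<partial>\<mu>) \<le> ennreal (2 * sing_bound + (R + R + 2) * n)"
    proof eventually_elim
      case (elim x)
      have "(\<integral>\<^sup>+t. ennreal \<bar>ln \<bar>x - t\<bar>\<bar> \<partial>\<mu>) = (\<integral>\<^sup>+t. ennreal (m t) * ennreal \<bar>ln \<bar>x - t\<bar>\<bar> \<partial>lborel)"
        unfolding \<mu>_def by (subst nn_integral_density) auto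
      also have "\<dots> \<le> (\<integral>\<^sup>+t. ennreal (2 * (m t * \<bar>x - t\<bar> powr (-3/4)) + (\<bar>x\<bar> + R + 2) * m t) \<partial>lborel)"
      proof (rule nn_integral_mono_AE)
        show "AE t in lborel. ennreal (m t) * ennreal \<bar>ln \<bar>x - t\<bar>\<bar> \<le> ennreal (2 * (m t * \<bar>x - t\<bar> powr (-3/4)) + (\<bar>x\<bar> + R + 2) * m t)"
          using log_pot_integrable(3)[of 0 x, OF order_refl zero_le_one]
        proof eventually_elim
          case (elim t)
          then show ?case
            using half_ln_square[of "x - t"] m_nonneg[of t] by (simp add: abs_mult ennreal_leI flip: ennreal_mult)
        qed
      qed
      also have "\<dots> = ennreal (\<integral>t. 2 * (m t * \<bar>x - t\<bar> powr (-3/4)) + (\<bar>x\<bar> + R + 2) * m t \<partial>lborel)"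
        using log_pot_integrable(4)[of 0 x] m_nonneg R by (intro nn_integral_eq_integral) auto
      also have "(\<integral>t. 2 * (m t * \<bar>x - t\<bar> powr (-3/4)) + (\<bar>x\<bar> + R + 2) * m t \<partial>lborel) =
         2 * (\<integral>t. m t * \<bar>x - t\<bar> powr (-3/4) \<partial>lborel) + (\<bar>x\<bar> + R + 2) * n"
        using singular_integral(1)[of x] integrable_m by (simp add: integral_m)
      also have "ennreal \<dots> \<le> ennreal (2 * sing_bound + (R + R + 2) * n)"
        using singular_integral(2)[of x] elim by (intro ennreal_leI add_mono mult_right_mono) auto
      finally show ?case .
    qed
  qed
  also have "\<dots> < \<infinity>"
    by (simp add: mu.emeasure_eq_measure ennreal_mult_less_top)
  finally have int: "integrable (\<mu> \<Otimes>\<^sub>M \<mu>) g" by (intro integrableI_bounded g)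
  have "log_energy \<mu> = ereal (\<integral>z. g z \<partial>(\<mu> \<Otimes>\<^sub>M \<mu>))"
    unfolding log_energy_def
  proof (rule ereal_integral_eq[OF _ int])
    have "AE z in \<mu> \<Otimes>\<^sub>M \<mu>. fst z \<noteq> snd z"
    proof (rule P.AE_pair_measure)
      show "{z \<in> space (\<mu> \<Otimes>\<^sub>M \<mu>). fst z \<noteq> snd z} \<in> sets (\<mu> \<Otimes>\<^sub>M \<mu>)" by measurable
      show "AE x in \<mu>. AE y in \<mu>. fst (x, y) \<noteq> snd (x, y)"
        unfolding \<mu>_def fst_conv snd_conv by (intro AE_I2 eventually_mono[OF AE_density_neq]) auto
    qed
    then show "AE z in \<mu> \<Otimes>\<^sub>M \<mu>. (case z of (x, y) \<Rightarrow> log_kernel (x - y)) = ereal (g z)"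
      by eventually_elim (auto simp: log_kernel_def g_def split: prod.splits)
  qed
  also have "(\<integral>z. g z \<partial>(\<mu> \<Otimes>\<^sub>M \<mu>)) = (\<integral>x. (\<integral>t. - ln \<bar>x - t\<bar> \<partial>\<mu>) \<partial>\<mu>)"
    by (subst P.integral_fst'[OF int, symmetric]) (simp add: g_def)
  also have "\<dots> = (\<integral>x. - log_pot 0 x \<partial>\<mu>)"
    unfolding \<mu>_def log_pot_0 using m_nonneg
    by (intro Bochner_Integration.integral_cong refl) (subst integral_density, auto)
  also have "\<dots> = - (\<integral>t. m t * log_pot 0 t \<partial>lborel)"
    unfolding \<mu>_def using m_nonneg by (subst integral_density) auto
  finally show ?thesis unfolding \<mu>_def .
qed

end

section \<open>Regularity, null sets and compact support\<close>

lemma holder_continuous_imp_continuous: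
  assumes "holder_continuous \<alpha> f" "0 < \<alpha>"
  shows "continuous_on UNIV f"
proof -
  obtain C where C: "\<And>x y. \<bar>f x - f y\<bar> \<le> C * \<bar>x - y\<bar> powr \<alpha>"
    using assms unfolding holder_continuous_def by blast
  have "(f \<longlongrightarrow> f x) (at x)" for x
  proof -
    have "((\<lambda>y. C * \<bar>y - x\<bar> powr \<alpha>) \<longlongrightarrow> C * \<bar>x - x\<bar> powr \<alpha>) (at x)"
      using assms(2) by (intro tendsto_mult tendsto_const tendsto_powr' tendsto_rabs tendsto_diff tendsto_ident_at) auto
    then have lim: "((\<lambda>y. C * \<bar>y - x\<bar> powr \<alpha>) \<longlongrightarrow> 0) (at x)" using assms(2) by simp
    have "((\<lambda>y. f y - f x) \<longlongrightarrow> 0) (at x)"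
      by (rule Lim_null_comparison[OF _ lim]) (use C in auto)
    then show ?thesis by (simp add: LIM_zero_iff)
  qed
  then show ?thesis by (simp add: continuous_on_eq_continuous_at isCont_def)
qed

lemma lower_semicontinuous_measurable:
  assumes "lower_semicontinuous V"
  shows "V \<in> borel_measurable borel"
proof (rule borel_measurableI_greater)
  fix a
  have "open {x. a < V x}"
  proof (subst open_subopen, safe)
    fix x assume x: "a < V x"
    then have "a < Liminf (at x) V" using assms unfolding lower_semicontinuous_def by (auto intro: less_le_trans)
    then have "\<forall>\<^sub>F y in at x. a < V y" by (rule less_LiminfD)
    then obtain S where "open S" "x \<in> S" "\<And>y. y \<in> S \<Longrightarrow> y \<noteq> x \<Longrightarrow> a < V y"
      unfolding eventually_at_topological by blast
    then show "\<exists>T. open T \<and> x \<in> T \<and> T \<subseteq> {x. a < V x}" using x by (intro exI[of _ S]) auto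
  qed
  then show "{x \<in> space borel. a < V x} \<in> sets borel" by simp
qed

text \<open>A set of positive Lebesgue measure carries a uniform measure on a compact subset, of finite energy.\<close>

lemma quasi_everywhere_null:
  assumes qe: "quasi_everywhere P" and E: "E \<in> sets borel" and sub: "\<And>x. x \<in> E \<Longrightarrow> \<not> P x"
  shows "emeasure lborel E = 0"
proof (rule ccontr)
  assume pos: "emeasure lborel E \<noteq> 0"
  \<comment> \<open>Cutting down to a bounded interval gives finite measure, which the inner
    regularity by compact sets requires.\<close>
  have "\<exists>k::nat. emeasure lborel (E \<inter> {- real k..real k}) \<noteq> 0"
  proof (rule ccontr)
    assume "\<not> ?thesis"
    then have "(\<Union>k::nat. E \<inter> {- real k..real k}) \<in> null_sets lborel"
      using E by (intro null_sets_UN) auto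
    moreover have "(\<Union>k::nat. E \<inter> {- real k..real k}) = E"
    proof -
      have "\<exists>k::nat. - real k \<le> x \<and> x \<le> real k" for x
        using real_arch_simple[of "\<bar>x\<bar>"] by (metis abs_le_iff minus_le_iff)
      then show ?thesis by auto
    qed
    ultimately show False using pos by auto
  qed
  then obtain k :: nat where k: "emeasure lborel (E \<inter> {- real k..real k}) \<noteq> 0" by blast
  define A where "A = E \<inter> {- real k..real k}"
  have A [measurable]: "A \<in> sets borel" using E by (simp add: A_def)
  have A_fin: "emeasure lborel A < \<infinity>"
  proof -
    have "emeasure lborel A \<le> emeasure lborel {- real k..real k}" by (intro emeasure_mono) (auto simp: A_def)
    then show ?thesis by (auto simp: emeasure_lborel_Icc_eq intro: le_less_trans)
  qed
  define N where "N = density lborel (indicator A)"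
  have N: "emeasure N B = emeasure lborel B" if "B \<in> sets borel" "B \<subseteq> A" for B
    unfolding N_def using that
    by (subst emeasure_density) (auto simp: indicator_inter_arith[symmetric] Int_absorb1)
  have "emeasure N (space N) = emeasure lborel A"
    unfolding N_def by (subst emeasure_density) auto
  then have "emeasure N A = (SUP K \<in> {K. K \<subseteq> A \<and> compact K}. emeasure N K)"
    using A_fin by (intro inner_regular) (auto simp: N_def)
  moreover have "0 < emeasure N A" using k N[OF A] unfolding A_def[symmetric] by (simp add: zero_less_iff_neq_zero)
  ultimately obtain K where K: "compact K" "K \<subseteq> A" "0 < emeasure N K" by (auto simp: less_SUP_iff)
  define l where "l = measure lborel K"
  have Kb [measurable]: "K \<in> sets borel" using K(1) by (rule borel_compact)
  define m where "m = (\<lambda>t. indicator K t / l)"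
  have K_fin: "emeasure lborel K < \<infinity>" using emeasure_mono[OF K(2), of lborel] A_fin by (auto intro: le_less_trans)
  have l: "0 < l"
    using K(3) K_fin N[OF Kb K(2)] by (simp add: l_def measure_def enn2real_positive_iff)
  have mb: "has_bochner_integral lborel m 1"
    unfolding m_def using has_bochner_integral_divide_zero[OF has_bochner_integral_real_indicator[of K lborel], of l] K_fin l
    by (simp add: l_def)
  \<comment> \<open>The uniform density on \<open>K\<close>, its mass one balanced by a dummy atom;
    the energy formula of the locale shows that its logarithmic energy is finite.\<close>
  interpret screened_points 1 "\<lambda>_. 0" m "real k + 1" "1 / l"
  proof
    show "m t \<le> 1 / l" for t using l by (simp add: m_def indicator_def)
    show "m t = 0" if "real k + 1 < \<bar>t\<bar>" for t
    proof -
      have "- real k \<le> t \<and> t \<le> real k" if "t \<in> K" using K(2) that by (auto simp: A_def)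
      then have "t \<notin> K" using that by auto
      then show ?thesis by (simp add: m_def)
    qed
  qed (use l mb in \<open>auto simp: m_def\<close>)
  define \<nu> where "\<nu> = density lborel (\<lambda>t. ennreal (m t))"
  have mi: "(\<integral>\<^sup>+t. ennreal (m t) \<partial>lborel) = 1"
    using integrable_m m_nonneg by (simp add: nn_integral_eq_integral integral_m)
  have "prob_space \<nu>" by (rule prob_spaceI) (simp add: \<nu>_def emeasure_density mi)
  moreover have "emeasure \<nu> K = 1"
  proof -
    have "emeasure \<nu> K = (\<integral>\<^sup>+t. ennreal (m t) * indicator K t \<partial>lborel)" by (simp add: \<nu>_def emeasure_density)
    also have "\<dots> = (\<integral>\<^sup>+t. ennreal (m t) \<partial>lborel)" by (intro nn_integral_cong) (auto simp: m_def split: split_indicator)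
    finally show ?thesis using mi by simp
  qed
  ultimately have "\<nu> \<in> {\<mu>. prob_on_reals \<mu> \<and> (\<exists>K. compact K \<and> K \<subseteq> {x. \<not> P x} \<and> emeasure \<mu> K = 1)}"
    using K sub by (auto simp: prob_on_reals_def \<nu>_def A_def)
  then have "(INF \<mu> \<in> {\<mu>. prob_on_reals \<mu> \<and> (\<exists>K. compact K \<and> K \<subseteq> {x. \<not> P x} \<and> emeasure \<mu> K = 1)}. log_energy \<mu>) \<le> log_energy \<nu>"
    by (rule INF_lower)
  \<comment> \<open>An infimum below infinity makes the capacity positive or infinite, never
    0.\<close>
  also have "\<dots> < \<infinity>" unfolding \<nu>_def log_energy_eq by simp
  finally show False
    using qe unfolding quasi_everywhere_def log_capacity_def by (auto split: ereal.splits)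
qed

lemma open_emeasure_lborel_pos:
  assumes "open S" "(x::real) \<in> S"
  shows "emeasure lborel S \<noteq> 0"
proof -
  obtain e where e: "0 < e" "ball x e \<subseteq> S" using assms by (meson open_contains_ball)
  have "{x - e<..<x + e} \<subseteq> S" using e(2) by (auto simp: ball_def dist_real_def subset_iff abs_less_iff)
  then have "emeasure lborel {x - e<..<x + e} \<le> emeasure lborel S" using assms by (intro emeasure_mono) auto
  then show ?thesis using e(1) by auto
qed

lemma continuous_bounded_Icc:
  fixes f :: "real \<Rightarrow> real"
  assumes "continuous_on UNIV f"
  obtains C where "0 \<le> C" "\<And>y. y \<in> {a..b} \<Longrightarrow> \<bar>f y\<bar> \<le> C"
proof -
  have "bounded (f ` {a..b})"
    using assms by (intro compact_imp_bounded compact_continuous_image) (auto intro: continuous_on_subset)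
  then obtain C where "\<And>z. z \<in> f ` {a..b} \<Longrightarrow> \<bar>z\<bar> \<le> C" by (auto simp: bounded_iff)
  then have "\<bar>f y\<bar> \<le> \<bar>C\<bar>" if "y \<in> {a..b}" for y
    using that by (intro order_trans[OF _ abs_ge_self]) blast
  then show thesis by (intro that[of "\<bar>C\<bar>"]) auto
qed

text \<open>The equality on the support alone forces the potential to be finite somewhere, hence logarithmic
  integrability of \<open>m\<^sub>0\<close>, and then, by the growth of \<open>V\<close>, compactness of the support.\<close>

lemma robin_constant_consequences:
  fixes V :: "real \<Rightarrow> ereal" and m\<^sub>0 :: "real \<Rightarrow> real"
  assumes Vm: "\<And>t. V t \<noteq> - \<infinity>" and lsc: "lower_semicontinuous V"
    and growth: "((\<lambda>t. V t / 2 - ereal (ln \<bar>t\<bar>)) \<longlongrightarrow> \<infinity>) at_infinity"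
    and m0: "\<And>t. 0 \<le> m\<^sub>0 t" and cont: "continuous_on UNIV m\<^sub>0"
    and \<mu>: "\<mu> = density lborel (\<lambda>t. ennreal (m\<^sub>0 t))" and prob: "prob_space \<mu>"
    and robin: "robin_constant V \<mu> c"
  shows "AE x in lborel. 0 < m\<^sub>0 x \<longrightarrow> log_potential \<mu> x + V x / 2 = ereal c"
    and "\<exists>R>0. \<forall>t. R < \<bar>t\<bar> \<longrightarrow> m\<^sub>0 t = 0"
proof -
  interpret prob_space \<mu> by fact
  have [measurable]: "m\<^sub>0 \<in> borel_measurable borel" using cont by (rule borel_measurable_continuous_onI)
  have [measurable_cong]: "sets \<mu> = sets borel" by (simp add: \<mu>)
  have [measurable]: "V \<in> borel_measurable borel" by (rule lower_semicontinuous_measurable[OF lsc])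
  have [measurable]: "log_potential \<mu> \<in> borel_measurable borel"
    unfolding log_potential_def[abs_def] ereal_integral_def by measurable
  have open_pos: "open {x. 0 < m\<^sub>0 x}" using cont by (intro open_Collect_less continuous_on_const)
  have supp: "x \<in> measure_support \<mu>" if x: "0 < m\<^sub>0 x" for x
    unfolding measure_support_def
  proof (safe)
    fix S assume S: "open S" "x \<in> S"
    have "emeasure \<mu> S \<noteq> 0"
    proof
      assume "emeasure \<mu> S = 0"
      then have "(\<integral>\<^sup>+t. ennreal (m\<^sub>0 t) * indicator S t \<partial>lborel) = 0" using S by (simp add: \<mu> emeasure_density)
      then have "AE t in lborel. ennreal (m\<^sub>0 t) * indicator S t = 0" using S by (subst (asm) nn_integral_0_iff_AE) auto
      then have "AE t in lborel. t \<notin> S \<inter> {x. 0 < m\<^sub>0 x}"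
        by eventually_elim (auto split: split_indicator_asm)
      then have "emeasure lborel (S \<inter> {x. 0 < m\<^sub>0 x}) = 0"
        using S open_pos by (subst (asm) AE_iff_measurable[of "S \<inter> {x. 0 < m\<^sub>0 x}"]) auto
      then show False using open_emeasure_lborel_pos[of "S \<inter> {x. 0 < m\<^sub>0 x}" x] S x open_pos by (auto simp: open_Int)
    qed
    then show "0 < emeasure \<mu> S" by (simp add: zero_less_iff_neq_zero)
  qed
  define E where "E = {x \<in> space borel. 0 < m\<^sub>0 x \<and> log_potential \<mu> x + V x / 2 \<noteq> ereal c}"
  have E [measurable]: "E \<in> sets borel" unfolding E_def by measurable
  have "emeasure lborel E = 0"
  proof (rule quasi_everywhere_null[OF _ E])
    show "quasi_everywhere (\<lambda>x. x \<in> measure_support \<mu> \<longrightarrow> log_potential \<mu> x + V x / 2 = ereal c)"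
      using robin by (simp add: robin_constant_def)
  qed (auto simp: E_def supp)
  then have "AE x in lborel. x \<notin> E" using E by (intro AE_not_in) (auto simp: null_sets_def)
  then show ae: "AE x in lborel. 0 < m\<^sub>0 x \<longrightarrow> log_potential \<mu> x + V x / 2 = ereal c"
    by eventually_elim (auto simp: E_def)
  have "emeasure lborel {x. 0 < m\<^sub>0 x} \<noteq> 0"
  proof
    assume "emeasure lborel {x. 0 < m\<^sub>0 x} = 0"
    then have "AE x in lborel. x \<notin> {x. 0 < m\<^sub>0 x}" by (intro AE_not_in) (auto simp: null_sets_def)
    then have "AE x in lborel. ennreal (m\<^sub>0 x) = 0" by eventually_elim (simp add: not_less ennreal_neg)
    then have "(\<integral>\<^sup>+t. ennreal (m\<^sub>0 t) \<partial>lborel) = 0" by (subst nn_integral_0_iff_AE) auto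
    then show False using emeasure_space_1 by (simp add: \<mu> emeasure_density)
  qed
  \<comment> \<open>The set of positive density is not null, whereas the exceptional set
    \<open>E\<close> is.\<close>
  then obtain x0 where x0: "0 < m\<^sub>0 x0" "log_potential \<mu> x0 + V x0 / 2 = ereal c"
  proof -
    assume *: "emeasure lborel {x. 0 < m\<^sub>0 x} \<noteq> 0" and t: "\<And>x0. 0 < m\<^sub>0 x0 \<Longrightarrow> log_potential \<mu> x0 + V x0 / 2 = ereal c \<Longrightarrow> thesis"
    have "\<not> {x. 0 < m\<^sub>0 x} \<subseteq> E"
      using * emeasure_mono[of "{x. 0 < m\<^sub>0 x}" E lborel] \<open>emeasure lborel E = 0\<close> by auto
    then show thesis using t by (auto simp: E_def)
  qed
  define P where "P = (\<lambda>x. \<integral>\<^sup>+y. e2ennreal (log_kernel (x - y)) \<partial>\<mu>)"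
  define N where "N = (\<lambda>x. \<integral>\<^sup>+y. e2ennreal (- log_kernel (x - y)) \<partial>\<mu>)"
  have pot: "log_potential \<mu> x = enn2ereal (P x) - enn2ereal (N x)" for x
    by (simp add: log_potential_def ereal_integral_def P_def N_def)
  \<comment> \<open>The positive part of the kernel lives on |x0 - y| <= 1, where the density is
    bounded and the logarithm integrable.\<close>
  have P_fin: "P x0 < \<infinity>"
  proof -
    obtain C where C0: "0 \<le> C" "\<And>y. y \<in> {x0 - 1..x0 + 1} \<Longrightarrow> \<bar>m\<^sub>0 y\<bar> \<le> C"
      using continuous_bounded_Icc[OF cont] by blast
    have C: "m\<^sub>0 y \<le> C" "0 \<le> C" if "\<bar>x0 - y\<bar> \<le> 1" for y
      using C0(1) C0(2)[of y] that by (auto simp: abs_le_iff)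
    define q where "q = (\<lambda>s::real. \<bar>s\<bar> powr (-3/4) * indicator {-1..1} s)"
    have "integrable lborel q" unfolding q_def by (rule integrable_abs_powr) simp
    then have "integrable lborel (\<lambda>y. q (x0 + (-1) * y))" by (subst lborel_integrable_real_affine_iff) auto
    then have int: "integrable lborel (\<lambda>y. C * (2 * q (x0 + (-1) * y)))" by simp
    have "P x0 = (\<integral>\<^sup>+y. ennreal (m\<^sub>0 y) * e2ennreal (log_kernel (x0 - y)) \<partial>lborel)"
      unfolding P_def \<mu> by (subst nn_integral_density) auto
    also have "\<dots> \<le> (\<integral>\<^sup>+y. ennreal (C * (2 * q (x0 + (-1) * y))) \<partial>lborel)"
    proof (rule nn_integral_mono_AE)
      show "AE y in lborel. ennreal (m\<^sub>0 y) * e2ennreal (log_kernel (x0 - y)) \<le> ennreal (C * (2 * q (x0 + (-1) * y)))"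
        using AE_lborel_singleton[of x0]
      proof eventually_elim
        case (elim y)
        show ?case
        proof (cases "\<bar>x0 - y\<bar> \<le> 1")
          case True
          have "ln (\<bar>x0 - y\<bar> powr (-3/4)) \<le> \<bar>x0 - y\<bar> powr (-3/4) - 1" using elim by (intro ln_le_minus_one) auto
          moreover have "ln (\<bar>x0 - y\<bar> powr (-3/4)) = -3/4 * ln \<bar>x0 - y\<bar>" using elim by (simp add: ln_powr)
          moreover have "0 < \<bar>x0 - y\<bar> powr (-3/4)" using elim by simp
          ultimately have "- ln \<bar>x0 - y\<bar> \<le> 2 * \<bar>x0 - y\<bar> powr (-3/4)" by linarith
          also have "\<dots> = 2 * q (x0 + (-1) * y)" using True by (auto simp: q_def abs_le_iff split: split_indicator)
          finally have le: "- ln \<bar>x0 - y\<bar> \<le> 2 * q (x0 + (-1) * y)" .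
          have "ennreal (m\<^sub>0 y) * e2ennreal (log_kernel (x0 - y)) = ennreal (m\<^sub>0 y) * ennreal (- ln \<bar>x0 - y\<bar>)"
            using elim by (simp add: log_kernel_def ennreal.abs_eq)
          also have "\<dots> \<le> ennreal C * ennreal (2 * q (x0 + (-1) * y))"
            using le C(1)[OF True] by (intro mult_mono ennreal_leI) auto
          also have "\<dots> = ennreal (C * (2 * q (x0 + (-1) * y)))"
            using C0(1) by (subst ennreal_mult) (auto simp: q_def)
          finally show ?thesis .
        next
          case False
          then have "e2ennreal (log_kernel (x0 - y)) = 0"
            by (auto simp: log_kernel_def ennreal.abs_eq intro!: ennreal_neg)
          then show ?thesis by simp
        qed
      qed
    qed
    also have "\<dots> < \<infinity>" using int C0(1) by (subst nn_integral_eq_integral) (auto simp: q_def)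
    finally show ?thesis .
  qed
  \<comment> \<open>An infinite negative part would make the potential minus infinity at
    \<open>x0\<close>, and adding V / 2 could not give the real number c: in \<open>ereal\<close>
    opposite infinities add up to plus infinity.\<close>
  have N_fin: "N x0 < \<infinity>"
  proof (rule ccontr)
    assume "\<not> ?thesis"
    then have "N x0 = \<infinity>" by (simp flip: less_top)
    moreover have "enn2ereal (P x0) \<noteq> \<infinity>" using P_fin by (metis enn2ereal_eq_top_iff infinity_ennreal_def less_irrefl)
    ultimately have "log_potential \<mu> x0 = - \<infinity>" unfolding pot by (cases "enn2ereal (P x0)") auto
    then show False using x0(2) by (cases "V x0 / 2") auto
  qed
  have ln_mult_le: "ln (1 + \<bar>x - y\<bar>) \<le> ln (1 + \<bar>x\<bar>) + ln (1 + \<bar>y\<bar>)" for x y :: real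
  proof -
    have "1 + \<bar>x - y\<bar> \<le> (1 + \<bar>x\<bar>) * (1 + \<bar>y\<bar>)"
    proof -
      have "1 + \<bar>x - y\<bar> \<le> 1 + \<bar>x\<bar> + \<bar>y\<bar>" by linarith
      also have "\<dots> \<le> 1 + \<bar>x\<bar> + \<bar>y\<bar> + \<bar>x\<bar> * \<bar>y\<bar>" by simp
      finally show ?thesis by (simp add: algebra_simps)
    qed
    then have "ln (1 + \<bar>x - y\<bar>) \<le> ln ((1 + \<bar>x\<bar>) * (1 + \<bar>y\<bar>))" by (intro ln_mono) auto
    also have "\<dots> = ln (1 + \<bar>x\<bar>) + ln (1 + \<bar>y\<bar>)" by (intro ln_mult_pos) auto
    finally show ?thesis .
  qed
  have neg_kernel: "e2ennreal (- log_kernel s) \<le> ennreal (ln (1 + \<bar>s\<bar>))"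
    and ln_le_kernel: "ennreal (ln (1 + \<bar>s\<bar>)) \<le> ennreal (ln 2) + e2ennreal (- log_kernel s)" for s
  proof -
    have ek: "e2ennreal (- log_kernel s) = ennreal (ln \<bar>s\<bar>)" if "s \<noteq> 0"
      using that by (simp add: log_kernel_def ennreal.abs_eq)
    show "e2ennreal (- log_kernel s) \<le> ennreal (ln (1 + \<bar>s\<bar>))"
    proof (cases "s = 0")
      case True
      then show ?thesis by (simp add: log_kernel_def e2ennreal_neg)
    next
      case False
      then have "ln \<bar>s\<bar> \<le> ln (1 + \<bar>s\<bar>)" by (intro ln_mono) auto
      then show ?thesis unfolding ek[OF False] by (rule ennreal_leI)
    qed
    show "ennreal (ln (1 + \<bar>s\<bar>)) \<le> ennreal (ln 2) + e2ennreal (- log_kernel s)"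
    proof (cases "\<bar>s\<bar> \<le> 1")
      case True
      then have "ln (1 + \<bar>s\<bar>) \<le> ln 2" by (intro ln_mono) auto
      then show ?thesis by (intro add_increasing2 ennreal_leI) auto
    next
      case False
      have "ln (1 + \<bar>s\<bar>) \<le> ln (2 * \<bar>s\<bar>)" using False by (intro ln_mono) auto
      also have "\<dots> = ln 2 + ln \<bar>s\<bar>" using False by (intro ln_mult_pos) auto
      finally have "ennreal (ln (1 + \<bar>s\<bar>)) \<le> ennreal (ln 2 + ln \<bar>s\<bar>)" by (rule ennreal_leI)
      also have "\<dots> = ennreal (ln 2) + ennreal (ln \<bar>s\<bar>)" using False by (intro ennreal_plus) auto
      finally have "ennreal (ln (1 + \<bar>s\<bar>)) \<le> ennreal (ln 2) + ennreal (ln \<bar>s\<bar>)" .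
      moreover have "e2ennreal (- log_kernel s) = ennreal (ln \<bar>s\<bar>)" using False by (intro ek) auto
      ultimately show ?thesis by (simp only:)
    qed
  qed
  \<comment> \<open>Finiteness at the single point \<open>x0\<close> transfers to the moment of ln
    (1 + |y|), which then bounds the potential below at every x.\<close>
  have "(\<integral>\<^sup>+y. ennreal (ln (1 + \<bar>y\<bar>)) \<partial>\<mu>) \<le> (\<integral>\<^sup>+y. ennreal (ln (1 + \<bar>x0\<bar>)) + (ennreal (ln 2) + e2ennreal (- log_kernel (x0 - y))) \<partial>\<mu>)"
  proof (rule nn_integral_mono)
    fix y
    have "ennreal (ln (1 + \<bar>y\<bar>)) \<le> ennreal (ln (1 + \<bar>x0\<bar>) + ln (1 + \<bar>x0 - y\<bar>))"
      using ln_mult_le[of x0 "x0 - y"] by (intro ennreal_leI) simp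
    also have "\<dots> = ennreal (ln (1 + \<bar>x0\<bar>)) + ennreal (ln (1 + \<bar>x0 - y\<bar>))" by (rule ennreal_plus) auto
    also have "\<dots> \<le> ennreal (ln (1 + \<bar>x0\<bar>)) + (ennreal (ln 2) + e2ennreal (- log_kernel (x0 - y)))"
      by (intro add_left_mono ln_le_kernel)
    finally show "ennreal (ln (1 + \<bar>y\<bar>)) \<le> ennreal (ln (1 + \<bar>x0\<bar>)) + (ennreal (ln 2) + e2ennreal (- log_kernel (x0 - y)))" .
  qed
  also have "\<dots> = ennreal (ln (1 + \<bar>x0\<bar>)) + (ennreal (ln 2) + N x0)"
    unfolding N_def by (simp add: nn_integral_add emeasure_space_1)
  also have "\<dots> < \<infinity>" using N_fin by simp
  finally obtain b where b: "(\<integral>\<^sup>+y. ennreal (ln (1 + \<bar>y\<bar>)) \<partial>\<mu>) = ennreal b" "0 \<le> b"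
    by (cases "\<integral>\<^sup>+y. ennreal (ln (1 + \<bar>y\<bar>)) \<partial>\<mu>") auto
  have pot_ge: "ereal (- (ln (1 + \<bar>x\<bar>) + b)) \<le> log_potential \<mu> x" for x
  proof -
    have "N x \<le> (\<integral>\<^sup>+y. ennreal (ln (1 + \<bar>x\<bar>)) + ennreal (ln (1 + \<bar>y\<bar>)) \<partial>\<mu>)"
      unfolding N_def
    proof (rule nn_integral_mono)
      fix y
      have "e2ennreal (- log_kernel (x - y)) \<le> ennreal (ln (1 + \<bar>x - y\<bar>))" by (rule neg_kernel)
      also have "\<dots> \<le> ennreal (ln (1 + \<bar>x\<bar>) + ln (1 + \<bar>y\<bar>))" by (intro ennreal_leI ln_mult_le)
      also have "\<dots> = ennreal (ln (1 + \<bar>x\<bar>)) + ennreal (ln (1 + \<bar>y\<bar>))" by (rule ennreal_plus) auto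
      finally show "e2ennreal (- log_kernel (x - y)) \<le> ennreal (ln (1 + \<bar>x\<bar>)) + ennreal (ln (1 + \<bar>y\<bar>))" .
    qed
    also have "\<dots> = ennreal (ln (1 + \<bar>x\<bar>)) + ennreal b"
      by (subst nn_integral_add) (auto simp: b emeasure_space_1)
    also have "\<dots> = ennreal (ln (1 + \<bar>x\<bar>) + b)" using b(2) by (subst ennreal_plus) auto
    finally have "enn2ereal (N x) \<le> enn2ereal (ennreal (ln (1 + \<bar>x\<bar>) + b))"
      by (simp only: less_eq_ennreal.rep_eq)
    also have "\<dots> = ereal (ln (1 + \<bar>x\<bar>) + b)" using b(2) by (intro enn2ereal_ennreal) auto
    finally have "enn2ereal (N x) \<le> ereal (ln (1 + \<bar>x\<bar>) + b)" .
    then have "- ereal (ln (1 + \<bar>x\<bar>) + b) \<le> - enn2ereal (N x)" by (simp only: ereal_minus_le_minus)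
    also have "\<dots> \<le> enn2ereal (P x) - enn2ereal (N x)"
      by (cases "enn2ereal (P x)"; cases "enn2ereal (N x)") (use enn2ereal_nonneg[of "P x"] in auto)
    finally show ?thesis unfolding pot by simp
  qed
  \<comment> \<open>Threshold chosen so that -ln (1 + |t|) - b + G + ln |t| >= c for |t| >= 1, using
    ln (1 + |t|) <= ln 2 + ln |t|.\<close>
  define G where "G = c + b + ln 2"
  have "\<forall>\<^sub>F t in at_infinity. ereal G < V t / 2 - ereal (ln \<bar>t\<bar>)"
    using growth by (rule order_tendstoD) simp
  then obtain B where B: "\<And>t. B \<le> \<bar>t\<bar> \<Longrightarrow> ereal G < V t / 2 - ereal (ln \<bar>t\<bar>)"
    unfolding eventually_at_infinity by auto
  define R where "R = max B 1"
  have contra: "log_potential \<mu> t + V t / 2 \<noteq> ereal c" if t: "R < \<bar>t\<bar>" for t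
  proof
    assume eq: "log_potential \<mu> t + V t / 2 = ereal c"
    have V: "ereal G < V t / 2 - ereal (ln \<bar>t\<bar>)" using t by (intro B) (auto simp: R_def)
    have "ln (1 + \<bar>t\<bar>) \<le> ln (2 * \<bar>t\<bar>)" using t by (intro ln_mono) (auto simp: R_def)
    also have "\<dots> = ln 2 + ln \<bar>t\<bar>" using t by (intro ln_mult_pos) (auto simp: R_def)
    finally have l: "ln (1 + \<bar>t\<bar>) \<le> ln 2 + ln \<bar>t\<bar>" .
    show False
    proof (cases "V t / 2")
      case (real v)
      then have v: "G < v - ln \<bar>t\<bar>" using V by simp
      then show False using eq pot_ge[of t] l real unfolding G_def by (cases "log_potential \<mu> t") auto
    next
      case PInf
      then show False using eq pot_ge[of t] by (cases "log_potential \<mu> t") auto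
    next
      case MInf
      then show False using V by simp
    qed
  qed
  have "m\<^sub>0 t = 0" if t: "R < \<bar>t\<bar>" for t
  proof (rule ccontr)
    assume "m\<^sub>0 t \<noteq> 0"
    then have pos: "0 < m\<^sub>0 t" using m0[of t] by simp
    \<comment> \<open>A point of positive density beyond \<open>R\<close> yields a nonempty open set
      on which the equality fails everywhere, although it holds almost everywhere there.\<close>
    define S where "S = {x. 0 < m\<^sub>0 x} \<inter> {x. R < \<bar>x\<bar>}"
    have oS: "open S" unfolding S_def by (intro open_Int open_pos open_Collect_less continuous_intros)
    have "AE x in lborel. x \<notin> S" using ae by eventually_elim (use contra in \<open>auto simp: S_def\<close>)
    then have "emeasure lborel S = 0" using oS by (subst (asm) AE_iff_measurable[of S]) auto
    then show False using open_emeasure_lborel_pos[OF oS, of t] pos t by (simp add: S_def)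
  qed
  then show "\<exists>R>0. \<forall>t. R < \<bar>t\<bar> \<longrightarrow> m\<^sub>0 t = 0" by (intro exI[of _ R]) (auto simp: R_def)
qed

section \<open>The splitting formula\<close>

lemma norm_diff_real_axis: "ln (norm (q - (t, 0::real))) = lnorm (fst q - t) (snd q)"
  by (cases q) (simp add: norm_Pair ln_sqrt)

lemma grad_eq:
  assumes "GDERIV f q :> D"
  shows "grad f q = D"
  unfolding grad_def
proof (rule the_equality)
  show "GDERIV f q :> D" by fact
  fix D' assume "GDERIV f q :> D'"
  then have "(\<lambda>h. h \<bullet> D') = (\<lambda>h. h \<bullet> D)"
    using assms unfolding gderiv_def by (rule has_derivative_unique)
  then show "D' = D" by (metis vector_eq_ldot)
qed

lemma renormalized_energy_eqI:
  assumes "((\<lambda>\<eta>. truncated_energy n q E \<eta>) \<longlongrightarrow> l) (at_right 0)"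
  shows "renormalized_energy n q E = l"
  unfolding renormalized_energy_def using assms by (intro tendsto_Lim trivial_limit_at_right_real)

section \<open>The dilated configuration\<close>

locale blow_up =
  fixes n :: nat and x :: "nat \<Rightarrow> real" and m\<^sub>0 :: "real \<Rightarrow> real" and R C :: real
  assumes n: "1 \<le> n" and cont: "continuous_on UNIV m\<^sub>0" and m0: "\<And>t. 0 \<le> m\<^sub>0 t"
    and m0_le: "\<And>t. m\<^sub>0 t \<le> C" and R0: "0 < R" and m0_support: "\<And>t. R < \<bar>t\<bar> \<Longrightarrow> m\<^sub>0 t = 0"
    and mass: "has_bochner_integral lborel m\<^sub>0 1"
begin

lemma m0_measurable [measurable]: "m\<^sub>0 \<in> borel_measurable borel"
  using cont by (rule borel_measurable_continuous_onI)

text \<open>With a dummy atom at 0, this supplies the potential and energy of the undilated density;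
  the instance for the actual dilated points follows.\<close>

sublocale unit: screened_points 1 "\<lambda>_. 0" m\<^sub>0 R C
  by unfold_locales (use m0 m0_le R0 m0_support mass in auto)

abbreviation m where "m \<equiv> \<lambda>t. m\<^sub>0 (t / real n)"

lemma n_pos: "0 < real n" using n by simp

lemma scale_integral:
  fixes f :: "real \<Rightarrow> real"
  shows "(\<integral>t. f t \<partial>lborel) = real n * (\<integral>s. f (real n * s) \<partial>lborel)"
  using lborel_integral_real_affine[of "real n" f 0] n_pos by simp

sublocale screened_points n "\<lambda>i. real n * x i" m "real n * R" C
proof
  show "m t = 0" if "real n * R < \<bar>t\<bar>" for t
    using that n_pos by (intro m0_support) (simp add: field_simps)
  have "integrable lborel (\<lambda>t. m (0 + real n * t))" using mass n_pos by (simp add: has_bochner_integral_iff)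
  then have "integrable lborel m" using n_pos by (subst (asm) lborel_integrable_real_affine_iff) auto
  then show "has_bochner_integral lborel m (real n)"
    using mass n_pos scale_integral[of m] by (simp add: has_bochner_integral_iff)
qed (use m0 m0_le R0 n_pos in auto)

text \<open>Minus the logarithmic potential of the measure with density \<open>m\<^sub>0\<close>;
  likewise \<open>I\<close> is minus its logarithmic energy.\<close>

definition u :: "real \<Rightarrow> real" where "u y = (\<integral>t. m\<^sub>0 t * ln \<bar>y - t\<bar> \<partial>lborel)"

definition I :: real where "I = (\<integral>s. m\<^sub>0 s * u s \<partial>lborel)"

lemma u_eq: "u = unit.log_pot 0" by (simp add: u_def unit.log_pot_0 fun_eq_iff)

lemma u_integrable: "integrable lborel (\<lambda>s. m\<^sub>0 s * u s)"
  unfolding u_eq by (rule unit.log_pot_m_integrable) auto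

lemma log_pot_scaled: "(\<integral>t. m t * ln \<bar>real n * y - t\<bar> \<partial>lborel) = real n * (ln (real n) + u y)"
proof -
  have i: "integrable lborel (\<lambda>t. m\<^sub>0 t * ln \<bar>y - t\<bar>)"
    by (rule unit.log_integrable)
  have "(\<integral>t. m t * ln \<bar>real n * y - t\<bar> \<partial>lborel) = real n * (\<integral>s. m\<^sub>0 s * ln \<bar>real n * y - real n * s\<bar> \<partial>lborel)"
    using n_pos by (subst scale_integral) simp
  also have "(\<integral>s. m\<^sub>0 s * ln \<bar>real n * y - real n * s\<bar> \<partial>lborel) = (\<integral>s. m\<^sub>0 s * ln (real n) + m\<^sub>0 s * ln \<bar>y - s\<bar> \<partial>lborel)"
  proof (rule integral_cong_AE)
    show "AE s in lborel. m\<^sub>0 s * ln \<bar>real n * y - real n * s\<bar> = m\<^sub>0 s * ln (real n) + m\<^sub>0 s * ln \<bar>y - s\<bar>"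
      using AE_lborel_singleton[of y]
    proof eventually_elim
      case (elim s)
      have "\<bar>real n * y - real n * s\<bar> = real n * \<bar>y - s\<bar>" by (simp add: abs_mult flip: right_diff_distrib)
      then have "ln \<bar>real n * y - real n * s\<bar> = ln (real n) + ln \<bar>y - s\<bar>"
        using elim n_pos by (simp add: ln_mult_pos)
      then show ?case by (simp add: distrib_left)
    qed
  qed measurable
  also have "\<dots> = ln (real n) + u y"
    using i unit.integrable_m unit.integral_m by (simp add: u_def)
  finally show ?thesis .
qed

text \<open>Each logarithm of a dilated distance gains ln n. Counting them, point pairs give n^2 -
  n, the cross terms -2 n^2 and the density n^2; the sum -n is the origin of the term n ln n in the
  theorem.\<close>

lemma interaction_scaled:
  assumes inj: "inj_on x {1..n}"
  shows "interaction = (\<Sum>(i, j) \<in> {(i, j). i \<in> {1..n} \<and> j \<in> {1..n} \<and> i \<noteq> j}. ln \<bar>x i - x j\<bar>)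
    - real n * ln (real n) - 2 * real n * (\<Sum>i\<in>{1..n}. u (x i)) + (real n)^2 * I"
proof -
  let ?D = "{(i, j). i \<in> {1..n} \<and> j \<in> {1..n} \<and> i \<noteq> j}"
  have D: "{(i, j) \<in> {1..n} \<times> {1..n}. real n * x i \<noteq> real n * x j} = ?D"
  proof -
    have "real n * x i \<noteq> real n * x j \<longleftrightarrow> i \<noteq> j" if "i \<in> {1..n}" "j \<in> {1..n}" for i j
      using inj_on_eq_iff[OF inj that] n_pos by simp
    then show ?thesis by blast
  qed
  have card_D: "real (card ?D) = (real n)^2 - real n"
  proof -
    have "?D = {1..n} \<times> {1..n} - (\<lambda>i. (i, i)) ` {1..n}" by auto
    moreover have "card ((\<lambda>i. (i, i)) ` {1..n}) = n" by (subst card_image) (auto simp: inj_on_def)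
    ultimately have "card ?D = n * n - n" by (simp add: card_Diff_subset image_subset_iff)
    moreover have "n \<le> n * n" by simp
    ultimately show ?thesis by (simp add: of_nat_diff power2_eq_square)
  qed
  have "(\<Sum>(i, j)\<in>?D. ln \<bar>real n * x i - real n * x j\<bar>) = (\<Sum>(i, j)\<in>?D. ln (real n) + ln \<bar>x i - x j\<bar>)"
  proof (rule sum.cong[OF refl], clarify)
    fix i j assume "i \<in> {1..n}" "j \<in> {1..n}" "i \<noteq> j"
    then have "x i \<noteq> x j" using inj_on_eq_iff[OF inj] by blast
    moreover have "\<bar>real n * x i - real n * x j\<bar> = real n * \<bar>x i - x j\<bar>" by (simp add: abs_mult flip: right_diff_distrib)
    ultimately show "ln \<bar>real n * x i - real n * x j\<bar> = ln (real n) + ln \<bar>x i - x j\<bar>"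
      using n_pos by (simp add: ln_mult_pos)
  qed
  also have "\<dots> = ((real n)^2 - real n) * ln (real n) + (\<Sum>(i, j)\<in>?D. ln \<bar>x i - x j\<bar>)"
    unfolding split_beta sum.distrib sum_constant card_D[unfolded split_beta] ..
  finally have pairs: "(\<Sum>(i, j)\<in>?D. ln \<bar>real n * x i - real n * x j\<bar>) = \<dots>" .
  have "(\<integral>s. m s * (\<integral>t. m t * ln \<bar>s - t\<bar> \<partial>lborel) \<partial>lborel) = real n * (\<integral>s. m\<^sub>0 s * (\<integral>t. m t * ln \<bar>real n * s - t\<bar> \<partial>lborel) \<partial>lborel)"
    using n_pos by (subst scale_integral) simp
  also have "\<dots> = real n * (\<integral>s. (real n * ln (real n)) * m\<^sub>0 s + real n * (m\<^sub>0 s * u s) \<partial>lborel)"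
    unfolding log_pot_scaled by (simp add: algebra_simps)
  also have "\<dots> = (real n)^2 * ln (real n) + (real n)^2 * I"
    using u_integrable unit.integrable_m unit.integral_m by (simp add: I_def power2_eq_square algebra_simps)
  finally have cloud: "(\<integral>s. m s * (\<integral>t. m t * ln \<bar>s - t\<bar> \<partial>lborel) \<partial>lborel) = \<dots>" .
  show ?thesis
    unfolding interaction_def D pairs cloud log_pot_scaled sum_distrib_left[symmetric] sum.distrib
    by (simp add: power2_eq_square algebra_simps)
qed

text \<open>Makes the gradient formula for encoded charges applicable; the minus sign comes from the
  kernel -log. On the axis the integral against the density is singular and its existence is a
  separate case.\<close>

lemma blown_up_field_eq:
  "blown_up_field n m\<^sub>0 x = (\<lambda>q. - (\<integral>t. polarity t * (lnorm (fst q - position t) (snd q)) \<partial>charges))"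
proof
  fix q :: "real \<times> real"
  have ln_m: "(\<lambda>z::real\<times>real. - ln (norm (q - z))) \<in> borel_measurable borel" by measurable
  have atoms: "planar_log_conv (point_measure_sum n (blown_up_point n x)) q =
      (\<Sum>i\<in>{1..n}. - (lnorm (fst q - real n * x i) (snd q)))"
    unfolding planar_log_conv_def point_measure_sum_def
    by (subst integral_distr) (auto simp: lebesgue_integral_count_space_finite blown_up_point_def norm_diff_real_axis sum_negf sum_divide_distrib)
  have fm: "(\<lambda>z::real\<times>real. m (fst z)) \<in> borel_measurable borel"
  proof -
    have "(\<lambda>z::real\<times>real. m (fst z)) \<in> borel_measurable (borel \<Otimes>\<^sub>M borel)" by measurable
    then show ?thesis by (simp add: borel_prod)
  qed
  have dm: "(\<lambda>t. (t, 0)) \<in> lborel \<rightarrow>\<^sub>M (borel :: (real \<times> real) measure)"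
    by (simp add: borel_measurable_continuous_onI continuous_on_Pair)
  have cloud: "planar_log_conv (density delta_R (\<lambda>q. ennreal (m\<^sub>0 (fst q / real n)))) q =
      (\<integral>t. m t * - (lnorm (fst q - t) (snd q)) \<partial>lborel)"
  proof -
    have "planar_log_conv (density delta_R (\<lambda>q. ennreal (m\<^sub>0 (fst q / real n)))) q = (\<integral>z. m (fst z) * - ln (norm (q - z)) \<partial>delta_R)"
      unfolding planar_log_conv_def using ln_m fm m0
      by (subst integral_density) (auto simp: delta_R_def)
    also have "\<dots> = (\<integral>t. m (fst (t, 0::real)) * - ln (norm (q - (t, 0))) \<partial>lborel)"
      unfolding delta_R_def using ln_m fm by (intro integral_distr dm) auto
    finally show ?thesis by (simp only: norm_diff_real_axis fst_conv)
  qed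
  have int: "integrable lborel (\<lambda>t. m t * (lnorm (fst q - t) (snd q)))"
  proof (cases "snd q = 0")
    case True
    then show ?thesis using log_pot_integrable(1)[of 0 "fst q"] by simp
  next
    case False
    have "continuous_on UNIV (\<lambda>t. lnorm (fst q - t) (snd q))"
      using False by (intro continuous_intros) (auto simp: sum_power2_eq_zero_iff)
    from continuous_bounded_Icc[OF this] obtain K where K: "\<And>t. t \<in> {- (real n * R)..real n * R} \<Longrightarrow> \<bar>ln ((fst q - t)^2 + (snd q)^2) / 2\<bar> \<le> K"
      by blast
    show ?thesis
    proof (rule integrable_m_mult)
      show "\<bar>ln ((fst q - t)^2 + (snd q)^2) / 2\<bar> \<le> K" if "\<bar>t\<bar> \<le> real n * R" for t
        using that by (intro K) (auto simp: abs_le_iff)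
    qed measurable
  qed
  have "(\<integral>t. polarity t * (lnorm (fst q - position t) (snd q)) \<partial>charges) =
      (\<Sum>i\<in>{1..n}. lnorm (fst q - real n * x i) (snd q)) - (\<integral>t. m t * (lnorm (fst q - t) (snd q)) \<partial>lborel)"
    using charges_integral[OF _ int] by (simp add: has_bochner_integral_iff)
  then show "blown_up_field n m\<^sub>0 x q = - (\<integral>t. polarity t * (lnorm (fst q - position t) (snd q)) \<partial>charges)"
    unfolding blown_up_field_def atoms cloud mult_minus_right Bochner_Integration.integral_minus sum_negf by (simp add: field_simps)
qed

lemma grad_blown_up_field:
  assumes "snd q \<noteq> 0"
  shows "(norm (grad (blown_up_field n m\<^sub>0 x) q))^2 = field_sq q"
proof -
  obtain a b where q: "q = (a, b)" by (cases q)
  have "GDERIV (blown_up_field n m\<^sub>0 x) (a, b) :> - (field_x a b, field_y a b)"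
    unfolding blown_up_field_eq using assms by (intro GDERIV_minus gderiv_log_potential) (simp add: q)
  then show ?thesis unfolding q by (simp add: grad_eq field_sq_def norm_Pair)
qed

text \<open>The axis is null, so the gradient off it, where the potential is differentiable,
  determines the integral.\<close>

lemma truncated_energy_eq:
  "truncated_energy n (blown_up_point n x) (grad (blown_up_field n m\<^sub>0 x)) \<eta> =
    enn2ereal (\<integral>\<^sup>+q\<in>- discs \<eta>. ennreal (field_sq q) \<partial>lborel) / 2 + ereal (pi * real n * ln \<eta>)"
proof -
  have "(\<Union>i\<in>{1..n}. ball (blown_up_point n x i) \<eta>) = discs \<eta>" by (simp add: discs_def blown_up_point_def)
  moreover have "(\<integral>\<^sup>+q\<in>- discs \<eta>. ennreal ((norm (grad (blown_up_field n m\<^sub>0 x) q))^2) \<partial>lborel) = (\<integral>\<^sup>+q\<in>- discs \<eta>. ennreal (field_sq q) \<partial>lborel)"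
    using AE_snd_neq[of 0] by (intro nn_integral_cong_AE) (auto elim: eventually_mono simp: grad_blown_up_field)
  ultimately show ?thesis by (simp add: truncated_energy_def)
qed

end

theorem lemma1p10:
  fixes V :: "real \<Rightarrow> ereal" and \<mu>\<^sub>0 :: "real measure" and m\<^sub>0 :: "real \<Rightarrow> real"
    and c :: real and n :: nat and x :: "nat \<Rightarrow> real"
  assumes "\<And>t. V t \<noteq> - \<infinity>"
    and "lower_semicontinuous V"
    and "((\<lambda>t. V t / 2 - ereal (ln \<bar>t\<bar>)) \<longlongrightarrow> \<infinity>) at_infinity"
    and "equilibrium_measure V \<mu>\<^sub>0"
    and "\<And>t. 0 \<le> m\<^sub>0 t"
    and "\<mu>\<^sub>0 = density lborel (\<lambda>t. ennreal (m\<^sub>0 t))"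
    and "holder_continuous (1 / 2) m\<^sub>0"
    and "robin_constant V \<mu>\<^sub>0 c"
    and "1 \<le> n"
  shows "(truncated_energy n (blown_up_point n x) (grad (blown_up_field n m\<^sub>0 x))
            \<longlongrightarrow> renormalized_energy n (blown_up_point n x) (grad (blown_up_field n m\<^sub>0 x))) (at_right 0)
    \<and> hamiltonian V n x =
        ereal ((real n)\<^sup>2) * free_energy V \<mu>\<^sub>0 - ereal (real n * ln (real n))
        + ereal (1 / pi) * renormalized_energy n (blown_up_point n x) (grad (blown_up_field n m\<^sub>0 x))
        + ereal (2 * real n) * (\<Sum>i = 1..n. zeta V \<mu>\<^sub>0 c (x i))"
proof -
  have cont: "continuous_on UNIV m\<^sub>0" using assms(7) by (rule holder_continuous_imp_continuous) simp
  have [measurable]: "m\<^sub>0 \<in> borel_measurable borel" using cont by (rule borel_measurable_continuous_onI)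
  have "is_arg_min (free_energy V) prob_on_reals \<mu>\<^sub>0" using assms(4) unfolding equilibrium_measure_def by blast
  then have prob: "prob_space \<mu>\<^sub>0" by (simp add: is_arg_min_def prob_on_reals_def)
  have robin: "AE t in lborel. 0 < m\<^sub>0 t \<longrightarrow> log_potential \<mu>\<^sub>0 t + V t / 2 = ereal c"
    and "\<exists>R>0. \<forall>t. R < \<bar>t\<bar> \<longrightarrow> m\<^sub>0 t = 0"
    using robin_constant_consequences[OF assms(1-3,5) cont assms(6) prob assms(8)] by auto
  then obtain R where R: "0 < R" "\<And>t. R < \<bar>t\<bar> \<Longrightarrow> m\<^sub>0 t = 0" by blast
  obtain C where C: "0 \<le> C" "\<And>t. t \<in> {-R..R} \<Longrightarrow> \<bar>m\<^sub>0 t\<bar> \<le> C" using continuous_bounded_Icc[OF cont] by blast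
  have "(\<integral>\<^sup>+t. ennreal (m\<^sub>0 t) \<partial>lborel) = 1"
    using prob_space.emeasure_space_1[OF prob] by (simp add: assms(6) emeasure_density)
  then have mass: "has_bochner_integral lborel m\<^sub>0 1"
    using assms(5) by (intro has_bochner_integral_nn_integral) auto
  interpret blow_up n x m\<^sub>0 R C
  proof
    show "m\<^sub>0 t \<le> C" for t
    proof (cases "\<bar>t\<bar> \<le> R")
      case True
      then have "t \<in> {-R..R}" by (auto simp: abs_le_iff)
      then show ?thesis using C(2)[of t] by auto
    qed (use R C in auto)
  qed (use assms(5,9) cont R mass in auto)
  have pot: "log_potential \<mu>\<^sub>0 y = ereal (- u y)" for y
    unfolding assms(6) u_eq by (rule unit.log_potential_eq)
  have energy: "log_energy \<mu>\<^sub>0 = ereal (- I)"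
    unfolding assms(6) I_def u_eq by (rule unit.log_energy_eq)
  have V_int: "ereal_integral \<mu>\<^sub>0 V = ereal (2 * c + 2 * I)"
  proof -
    \<comment> \<open>Where the density is positive, U + V/2 = c with U = -u reads V = 2 (c + u)
      almost everywhere, and u has integral \<open>I\<close>.\<close>
    have "ereal_integral \<mu>\<^sub>0 V = ereal (\<integral>t. 2 * (c + u t) \<partial>\<mu>\<^sub>0)"
    proof (rule ereal_integral_eq)
      have "AE t in lborel. 0 < m\<^sub>0 t \<longrightarrow> V t = ereal (2 * (c + u t))"
        using robin
      proof eventually_elim
        case (elim t)
        show ?case
        proof
          assume "0 < m\<^sub>0 t"
          then have "ereal (- u t) + V t / 2 = ereal c" using elim pot by simp
          then show "V t = ereal (2 * (c + u t))" by (cases "V t") (auto simp: field_simps)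
        qed
      qed
      then show "AE t in \<mu>\<^sub>0. V t = ereal (2 * (c + u t))"
        unfolding assms(6) by (subst AE_density) auto
      have "integrable lborel (\<lambda>t. 2 * c * m\<^sub>0 t + 2 * (m\<^sub>0 t * u t))"
        using u_integrable unit.integrable_m by auto
      then show "integrable \<mu>\<^sub>0 (\<lambda>t. 2 * (c + u t))"
        unfolding assms(6) using assms(5) by (subst integrable_density) (auto simp: u_eq algebra_simps)
    qed
    also have "(\<integral>t. 2 * (c + u t) \<partial>\<mu>\<^sub>0) = (\<integral>t. 2 * c * m\<^sub>0 t + 2 * (m\<^sub>0 t * u t) \<partial>lborel)"
      unfolding assms(6) using assms(5) by (subst integral_density) (auto simp: u_eq algebra_simps)
    also have "\<dots> = 2 * c + 2 * I"
      using u_integrable unit.integrable_m unit.integral_m by (simp add: I_def)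
    finally show ?thesis .
  qed
  \<comment> \<open>Logarithmic energy -I plus the V-integral 2 c + 2 I.\<close>
  have F: "free_energy V \<mu>\<^sub>0 = ereal (2 * c + I)"
    by (simp add: free_energy_def energy V_int)
  let ?D = "{(i, j). i \<in> {1..n} \<and> j \<in> {1..n} \<and> i \<noteq> j}"
  let ?T = "truncated_energy n (blown_up_point n x) (grad (blown_up_field n m\<^sub>0 x))"
  let ?W = "renormalized_energy n (blown_up_point n x) (grad (blown_up_field n m\<^sub>0 x))"
  have finD: "finite ?D" by (rule finite_subset[of _ "{1..n} \<times> {1..n}"]) auto
  have inj_iff: "inj_on (\<lambda>i. real n * x i) {1..n} \<longleftrightarrow> inj_on x {1..n}"
    using n_pos by (auto simp: inj_on_def)
  have lim1: "(?T \<longlongrightarrow> ereal (- pi * interaction)) (at_right 0)" if "inj_on x {1..n}"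
    unfolding truncated_energy_eq[abs_def] using that inj_iff by (intro renormalized_limit(1)) simp
  have lim2: "(?T \<longlongrightarrow> \<infinity>) (at_right 0)" if "\<not> inj_on x {1..n}"
    unfolding truncated_energy_eq[abs_def] using that inj_iff by (intro renormalized_limit(2)) simp
  have W1: "?W = ereal (- pi * interaction)" if "inj_on x {1..n}"
    by (rule renormalized_energy_eqI[OF lim1[OF that]])
  have W2: "?W = \<infinity>" if "\<not> inj_on x {1..n}"
    by (rule renormalized_energy_eqI[OF lim2[OF that]])
  have "(?T \<longlongrightarrow> ?W) (at_right 0)" using lim1 lim2 W1 W2 by (cases "inj_on x {1..n}") auto
  moreover have "hamiltonian V n x = ereal ((real n)^2) * free_energy V \<mu>\<^sub>0 - ereal (real n * ln (real n))
        + ereal (1 / pi) * ?W + ereal (2 * real n) * (\<Sum>i = 1..n. zeta V \<mu>\<^sub>0 c (x i))"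
  \<comment> \<open>For distinct points with finite V all terms are real; in every other case both
    sides are infinite.\<close>
  proof (cases "inj_on x {1..n} \<and> (\<forall>i\<in>{1..n}. V (x i) \<noteq> \<infinity>)")
    case True
    then have inj: "inj_on x {1..n}" by simp
    define v where "v = (\<lambda>i. real_of_ereal (V (x i)))"
    have v: "V (x i) = ereal (v i)" if "i \<in> {1..n}" for i
      using True assms(1)[of "x i"] that by (cases "V (x i)") (auto simp: v_def)
    have "(\<Sum>(i, j)\<in>?D. log_kernel (x i - x j)) = (\<Sum>(i, j)\<in>?D. ereal (- ln \<bar>x i - x j\<bar>))"
    proof (rule sum.cong[OF refl], clarify)
      fix i j assume "i \<in> {1..n}" "j \<in> {1..n}" "i \<noteq> j"
      then have "x i \<noteq> x j" using inj_on_eq_iff[OF inj] by blast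
      then show "log_kernel (x i - x j) = ereal (- ln \<bar>x i - x j\<bar>)" by (simp add: log_kernel_def)
    qed
    then have k: "(\<Sum>(i, j)\<in>?D. log_kernel (x i - x j)) = ereal (- (\<Sum>(i, j)\<in>?D. ln \<bar>x i - x j\<bar>))"
      by (simp add: split_beta sum_negf)
    have "(\<Sum>i = 1..n. V (x i)) = (\<Sum>i = 1..n. ereal (v i))" by (intro sum.cong refl v)
    then have sV: "(\<Sum>i = 1..n. V (x i)) = ereal (\<Sum>i = 1..n. v i)" by simp
    have "(\<Sum>i = 1..n. zeta V \<mu>\<^sub>0 c (x i)) = (\<Sum>i = 1..n. ereal (- u (x i) + v i / 2 - c))"
      by (intro sum.cong refl) (simp add: zeta_def pot v)
    then have z: "(\<Sum>i = 1..n. zeta V \<mu>\<^sub>0 c (x i)) = ereal (- (\<Sum>i = 1..n. u (x i)) + (\<Sum>i = 1..n. v i) / 2 - real n * c)"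
      by (simp add: sum.distrib sum_subtractf sum_negf sum_divide_distrib)
    \<comment> \<open>The terms with I, n ln n and u cancel against those of
      \<open>interaction_scaled\<close>, and 2 c n^2 from the free energy cancels against 2 n times
      -n c from zeta.\<close>
    show ?thesis
      unfolding hamiltonian_def k sV z F W1[OF inj] interaction_scaled[OF inj]
      by (simp add: power2_eq_square algebra_simps)
  next
    case False
    have n0: "0 < ereal (real n)" "0 < ereal (2 * real n)" "0 < ereal (1 / pi)" using n_pos by auto
    have lhs: "hamiltonian V n x = \<infinity>"
    proof (cases "inj_on x {1..n}")
      case True
      then obtain i where "i \<in> {1..n}" "V (x i) = \<infinity>" using False by blast
      then have "(\<Sum>i = 1..n. V (x i)) = \<infinity>" by (intro sum_Pinfty[THEN iffD2]) auto
      then show ?thesis using n0(1) by (simp add: hamiltonian_def)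
    next
      case False
      then obtain i j where "i \<in> {1..n}" "j \<in> {1..n}" "i \<noteq> j" "x i = x j" by (auto simp: inj_on_def)
      then have "(\<Sum>(i, j)\<in>?D. log_kernel (x i - x j)) = \<infinity>"
        using finD by (intro sum_Pinfty[THEN iffD2]) (auto simp: log_kernel_def)
      then show ?thesis by (simp add: hamiltonian_def)
    qed
    have "ereal (1 / pi) * ?W = \<infinity> \<or> ereal (2 * real n) * (\<Sum>i = 1..n. zeta V \<mu>\<^sub>0 c (x i)) = \<infinity>"
    proof (cases "inj_on x {1..n}")
      case True
      then obtain i where i: "i \<in> {1..n}" "V (x i) = \<infinity>" using False by blast
      then have "zeta V \<mu>\<^sub>0 c (x i) = \<infinity>" by (simp add: zeta_def pot)
      then have "(\<Sum>i = 1..n. zeta V \<mu>\<^sub>0 c (x i)) = \<infinity>" using i by (intro sum_Pinfty[THEN iffD2]) auto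
      then show ?thesis using n0(2) by simp
    next
      case False
      then show ?thesis using W2 n0(3) by simp
    qed
    \<comment> \<open>One infinite summand decides the sum, since in \<open>ereal\<close> plus
      infinity prevails over minus infinity.\<close>
    moreover have "a - b + p + q = \<infinity>" if "p = \<infinity> \<or> q = \<infinity>" "\<bar>a\<bar> \<noteq> \<infinity>" "\<bar>b\<bar> \<noteq> \<infinity>" for a b p q :: ereal
      using that by (cases a; cases b; cases p; cases q) auto
    ultimately show ?thesis unfolding lhs F by simp
  qed
  ultimately show ?thesis by blast
qed

end
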